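(* For every integer $m\geq 1$ and every integer $N\geq 0$, \[ R_{m+2,4}(N)=\sum_{\substack{n\in \mathbb N, \; r\in \mathbb Z \\ mn/2-r+2-m/2=N \\ n \text{ odd},\; r \text{ even} \\ 4n-r^2\geq 0}} 12H^{(2)}(4n-r^2) \; + \sum_{\substack{n\in \mathbb N, \; r\in \mathbb Z \\ mn/2-r+2-m/2=N \\ n \text{ odd},\; r\text{ odd} \\ 4n-r^2\geq 0}} 12H(4n-r^2). \]
   Context: $\mathbb N=\{0,1,2,\dots\}$. For an integer $k\geq 3$ and $\ell\in\mathbb Z$, the generalized $k$-gonal number is $p_k(\ell)=\frac{(k-2)\ell^2-(k-4)\ell}{2}$. For $N\in\mathbb N$ and $t\geq 1$, $R_{k,t}(N)=\#\{(\ell_1,\dots,\ell_t)\in\mathbb Z^t: p_k(\ell_1)+\cdots+p_k(\ell_t)=N\}$. $H(D)$ is the Hurwitz class number: $H(0)=-1/12$; for $D>0$, $H(D)$ is the number of $\mathrm{SL}_2(\mathbb Z)$-equivalence classes of positive definite integral binary quadratic forms of discriminant $-D$, counted with weight $1/2$ for the class of $a(x^2+y^2)$ and $1/3$ for the class of $a(x^2+xy+y^2)$; $H(D)=0$ if $D<0$ or $D\equiv 1,2 \pmod 4$. The modified Hurwitz class number is $H^{(2)}(D)=H(4D)-2H(D)$ if $D\equiv 0,3\pmod 4$ and $H^{(2)}(D)=0$ otherwise (equivalently, for $D\equiv 0,3 \pmod 4$, $H^{(2)}(D)=H(D/4^a)\bigl(1-\bigl(\frac{-D/4^a}{2}\bigr)\bigr)$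 where $a$ is the largest integer with $D/4^a\equiv 0,3\pmod 4$). *)

theory Defs
  imports Complex_Main
begin

definition polygonal :: "int \<Rightarrow> int \<Rightarrow> int" where
  "polygonal k l = ((k - 2) * l^2 - (k - 4) * l) div 2"

text \<open>The integer division in \<^const>\<open>polygonal\<close> is exact.\<close>

lemma two_times_polygonal: "2 * polygonal k l = (k - 2) * l^2 - (k - 4) * l"
proof -
  have "even ((k - 2) * l^2 - (k - 4) * l)"
    by (cases "even k"; cases "even l") simp_all
  then show ?thesis
    unfolding polygonal_def by simp
qed

text \<open>The tuples in \<open>\<int>\<^sup>t\<close> are the integer lists of length \<open>t\<close>.  For \<open>k \<ge> 3\<close> the set
  below is finite, so \<^const>\<open>card\<close> is the true number of solutions.\<close>

definition polygonal_reps :: "int \<Rightarrow> nat \<Rightarrow> nat \<Rightarrow> nat" where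
  "polygonal_reps k t N =
     card {ls :: int list. length ls = t \<and> (\<Sum>l\<leftarrow>ls. polygonal k l) = int N}"

text \<open>The triple \<open>(a, b, c)\<close> encodes the integral binary quadratic form
  \<open>a x\<^sup>2 + b x y + c y\<^sup>2\<close>; the middle coefficient may be odd and the form need not be primitive.\<close>

type_synonym bqf = "int \<times> int \<times> int"

fun bqf_eval :: "bqf \<Rightarrow> 'a::comm_ring_1 \<Rightarrow> 'a \<Rightarrow> 'a" where
  "bqf_eval (a, b, c) x y = of_int a * x^2 + of_int b * x * y + of_int c * y^2"

fun bqf_disc :: "bqf \<Rightarrow> int" where
  "bqf_disc (a, b, c) = b^2 - 4 * a * c"

definition bqf_pos_def :: "bqf \<Rightarrow> bool" where
  "bqf_pos_def f \<longleftrightarrow> (\<forall>x y :: real. (x, y) \<noteq> (0, 0) \<longrightarrow> bqf_eval f x y > 0)"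

definition SL2Z_equiv :: "(bqf \<times> bqf) set" where
  "SL2Z_equiv = {(f, g). \<exists>p q r s :: int. p * s - q * r = 1 \<and>
     (\<forall>x y :: int. bqf_eval g x y = bqf_eval f (p * x + q * y) (r * x + s * y))}"

definition bqf_classes :: "int \<Rightarrow> bqf set set" where
  "bqf_classes D = {f. bqf_pos_def f \<and> bqf_disc f = - D} // SL2Z_equiv"

definition class_weight :: "bqf set \<Rightarrow> real" where
  "class_weight C =
     (if \<exists>a. (a, 0, a) \<in> C then 1/2 else if \<exists>a. (a, a, a) \<in> C then 1/3 else 1)"

text \<open>For \<open>D > 0\<close> there are finitely many classes, and there are none if
  \<open>D \<equiv> 1, 2 (mod 4)\<close> because a discriminant is \<open>0\<close> or \<open>1\<close> modulo \<open>4\<close>; so the convention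
  \<open>H(D) = 0\<close> for those \<open>D\<close> needs no separate case.\<close>

definition hurwitz_H :: "int \<Rightarrow> real" where
  "hurwitz_H D =
     (if D = 0 then - 1/12
      else if D > 0 then (\<Sum>C\<in>bqf_classes D. class_weight C)
      else 0)"

definition hurwitz_H2 :: "int \<Rightarrow> real" where
  "hurwitz_H2 D =
     (if D mod 4 \<in> {0, 3} then hurwitz_H (4 * D) - 2 * hurwitz_H D else 0)"

end

theory Submission
  imports Defs
begin

text \<open>
  For a tuple \<open>(l\<^sub>1, \<dots>, l\<^sub>4)\<close> put \<open>s = \<Sum>l\<^sub>i\<close>, \<open>n = \<Sum>l\<^sub>i\<^sup>2 - s + 1\<close> and \<open>r = 2 - s\<close>.  The tuples with given \<open>n\<close>
  and \<open>r\<close> correspond, by Cauchy's orthogonal change of variables, to the representations of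
  \<open>n - (r/2)\<^sup>2\<close> by three squares if \<open>r\<close> is even, and to half of those of \<open>4n - r\<^sup>2\<close>, which is 3 modulo
  8, if \<open>r\<close> is odd.  So the theorem amounts to Gauss's formula for the number of representations by
  three squares, and this is determined by its convolution with the squares, that is, by Jacobi's
  formula for four squares.

  On the class number side, reduction theory turns \<open>3 H(D)\<close> into a count of the Selling parameters
  \<open>x, y, z \<ge> 0\<close> with \<open>xy + yz + zx = D\<close>.  A fourth variable \<open>w\<^sup>2\<close> makes this a count of integral
  matrices of determinant \<open>n\<close> whose fixed point lies in one triangle of the Farey tessellation.
  Unimodular substitutions in \<open>pq + st = n\<close>, in the manner of Liouville, evaluate it as a divisor sum.

  Jacobi's formula itself follows from the recursion \<open>\<Sum>(n - 5x\<^sup>2) f(n - x\<^sup>2) = 0\<close> over all \<open>x\<close> with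
  \<open>x\<^sup>2 \<le> n\<close>.  For four squares it holds by symmetry, and for the divisor sum by a substitution in
  \<open>x\<^sup>2 + yz = n\<close> that also occurs in Zagier's windmill involution, applied with a cubic weight.
\<close>

section \<open>Sums over \<open>pq + st = n\<close>\<close>

text \<open>The (m+2)-gonal number of l is m(l^2 - l)/2 + l, so a tuple represents N = m(n - 1)/2 +
  s. This is the linear condition on (n, r), and 4n - r^2 is four times the sum of the squares minus
  s^2. A convolution with squares is inverted by induction: the square 0 isolates the largest
  argument, or the squares of 1 and -1 do when only odd roots occur. The obstacle on the class
  number side is that the substitutions act on all positive quadruples, while only elliptic
  matrices, with a fixed point in the upper half-plane, carry class numbers. The sum over hyperbolic
  matrices is never evaluated. Each region is expressed by sums over half-spaces in such a way that
  all full-dimensional sums cancel and only hyperplanes such as q = s or p = q + s + t remain. There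
  pq + st factors, hence the divisor sums. Even and odd r need different residues modulo 2; both
  weights transform alike, so the argument runs once for an abstract weight. The 5 in the recursion
  counts the squares in x^2 + a^2 + b^2 + c^2 + d^2 = n.\<close>

definition half_step :: "int \<Rightarrow> real" where
  "half_step x = (if x > 0 then 1 else if x = 0 then 1/2 else 0)"

lemma half_step_simps: "x > 0 \<Longrightarrow> half_step x = 1" "x < 0 \<Longrightarrow> half_step x = 0" "half_step 0 = 1/2"
  by (auto simp: half_step_def)

definition quads :: "int \<Rightarrow> (int \<times> int \<times> int \<times> int) set" where
  "quads n = {(p, q, s, t). 0 < p \<and> 0 < q \<and> 0 < s \<and> 0 < t \<and> p * q + s * t = n}"

definition qsum :: "int \<Rightarrow> (int \<Rightarrow> int \<Rightarrow> int \<Rightarrow> int \<Rightarrow> real) \<Rightarrow> real" where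
  "qsum n F = (\<Sum>(p, q, s, t)\<in>quads n. F p q s t)"

lemma le_mult_pos: "0 < a \<Longrightarrow> 0 < b \<Longrightarrow> a \<le> a * (b::int)"
  by (simp add: mult_le_cancel_left1)

lemma finite_quads: "finite (quads n)"
proof (rule finite_subset)
  show "quads n \<subseteq> {0..n} \<times> {0..n} \<times> {0..n} \<times> {0..n}"
  proof (clarsimp simp: quads_def, intro conjI)
    fix p q s t :: int assume *: "0 < p" "0 < q" "0 < s" "0 < t"
    have "p \<le> p * q" "q \<le> q * p" "s \<le> s * t" "t \<le> t * s" "0 < p * q" "0 < s * t"
      using * by (simp_all add: le_mult_pos)
    then show "p \<le> p * q + s * t" "q \<le> p * q + s * t" "s \<le> p * q + s * t" "t \<le> p * q + s * t"
      by (simp_all add: mult.commute)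
  qed
qed auto

lemma qsum_cong:
  assumes "\<And>p q s t. 0 < p \<Longrightarrow> 0 < q \<Longrightarrow> 0 < s \<Longrightarrow> 0 < t \<Longrightarrow> F p q s t = G p q s t"
  shows "qsum n F = qsum n G"
  unfolding qsum_def by (rule sum.cong) (auto simp: quads_def assms)

lemma qsum_add: "qsum n (\<lambda>p q s t. F p q s t + G p q s t) = qsum n F + qsum n G"
  unfolding qsum_def by (simp add: sum.distrib[symmetric] case_prod_unfold)

lemma qsum_diff: "qsum n (\<lambda>p q s t. F p q s t - G p q s t) = qsum n F - qsum n G"
  unfolding qsum_def by (simp add: sum_subtractf[symmetric] case_prod_unfold)

lemma qsum_swap_left: "qsum n (\<lambda>p q s t. F q p s t) = qsum n F"
  unfolding qsum_def
  by (rule sum.reindex_bij_witness[where i = "\<lambda>(p, q, s, t). (q, p, s, t)"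
        and j = "\<lambda>(p, q, s, t). (q, p, s, t)"]) (auto simp: quads_def algebra_simps)

lemma qsum_swap_right: "qsum n (\<lambda>p q s t. F p q t s) = qsum n F"
  unfolding qsum_def
  by (rule sum.reindex_bij_witness[where i = "\<lambda>(p, q, s, t). (p, q, t, s)"
        and j = "\<lambda>(p, q, s, t). (p, q, t, s)"]) (auto simp: quads_def algebra_simps)

lemma qsum_swap: "qsum n (\<lambda>p q s t. F s t p q) = qsum n F"
  unfolding qsum_def
  by (rule sum.reindex_bij_witness[where i = "\<lambda>(p, q, s, t). (s, t, p, q)"
        and j = "\<lambda>(p, q, s, t). (s, t, p, q)"]) (auto simp: quads_def algebra_simps)

lemma qsum_reverse: "qsum n (\<lambda>p q s t. F t s q p) = qsum n F"
  unfolding qsum_def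
  by (rule sum.reindex_bij_witness[where i = "\<lambda>(p, q, s, t). (t, s, q, p)"
        and j = "\<lambda>(p, q, s, t). (t, s, q, p)"]) (auto simp: quads_def algebra_simps)

lemma qsum_restrict:
  "qsum n (\<lambda>p q s t. of_bool (P p q s t) * F p q s t) =
    (\<Sum>(p, q, s, t)\<in>{(p, q, s, t). (p, q, s, t) \<in> quads n \<and> P p q s t}. F p q s t)"
  unfolding qsum_def
  by (rule sum.mono_neutral_cong_right) (auto simp: finite_quads)

text \<open>Adding the second column of the matrix with rows (p, -s) and (t, q) to the first keeps
  the determinant, and the image of p > s is exactly t > q.\<close>

lemma qsum_shift:
  "qsum n (\<lambda>p q s t. of_bool (p > s) * F (p - s) q s (t + q)) =
   qsum n (\<lambda>p q s t. of_bool (t > q) * F p q s t)"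
  unfolding qsum_restrict
  by (rule sum.reindex_bij_witness[where j = "\<lambda>(p, q, s, t). (p - s, q, s, t + q)"
        and i = "\<lambda>(p, q, s, t). (p + s, q, s, t - q)"])
    (auto simp: quads_def algebra_simps)

text \<open>
  The weight \<open>\<epsilon>\<close> depends only on the residues modulo 2 and is a conjugacy invariant of the matrix
  with rows \<open>(p, - s)\<close> and \<open>(t, q)\<close>; \<open>\<delta>\<close> is \<open>\<epsilon>\<close> in the coordinates in which the matrices with
  \<open>q < 0\<close> have four positive entries.
\<close>

locale parity_weight =
  fixes \<epsilon> \<delta> :: "int \<Rightarrow> int \<Rightarrow> int \<Rightarrow> int \<Rightarrow> real"
  assumes eps_swap: "\<epsilon> q p s t = \<epsilon> p q s t" "\<epsilon> p q t s = \<epsilon> p q s t"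
    and eps_conj: "\<epsilon> (p - t) (q + t) (s - p + q + t) t = \<epsilon> p q s t"
    and eps_hyp: "\<epsilon> (p - q + s + t) q (s - q) (t - q) = \<delta> p q s t"
    and eps_ell: "\<epsilon> (s + t + q - p) (- q) (q + s) (q + t) = \<delta> p q s t"
    and eps_shift: "\<epsilon> (p + s) q s (t - q) = \<delta> s t p q"
    and delta_swap: "\<delta> p q t s = \<delta> p q s t"
    and delta_shift: "\<delta> p (q - t) (s + p) t = \<epsilon> s t p q"
      "\<delta> p (q + s) s (t - p) = \<epsilon> s t p q"
      "\<delta> (p + s) q s (t - q) = \<delta> t s q p"

text \<open>
  The first weight selects, for odd determinant, the matrices of odd trace, which are the elements
  of order 3 modulo 2.  The second selects even trace, with a minus sign for scalar matrices modulo 2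
  when the determinant is odd.
\<close>

definition odd_eps :: "int \<Rightarrow> int \<Rightarrow> int \<Rightarrow> int \<Rightarrow> real" where
  "odd_eps p q s t = of_bool (odd (p + q) \<and> odd s \<and> odd t)"
definition odd_delta :: "int \<Rightarrow> int \<Rightarrow> int \<Rightarrow> int \<Rightarrow> real" where
  "odd_delta p q s t = of_bool (odd p \<and> odd (q + s) \<and> odd (q + t))"
definition even_eps :: "int \<Rightarrow> int \<Rightarrow> int \<Rightarrow> int \<Rightarrow> real" where
  "even_eps p q s t = of_bool (even (p + q)) * (1 - 2 * of_bool (even s \<and> even t))"
definition even_delta :: "int \<Rightarrow> int \<Rightarrow> int \<Rightarrow> int \<Rightarrow> real" where
  "even_delta p q s t = of_bool (even (p + s + t)) * (1 - 2 * of_bool (even (q + s) \<and> even (q + t)))"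

lemma odd_weight: "parity_weight odd_eps odd_delta"
  by unfold_locales (auto simp: odd_eps_def odd_delta_def)

lemma even_weight: "parity_weight even_eps even_delta"
  by unfold_locales (auto simp: even_eps_def even_delta_def)

context parity_weight
begin

text \<open>The fixed points are the roots of \<open>t * z^2 - (p - q) * z + s\<close>, which is
  positive at 0 and negative at 1 when p > q + s + t, so these matrices are hyperbolic. Three
  regions of the \<delta> sum turn out to have this same sum, which is what allows its
  elimination.\<close>

lemma hyperbolic_sum_1:
  "qsum n (\<lambda>p q s t. of_bool (p > q + s + t) * \<epsilon> p q s t) =
   qsum n (\<lambda>p q s t. of_bool (q < s \<and> q < t) * \<delta> p q s t)"
  unfolding qsum_restrict
  by (rule sum.reindex_bij_witness[where j = "\<lambda>(p, q, s, t). (p - q - s - t, q, q + s, q + t)"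
        and i = "\<lambda>(p, q, s, t). (p - q + s + t, q, s - q, t - q)"])
    (auto simp: quads_def algebra_simps eps_hyp[symmetric])

lemma hyperbolic_sum_2:
  "qsum n (\<lambda>p q s t. of_bool (p > q + s + t) * \<epsilon> p q s t) =
   qsum n (\<lambda>p q s t. of_bool (t < q \<and> q < s) * \<delta> p q s t)"
proof -
  have "qsum n (\<lambda>p q s t. of_bool (p > q + s + t) * \<epsilon> p q s t) =
      qsum n (\<lambda>p q s t. of_bool (q < t \<and> t < p) * \<delta> s t p q)"
    unfolding qsum_restrict
    by (rule sum.reindex_bij_witness[where j = "\<lambda>(p, q, s, t). (p - s, q, s, t + q)"
          and i = "\<lambda>(p, q, s, t). (p + s, q, s, t - q)"])
      (auto simp: quads_def algebra_simps eps_shift[symmetric])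
  also have "\<dots> = qsum n (\<lambda>p q s t. of_bool (t < q \<and> q < s) * \<delta> p q s t)"
    by (rule qsum_swap)
  finally show ?thesis .
qed

lemma hyperbolic_sum_3:
  "qsum n (\<lambda>p q s t. of_bool (p > q + s + t) * \<epsilon> p q s t) =
   qsum n (\<lambda>p q s t. of_bool (s < q \<and> q < t) * \<delta> p q s t)"
  unfolding hyperbolic_sum_2 by (subst qsum_swap_right[symmetric]) (simp add: delta_swap)

text \<open>Replacing q by q - s and t by t + p turns the two bounds on q into one lower and one
  upper bound. What the upper bound q < p + s + t cuts off is a hyperbolic part and an edge.\<close>

lemma qsum_delta_max:
  "qsum n (\<lambda>p q s t. of_bool (s < q \<and> t < q) * \<delta> p q s t) =
   qsum n (\<lambda>p q s t. of_bool (s < q \<and> q < p + s + t) * \<epsilon> p q s t)"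
proof -
  have "qsum n (\<lambda>p q s t. of_bool (s < q \<and> t < q) * \<delta> p q s t) =
      qsum n (\<lambda>p q s t. of_bool (p < t \<and> t < s + p + q) * \<epsilon> s t p q)"
    unfolding qsum_restrict
    by (rule sum.reindex_bij_witness[where j = "\<lambda>(p, q, s, t). (p, q - s, s, t + p)"
          and i = "\<lambda>(p, q, s, t). (p, q + s, s, t - p)"])
      (auto simp: quads_def algebra_simps delta_shift(2)[symmetric])
  also have "\<dots> = qsum n (\<lambda>p q s t. of_bool (s < q \<and> q < p + s + t) * \<epsilon> p q s t)"
    by (rule qsum_swap)
  finally show ?thesis .
qed

text \<open>Moving p out of s and t into q keeps pq + st. The function \<open>f\<close> stays
  general because two instances occur: the constant 1 for a half-space, and \<open>half_step\<close>
  for the excess over a triangle inequality.\<close>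

lemma qsum_delta_less:
  fixes f :: "int \<Rightarrow> real"
  shows "qsum n (\<lambda>p q s t. of_bool (p < s) * (f (s - p - t) * \<delta> p q s t)) =
    qsum n (\<lambda>p q s t. of_bool (q < t) * (f (p - q) * \<epsilon> p q s t))"
proof -
  have "qsum n (\<lambda>p q s t. of_bool (p < s) * (f (s - p - t) * \<delta> p q s t)) =
      qsum n (\<lambda>p q s t. of_bool (t < q) * (f (s - t) * \<epsilon> s t p q))"
    unfolding qsum_restrict
    by (rule sum.reindex_bij_witness[where j = "\<lambda>(p, q, s, t). (p, q + t, s - p, t)"
          and i = "\<lambda>(p, q, s, t). (p, q - t, s + p, t)"])
      (auto simp: quads_def algebra_simps delta_shift(1)[symmetric])
  also have "\<dots> = qsum n (\<lambda>p q s t. of_bool (q < t) * (f (p - q) * \<epsilon> p q s t))"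
    by (rule qsum_swap)
  finally show ?thesis .
qed

lemma qsum_eps_swap_right:
  "qsum n (\<lambda>p q s t. F p q t s * \<epsilon> p q s t) = qsum n (\<lambda>p q s t. F p q s t * \<epsilon> p q s t)"
  by (subst (2) qsum_swap_right[symmetric]) (simp add: eps_swap)

lemma qsum_eps_swap_left:
  "qsum n (\<lambda>p q s t. F q p s t * \<epsilon> p q s t) = qsum n (\<lambda>p q s t. F p q s t * \<epsilon> p q s t)"
  by (subst (2) qsum_swap_left[symmetric]) (simp add: eps_swap)

lemma qsum_delta_swap_right:
  "qsum n (\<lambda>p q s t. F p q t s * \<delta> p q s t) = qsum n (\<lambda>p q s t. F p q s t * \<delta> p q s t)"
  by (subst (2) qsum_swap_right[symmetric]) (simp add: delta_swap)

text \<open>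
  The shift takes the sum over \<open>p > s + t\<close> to the part \<open>q < t < p + q\<close> of \<open>q < t\<close>, whose complement
  \<open>t > p + q\<close> is the original sum after reversing the variables.
\<close>

lemma qsum_delta_half:
  "2 * qsum n (\<lambda>p q s t. half_step (p - s - t) * \<delta> p q s t) =
    qsum n (\<lambda>p q s t. of_bool (s < p) * \<delta> p q s t)"
proof -
  let ?X = "qsum n (\<lambda>p q s t. half_step (p - s - t) * \<delta> p q s t)"
  have "\<delta> (t + q) s q (p - s) = \<delta> p q s t" for p q s t
    using delta_shift(3)[of "p - s" s q "t + q"] by simp
  then have "?X = qsum n (\<lambda>p q s t. of_bool (p > s) *
      (half_step ((p - s) + q - (t + q)) * \<delta> (t + q) s q (p - s)))"
    by (intro qsum_cong) (simp add: half_step_def)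
  also have "\<dots> = qsum n (\<lambda>p q s t. of_bool (q < t) * (half_step (p + q - t) * \<delta> t s q p))"
    by (rule qsum_shift)
  also have "\<dots> = qsum n (\<lambda>p q s t. of_bool (q < t) * \<delta> t s q p - half_step (t - q - p) * \<delta> t s q p)"
    by (rule qsum_cong) (auto simp: half_step_def)
  also have "\<dots> = qsum n (\<lambda>p q s t. of_bool (q < t) * \<delta> t s q p) -
      qsum n (\<lambda>p q s t. half_step (t - q - p) * \<delta> t s q p)"
    by (rule qsum_diff)
  also have "qsum n (\<lambda>p q s t. of_bool (q < t) * \<delta> t s q p) =
      qsum n (\<lambda>p q s t. of_bool (s < p) * \<delta> p q s t)"
    by (rule qsum_reverse)
  also have "qsum n (\<lambda>p q s t. half_step (t - q - p) * \<delta> t s q p) = ?X"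
    using qsum_reverse[of n "\<lambda>p q s t. half_step (p - s - t) * \<delta> p q s t"] by (simp add: algebra_simps)
  finally show ?thesis by simp
qed

abbreviation edge_sum where "edge_sum n \<equiv> qsum n (\<lambda>p q s t. of_bool (p = q + s + t) * \<epsilon> p q s t)"
abbreviation hyperbolic_sum where "hyperbolic_sum n \<equiv> qsum n (\<lambda>p q s t. of_bool (p > q + s + t) *
    \<epsilon> p q s t)"

text \<open>The order of q relative to s and t dissects the sum into five regions. Three of them are
  copies of the hyperbolic sum; in the fourth, where q is largest, cutting off q \<ge> p + s + t
  takes one copy away again.\<close>

lemma delta_total:
  "qsum n \<delta> = 2 * hyperbolic_sum n + qsum n (\<lambda>p q s t. of_bool (s < q) * \<epsilon> p q s t) - edge_sum n
    + qsum n (\<lambda>p q s t. of_bool (q = s \<or> q = t) * \<delta> p q s t)"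
proof -
  have "qsum n \<delta> = qsum n (\<lambda>p q s t. of_bool (q < s \<and> q < t) * \<delta> p q s t +
      of_bool (s < q \<and> t < q) * \<delta> p q s t + of_bool (t < q \<and> q < s) * \<delta> p q s t +
      of_bool (s < q \<and> q < t) * \<delta> p q s t + of_bool (q = s \<or> q = t) * \<delta> p q s t)"
    by (rule qsum_cong) auto
  also have "\<dots> = 3 * hyperbolic_sum n + qsum n (\<lambda>p q s t. of_bool (s < q \<and> q < p + s + t) * \<epsilon> p q s t)
      + qsum n (\<lambda>p q s t. of_bool (q = s \<or> q = t) * \<delta> p q s t)"
    by (simp add: qsum_add hyperbolic_sum_1[symmetric] hyperbolic_sum_2[symmetric]
        hyperbolic_sum_3[symmetric]
        qsum_delta_max)
  also have "qsum n (\<lambda>p q s t. of_bool (s < q \<and> q < p + s + t) * \<epsilon> p q s t) =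
      qsum n (\<lambda>p q s t. of_bool (s < q) * \<epsilon> p q s t -
        of_bool (q > p + s + t) * \<epsilon> p q s t - of_bool (q = p + s + t) * \<epsilon> p q s t)"
    by (rule qsum_cong) auto
  also have "\<dots> = qsum n (\<lambda>p q s t. of_bool (s < q) * \<epsilon> p q s t) - hyperbolic_sum n - edge_sum n"
    using qsum_eps_swap_left[of n "\<lambda>p q s t. of_bool (p > q + s + t)"]
      qsum_eps_swap_left[of n "\<lambda>p q s t. of_bool (p = q + s + t)"]
    by (simp add: qsum_diff)
  finally show ?thesis by simp
qed

lemma eps_total:
  "qsum n \<epsilon> = 2 * qsum n (\<lambda>p q s t. half_step (p - q) * \<epsilon> p q s t)"
proof -
  have "qsum n \<epsilon> = qsum n (\<lambda>p q s t. half_step (p - q) * \<epsilon> p q s t + half_step (q - p) * \<epsilon> p q s t)"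
    by (rule qsum_cong) (auto simp: half_step_def)
  then show ?thesis
    using qsum_eps_swap_left[of n "\<lambda>p q s t. half_step (p - q)"] by (simp add: qsum_add)
qed

text \<open>The \<delta> sum is computed in two ways: \<open>delta_total\<close> splits by the
  position of q, while \<open>qsum_delta_half\<close> and \<open>qsum_delta_less\<close> split by
  the order of p and s. In the average, the parts s < q and q < s of the \<epsilon> sum complete
  each other to the whole sum up to q = s.\<close>

lemma delta_balance:
  "qsum n \<delta> - qsum n (\<lambda>p q s t. half_step (p - s - t) * \<delta> p q s t) - hyperbolic_sum n =
    qsum n (\<lambda>p q s t. half_step (p - q) * \<epsilon> p q s t)
    - qsum n (\<lambda>p q s t. of_bool (q = s) * \<epsilon> p q s t) / 2 - edge_sum n / 2
    + qsum n (\<lambda>p q s t. of_bool (q = s \<or> q = t) * \<delta> p q s t) / 2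
    + qsum n (\<lambda>p q s t. of_bool (p = s) * \<delta> p q s t) / 2"
proof -
  have "qsum n \<delta> = qsum n (\<lambda>p q s t. of_bool (s < p) * \<delta> p q s t + of_bool (p < s) * \<delta> p q s t
      + of_bool (p = s) * \<delta> p q s t)"
    by (rule qsum_cong) auto
  moreover have "qsum n (\<lambda>p q s t. of_bool (p < s) * \<delta> p q s t) =
      qsum n (\<lambda>p q s t. of_bool (q < s) * \<epsilon> p q s t)"
    using qsum_delta_less[of n "\<lambda>_. 1"] qsum_eps_swap_right[of n "\<lambda>p q s t. of_bool (q < s)"]
    by simp
  moreover have "qsum n \<epsilon> = qsum n (\<lambda>p q s t. of_bool (s < q) * \<epsilon> p q s t +
      of_bool (q < s) * \<epsilon> p q s t + of_bool (q = s) * \<epsilon> p q s t)"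
    by (rule qsum_cong) auto
  ultimately show ?thesis
    using qsum_delta_half[of n] delta_total[of n] eps_total[of n]
    by (simp add: qsum_add)
qed

end

section \<open>Elliptic matrices\<close>

definition divisor_pairs :: "int \<Rightarrow> (int \<times> int) set" where
  "divisor_pairs n = {(a, b). 0 < a \<and> 0 < b \<and> a * b = n}"

lemma finite_divisor_pairs: "finite (divisor_pairs n)"
proof (rule finite_subset)
  show "divisor_pairs n \<subseteq> {0..n} \<times> {0..n}"
    using le_mult_pos by (fastforce simp: divisor_pairs_def mult.commute)
qed auto

text \<open>
  In the coordinates \<open>p = w + x\<close>, \<open>q = w - x\<close>, \<open>t = x + y\<close>, \<open>s = x + z\<close> the equation reads
  \<open>w\<^sup>2 + xy + yz + zx = n\<close>, and the inequalities say that \<open>w, x, y, z \<ge> 0\<close> and \<open>w\<^sup>2 < n\<close>.  Points on an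
  edge of the triangle \<open>x, y, z \<ge> 0\<close> belong to two triangles, hence the factor 1/2 on the boundary.
\<close>

definition elliptic :: "int \<Rightarrow> (int \<times> int \<times> int \<times> int) set" where
  "elliptic n = {(p, q, s, t). 0 < s \<and> 0 < t \<and> p * q + s * t = n \<and> 0 \<le> p + q \<and> q \<le> p \<and>
     p - q \<le> 2 * s \<and> p - q \<le> 2 * t \<and> \<not> (p - q = 2 * s \<and> p - q = 2 * t)}"

definition ell_weight :: "int \<Rightarrow> int \<Rightarrow> int \<Rightarrow> int \<Rightarrow> real" where
  "ell_weight p q s t = half_step (p + q) * half_step (p - q) * half_step (2 * t - p + q) *
      half_step (2 * s - p + q)"

definition elliptic0 :: "int \<Rightarrow> (int \<times> int \<times> int) set" where
  "elliptic0 n = {(p, s, t). (s, t) \<in> divisor_pairs n \<and> 0 \<le> p \<and>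
     p \<le> 2 * s \<and> p \<le> 2 * t \<and> \<not> (p = 2 * s \<and> p = 2 * t)}"

lemma finite_elliptic0: "finite (elliptic0 n)"
proof (rule finite_subset)
  show "elliptic0 n \<subseteq> (\<lambda>(p, s, t). (p, s, t)) ` (SIGMA p:{0..2 * n}. divisor_pairs n)"
    using le_mult_pos by (fastforce simp: elliptic0_def divisor_pairs_def)
qed (simp add: finite_divisor_pairs)

lemma elliptic_pos: "{(p, q, s, t) \<in> elliptic n. 0 < q} =
   {(p, q, s, t) \<in> quads n. q \<le> p \<and> p - q \<le> 2 * s \<and> p - q \<le> 2 * t \<and> \<not> (p - q = 2 * s \<and> p - q = 2 * t)}"
  by (auto simp: elliptic_def quads_def)

lemma elliptic_zero: "{(p, q, s, t) \<in> elliptic n. q = 0} = (\<lambda>(p, s, t). (p, 0, s, t)) ` elliptic0 n"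
  by (auto simp: elliptic_def elliptic0_def divisor_pairs_def image_iff)

text \<open>The substitution is an involution preserving pq + st. It makes all four entries positive
  and turns the conditions w, y, z \<ge> 0 into the triangle inequalities for p, s, t.\<close>

lemma elliptic_neg: "{(p, q, s, t) \<in> elliptic n. q < 0 \<and> 0 < s + q \<and> 0 < t + q} =
    (\<lambda>(p, q, s, t). (s + t + q - p, - q, q + s, q + t)) `
    {(p, q, s, t) \<in> quads n. p \<le> s + t \<and> s \<le> p + t \<and> t \<le> p + s}" (is "?L = ?f ` ?R")
proof (intro equalityI subsetI)
  fix x assume x: "x \<in> ?L"
  obtain p q s t where [simp]: "x = (p, q, s, t)" by (cases x)
  have "(s + t + q - p, - q, s + q, t + q) \<in> ?R"
    using x by (auto simp: elliptic_def quads_def algebra_simps)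
  moreover have "x = ?f (s + t + q - p, - q, s + q, t + q)" by simp
  ultimately show "x \<in> ?f ` ?R" by blast
qed (auto simp: elliptic_def quads_def algebra_simps)

text \<open>From 0 \<le> p + q and p - q \<le> 2s the bound s + q \<le> 0 forces p = s = -q, that is
  w = z = 0, and then n = s(t - s).\<close>

lemma elliptic_neg_edge1: "{(p, q, s, t) \<in> elliptic n. q < 0 \<and> s + q \<le> 0} =
    (\<lambda>(a, b). (b, - b, b, a + b)) ` divisor_pairs n" (is "?L = ?f ` ?R")
proof (intro equalityI subsetI)
  fix x assume x: "x \<in> ?L"
  obtain p q s t where [simp]: "x = (p, q, s, t)" by (cases x)
  have "p = s" "q = - s" "s < t" using x by (auto simp: elliptic_def)
  then have "(t - s, s) \<in> ?R" "x = ?f (t - s, s)"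
    using x by (auto simp: elliptic_def divisor_pairs_def algebra_simps)
  then show "x \<in> ?f ` ?R" by blast
qed (auto simp: elliptic_def divisor_pairs_def algebra_simps)

lemma elliptic_neg_edge2: "{(p, q, s, t) \<in> elliptic n. q < 0 \<and> t + q \<le> 0} =
    (\<lambda>(a, b). (b, - b, a + b, b)) ` divisor_pairs n" (is "?L = ?f ` ?R")
proof (intro equalityI subsetI)
  fix x assume x: "x \<in> ?L"
  obtain p q s t where [simp]: "x = (p, q, s, t)" by (cases x)
  have "p = t" "q = - t" "t < s" using x by (auto simp: elliptic_def)
  then have "(s - t, t) \<in> ?R" "x = ?f (s - t, t)"
    using x by (auto simp: elliptic_def divisor_pairs_def algebra_simps)
  then show "x \<in> ?f ` ?R" by blast
qed (auto simp: elliptic_def divisor_pairs_def algebra_simps)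

lemma elliptic_decomp:
  "elliptic n = {(p, q, s, t) \<in> elliptic n. 0 < q} \<union> ({(p, q, s, t) \<in> elliptic n. q = 0} \<union>
    ({(p, q, s, t) \<in> elliptic n. q < 0 \<and> 0 < s + q \<and> 0 < t + q} \<union>
    ({(p, q, s, t) \<in> elliptic n. q < 0 \<and> s + q \<le> 0} \<union>
     {(p, q, s, t) \<in> elliptic n. q < 0 \<and> t + q \<le> 0})))"
  by auto

lemma finite_quads_sub: "finite {(p, q, s, t) \<in> quads n. P p q s t}"
  by (rule finite_subset[OF _ finite_quads[of n]]) auto

lemma finite_elliptic: "finite (elliptic n)"
  by (subst elliptic_decomp, unfold elliptic_pos elliptic_zero elliptic_neg elliptic_neg_edge1
      elliptic_neg_edge2)
    (intro finite_UnI finite_imageI finite_quads_sub finite_elliptic0 finite_divisor_pairs)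

lemma sum_elliptic:
  fixes F :: "int \<Rightarrow> int \<Rightarrow> int \<Rightarrow> int \<Rightarrow> real"
  shows "(\<Sum>(p, q, s, t)\<in>elliptic n. F p q s t) =
    qsum n (\<lambda>p q s t. of_bool (q \<le> p \<and> p - q \<le> 2 * s \<and> p - q \<le> 2 * t \<and>
       \<not> (p - q = 2 * s \<and> p - q = 2 * t)) * F p q s t) +
    (\<Sum>(p, s, t)\<in>elliptic0 n. F p 0 s t) +
    qsum n (\<lambda>p q s t. of_bool (p \<le> s + t \<and> s \<le> p + t \<and> t \<le> p + s) *
      F (s + t + q - p) (- q) (q + s) (q + t)) +
    (\<Sum>(a, b)\<in>divisor_pairs n. F b (- b) b (a + b) + F b (- b) (a + b) b)"
proof -
  have fin: "finite {(p, q, s, t) \<in> elliptic n. P p q s t}" for P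
    by (rule finite_subset[OF _ finite_elliptic[of n]]) auto
  have edge: "s + q > 0 \<or> t + q > 0" if "(p, q, s, t) \<in> elliptic n" "q < 0" for p q s t
    using that by (auto simp: elliptic_def)
  have disj: "{(p, q, s, t) \<in> elliptic n. q < 0 \<and> s + q \<le> 0} \<inter>
     {(p, q, s, t) \<in> elliptic n. q < 0 \<and> t + q \<le> 0} = {}"
    using edge by force
  have 1: "(\<Sum>(p, q, s, t)\<in>{(p, q, s, t) \<in> elliptic n. q < 0 \<and> 0 < s + q \<and> 0 < t + q}. F p q s t) =
      qsum n (\<lambda>p q s t. of_bool (p \<le> s + t \<and> s \<le> p + t \<and> t \<le> p + s) *
      F (s + t + q - p) (- q) (q + s) (q + t))"
    unfolding elliptic_neg qsum_restrict
    by (subst sum.reindex) (auto simp: inj_on_def case_prod_unfold intro!: sum.cong)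
  have un: "sum G (A \<union> (B \<union> (C \<union> (D \<union> E)))) = sum G A + sum G B + sum G C + (sum G D + sum G E)"
    if "finite A" "finite B" "finite C" "finite D" "finite E" "A \<inter> (B \<union> (C \<union> (D \<union> E))) = {}"
      "B \<inter> (C \<union> (D \<union> E)) = {}" "C \<inter> (D \<union> E) = {}" "D \<inter> E = {}"
    for A B C D E and G :: "int \<times> int \<times> int \<times> int \<Rightarrow> real"
    using that by (simp add: sum.union_disjoint)
  show ?thesis
    apply (subst elliptic_decomp)
    apply (subst un[OF fin fin fin fin fin _ _ _ disj])
       apply (force, force, force)
    apply (subst 1)
    unfolding elliptic_pos elliptic_zero elliptic_neg_edge1 elliptic_neg_edge2
    apply (simp add: case_prod_unfold sum.distrib qsum_restrict)
    apply (subst sum.reindex, force simp: inj_on_def)+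
    apply simp
    done
qed

context parity_weight
begin

text \<open>Everything on the right lives on a hyperplane or on q = 0: the full-dimensional sums
  from q > 0 and from q < 0 cancel by \<open>delta_balance\<close>.\<close>

lemma elliptic_sum:
  "(\<Sum>(p, q, s, t)\<in>elliptic n. ell_weight p q s t * \<epsilon> p q s t) =
    (\<Sum>(p, s, t)\<in>elliptic0 n. ell_weight p 0 s t * \<epsilon> p 0 s t) +
    (\<Sum>(a, b)\<in>divisor_pairs n. \<epsilon> b (- b) (a + b) b) / 2
    - 3 / 2 * edge_sum n
    - qsum n (\<lambda>p q s t. of_bool (q = s) * \<epsilon> p q s t) / 2
    + qsum n (\<lambda>p q s t. of_bool (q = s \<or> q = t) * \<delta> p q s t) / 2
    + qsum n (\<lambda>p q s t. of_bool (p = s) * \<delta> p q s t) / 2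
    + 2 * qsum n (\<lambda>p q s t. (of_bool (q = s) * half_step (p - q)) * \<epsilon> p q s t)"
proof -
  have conj: "\<epsilon> (p - t) (q + t) (q + (s + t) - p) t = \<epsilon> p q s t" for p q s t
    using eps_conj[of p t q s] by (simp add: algebra_simps)
  let ?e = "\<lambda>F. qsum n (\<lambda>p q s t. F p q s t * \<epsilon> p q s t)"
  \<comment> \<open>As long as p - q < s + t, at most one of y \<le> 0 and z \<le> 0 holds, so the
    parts beyond the two edges are subtracted separately. From p - q = s + t on everything is
    discarded, which costs the hyperbolic and the edge sum.\<close>
  have "qsum n (\<lambda>p q s t. of_bool (q \<le> p \<and> p - q \<le> 2 * s \<and> p - q \<le> 2 * t \<and>
       \<not> (p - q = 2 * s \<and> p - q = 2 * t)) * (ell_weight p q s t * \<epsilon> p q s t)) =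
     qsum n (\<lambda>p q s t. half_step (p - q) * \<epsilon> p q s t
       - of_bool (p - q < s + t \<and> 2 * t \<le> p - q) * (half_step (p - q - 2 * t) * \<epsilon> p q s t)
       - (of_bool (p - q < t + s \<and> 2 * s \<le> p - q) * half_step (p - q - 2 * s)) * \<epsilon> p q s t
       - of_bool (p > q + s + t) * \<epsilon> p q s t - of_bool (p = q + s + t) * \<epsilon> p q s t)"
    by (rule qsum_cong) (auto simp: half_step_def ell_weight_def)
  also have "\<dots> = ?e (\<lambda>p q s t. half_step (p - q))
      - 2 * qsum n (\<lambda>p q s t. of_bool (p - q < s + t \<and> 2 * t \<le> p - q) *
          (half_step (p - q - 2 * t) * \<epsilon> p q s t))
      - hyperbolic_sum n - edge_sum n"
    using qsum_eps_swap_right[of n "\<lambda>p q s t. of_bool (p - q < s + t \<and> 2 * t \<le> p - q) *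
        half_step (p - q - 2 * t)"]
    by (simp add: qsum_diff mult.assoc)
  \<comment> \<open>The substitution is conjugation by the translation z -> z - 1, under which
    \<epsilon> is invariant; it carries the part beyond one edge to t < q \<le> p.\<close>
  also have "qsum n (\<lambda>p q s t. of_bool (p - q < s + t \<and> 2 * t \<le> p - q) *
      (half_step (p - q - 2 * t) * \<epsilon> p q s t))
      = qsum n (\<lambda>p q s t. of_bool (t < q \<and> q \<le> p) * (half_step (p - q) * \<epsilon> p q s t))"
    unfolding qsum_restrict
    by (rule sum.reindex_bij_witness[where j = "\<lambda>(p, q, s, t). (p - t, q + t, s - p + q + t, t)"
          and i = "\<lambda>(p, q, s, t). (p + t, q - t, s + p - q + t, t)"])
      (auto simp: quads_def conj algebra_simps)
  finally have pos: "qsum n (\<lambda>p q s t. of_bool (q \<le> p \<and> p - q \<le> 2 * s \<and> p - q \<le> 2 * t \<and>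
       \<not> (p - q = 2 * s \<and> p - q = 2 * t)) * (ell_weight p q s t * \<epsilon> p q s t)) =
     ?e (\<lambda>p q s t. half_step (p - q)) - 2 * qsum n (\<lambda>p q s t. of_bool (t < q \<and> q \<le> p) *
         (half_step (p - q) * \<epsilon> p q s t))
      - hyperbolic_sum n - edge_sum n" .
  \<comment> \<open>At most one of the three triangle inequalities can fail or be an equality, so
    the weight is 1 minus three terms with disjoint supports.\<close>
  have "qsum n (\<lambda>p q s t. of_bool (p \<le> s + t \<and> s \<le> p + t \<and> t \<le> p + s) *
      (ell_weight (s + t + q - p) (- q) (q + s) (q + t) * \<epsilon> (s + t + q - p) (- q) (q + s) (q + t))) =
    qsum n (\<lambda>p q s t. \<delta> p q s t - half_step (p - s - t) * \<delta> p q s t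
      - of_bool (p < s) * (half_step (s - p - t) * \<delta> p q s t)
          - (of_bool (p < t) * half_step (t - p - s)) * \<delta> p q s t)"
    by (rule qsum_cong) (auto simp: eps_ell half_step_def ell_weight_def)
  also have "\<dots> = qsum n \<delta> - qsum n (\<lambda>p q s t. half_step (p - s - t) * \<delta> p q s t)
     - 2 * qsum n (\<lambda>p q s t. of_bool (q < t) * (half_step (p - q) * \<epsilon> p q s t))"
    using qsum_delta_swap_right[of n "\<lambda>p q s t. of_bool (p < s) * half_step (s - p - t)"]
      qsum_delta_less[of n half_step]
    by (simp add: qsum_diff mult.assoc)
  finally have neg: "qsum n (\<lambda>p q s t. of_bool (p \<le> s + t \<and> s \<le> p + t \<and> t \<le> p + s) *
      (ell_weight (s + t + q - p) (- q) (q + s) (q + t) * \<epsilon> (s + t + q - p) (- q) (q + s) (q + t))) =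
     qsum n \<delta> - qsum n (\<lambda>p q s t. half_step (p - s - t) * \<delta> p q s t)
     - 2 * qsum n (\<lambda>p q s t. of_bool (q < t) * (half_step (p - q) * \<epsilon> p q s t))" .
  have "(\<Sum>(a, b)\<in>divisor_pairs n. ell_weight b (- b) b (a + b) * \<epsilon> b (- b) b (a + b) +
      ell_weight b (- b) (a + b) b * \<epsilon> b (- b) (a + b) b) =
          (\<Sum>(a, b)\<in>divisor_pairs n. \<epsilon> b (- b) (a + b) b / 2)"
    by (rule sum.cong) (auto simp: divisor_pairs_def ell_weight_def half_step_def eps_swap)
  then have edge: "(\<Sum>(a, b)\<in>divisor_pairs n. ell_weight b (- b) b (a + b) * \<epsilon> b (- b) b (a + b) +
      ell_weight b (- b) (a + b) b * \<epsilon> b (- b) (a + b) b) =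
          (\<Sum>(a, b)\<in>divisor_pairs n. \<epsilon> b (- b) (a + b) b) / 2"
    by (simp add: sum_divide_distrib case_prod_unfold)
  have "?e (\<lambda>p q s t. half_step (p - q)) = qsum n (\<lambda>p q s t. of_bool (t < q \<and> q \<le> p) *
      (half_step (p - q) * \<epsilon> p q s t)
      + of_bool (q < t) * (half_step (p - q) * \<epsilon> p q s t) + (of_bool (q = t) * half_step (p - q)) *
          \<epsilon> p q s t)"
    by (rule qsum_cong) (auto simp: half_step_def)
  also have "\<dots> = qsum n (\<lambda>p q s t. of_bool (t < q \<and> q \<le> p) * (half_step (p - q) * \<epsilon> p q s t))
      + qsum n (\<lambda>p q s t. of_bool (q < t) * (half_step (p - q) * \<epsilon> p q s t))
      + ?e (\<lambda>p q s t. of_bool (q = s) * half_step (p - q))"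
    using qsum_eps_swap_right[of n "\<lambda>p q s t. of_bool (q = s) * half_step (p - q)"]
    by (simp add: qsum_add)
  \<comment> \<open>The regions t < q \<le> p and q < t both occur with factor -2 and add up, with q
    = t, to the half-space sum. The total coefficient of that sum is 1 - 2 + 1 = 0, the last 1
    coming from \<open>delta_balance\<close>.\<close>
  finally show ?thesis
    unfolding sum_elliptic pos neg edge using delta_balance[of n] by argo
qed

end

section \<open>Boundary terms as divisor sums\<close>

lemma divisor_pairs_swap: "(\<Sum>(a, b)\<in>divisor_pairs n. F b a) = (\<Sum>(a, b)\<in>divisor_pairs n. F a b)"
  by (rule sum.reindex_bij_witness[where i = "\<lambda>(a, b). (b, a)" and j = "\<lambda>(a, b). (b, a)"])
    (auto simp: divisor_pairs_def algebra_simps)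

text \<open>On q = s the equation reads s(p + t) = n, and \<open>k\<close> is p + t.\<close>

lemma qsum_edge1:
  "qsum n (\<lambda>p q s t. of_bool (q = s) * G p q s t) =
    (\<Sum>(s, k)\<in>divisor_pairs n. \<Sum>p\<in>{0<..<k}. G p s s (k - p))"
proof -
  have "(\<Sum>(s, k)\<in>divisor_pairs n. \<Sum>p\<in>{0<..<k}. G p s s (k - p)) =
      (\<Sum>((s, k), p)\<in>(SIGMA (s, k):divisor_pairs n. {0<..<k}). G p s s (k - p))"
    by (simp add: sum.Sigma finite_divisor_pairs case_prod_unfold)
  also have "\<dots> = qsum n (\<lambda>p q s t. of_bool (q = s) * G p q s t)"
    unfolding qsum_restrict
    by (rule sum.reindex_bij_witness[where i = "\<lambda>(p, q, s, t). ((s, p + t), p)"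
          and j = "\<lambda>((s, k), p). (p, s, s, k - p)"])
      (auto simp: quads_def divisor_pairs_def algebra_simps)
  finally show ?thesis by simp
qed

lemma qsum_edge2:
  "qsum n (\<lambda>p q s t. of_bool (p = s) * G p q s t) =
    (\<Sum>(s, k)\<in>divisor_pairs n. \<Sum>q\<in>{0<..<k}. G s q s (k - q))"
  using qsum_swap_left[of n "\<lambda>p q s t. of_bool (q = s) * G q p s t"]
  by (simp add: qsum_edge1)

text \<open>If p = q + s + t, then pq + st = (q + s)(q + t), and \<open>a\<close>, \<open>b\<close>
  are these factors.\<close>

lemma qsum_edge3:
  "qsum n (\<lambda>p q s t. of_bool (p = q + s + t) * G p q s t) =
    (\<Sum>(a, b)\<in>divisor_pairs n. \<Sum>q\<in>{0<..<min a b}. G (a + b - q) q (a - q) (b - q))"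
proof -
  have "(\<Sum>(a, b)\<in>divisor_pairs n. \<Sum>q\<in>{0<..<min a b}. G (a + b - q) q (a - q) (b - q)) =
      (\<Sum>((a, b), q)\<in>(SIGMA (a, b):divisor_pairs n. {0<..<min a b}). G (a + b - q) q (a - q) (b - q))"
    by (simp add: sum.Sigma finite_divisor_pairs case_prod_unfold)
  also have "\<dots> = qsum n (\<lambda>p q s t. of_bool (p = q + s + t) * G p q s t)"
    unfolding qsum_restrict
    by (rule sum.reindex_bij_witness[where i = "\<lambda>(p, q, s, t). ((q + s, q + t), q)"
          and j = "\<lambda>((a, b), q). (a + b - q, q, a - q, b - q)"])
      (auto simp: quads_def divisor_pairs_def algebra_simps)
  finally show ?thesis by simp
qed

text \<open>With q = 0 the equation is st = n. The upper end p = 2 * min s t is excluded exactly for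
  s = t, where y and z would both vanish.\<close>

lemma sum_elliptic0:
  fixes F :: "int \<Rightarrow> int \<Rightarrow> int \<Rightarrow> real"
  shows "(\<Sum>(p, s, t)\<in>elliptic0 n. F p s t) =
    (\<Sum>(s, t)\<in>divisor_pairs n. F 0 s t + (\<Sum>p\<in>{0<..<2 * min s t}. F p s t)
      + of_bool (s \<noteq> t) * F (2 * min s t) s t)"
proof -
  let ?P = "\<lambda>s t. {p. 0 \<le> p \<and> p \<le> 2 * s \<and> p \<le> 2 * t \<and> \<not> (p = 2 * s \<and> p = 2 * t)} :: int set"
  have fin: "finite (?P s t)" for s t by (rule finite_subset[of _ "{0..2*s}"]) auto
  have "(\<Sum>(p, s, t)\<in>elliptic0 n. F p s t) = (\<Sum>((s, t),
      p)\<in>(SIGMA (s, t):divisor_pairs n. ?P s t). F p s t)"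
    by (rule sum.reindex_bij_witness[where i = "\<lambda>((s, t), p). (p, s, t)"
          and j = "\<lambda>(p, s, t). ((s, t), p)"]) (auto simp: elliptic0_def)
  also have "\<dots> = (\<Sum>(s, t)\<in>divisor_pairs n. \<Sum>p\<in>?P s t. F p s t)"
    using fin by (simp add: sum.Sigma finite_divisor_pairs case_prod_unfold)
  also have "\<dots> = (\<Sum>(s, t)\<in>divisor_pairs n. F 0 s t + (\<Sum>p\<in>{0<..<2 * min s t}. F p s t)
      + of_bool (s \<noteq> t) * F (2 * min s t) s t)"
  proof (rule sum.cong[OF refl])
    fix x assume x: "x \<in> divisor_pairs n"
    obtain s t where [simp]: "x = (s, t)" by (cases x)
    have st: "0 < s" "0 < t" using x by (auto simp: divisor_pairs_def)
    have "?P s t = insert 0 ({0<..<2 * min s t} \<union> (if s \<noteq> t then {2 * min s t} else {}))"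
      using st by auto
    moreover have "0 \<notin> {0<..<2 * min s t} \<union> (if s \<noteq> t then {2 * min s t} else {})"
      using st by (auto simp: min_def)
    ultimately have "(\<Sum>p\<in>?P s t. F p s t) = F 0 s t + (\<Sum>p\<in>{0<..<2 * min s t}. F p s t)
      + of_bool (s \<noteq> t) * F (2 * min s t) s t"
      by simp
    then show "(case x of (s, t) \<Rightarrow> \<Sum>p\<in>?P s t. F p s t) =
      (case x of (s, t) \<Rightarrow> F 0 s t + (\<Sum>p\<in>{0<..<2 * min s t}. F p s t)
      + of_bool (s \<noteq> t) * F (2 * min s t) s t)"
      by (simp only: \<open>x = (s, t)\<close> prod.case)
  qed
  finally show ?thesis .
qed

lemma sum_step:
  fixes F :: "int \<Rightarrow> real"
  assumes "k > 0"
  shows "(\<Sum>p\<in>{0<..<k + 1}. F p) = (\<Sum>p\<in>{0<..<k}. F p) + F k"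
proof -
  have "{0<..<k + 1} = insert k {0<..<k}" using assms by auto
  then show ?thesis by simp
qed

lemma interval_1: "{0<..<1::int} = {}"
  by auto

lemma sum_alternating:
  "k \<ge> 1 \<Longrightarrow> (\<Sum>p\<in>{0<..<k::int}. if even p then 1 else - 1 :: real) = - of_bool (even k)"
  by (induction k rule: int_ge_induct) (auto simp: sum_step interval_1)

lemma count_parity:
  "m \<ge> 1 \<Longrightarrow> (\<Sum>p\<in>{0<..<2 * m::int}. of_bool (even p) :: real) = of_int m - 1 \<and>
    (\<Sum>p\<in>{0<..<2 * m}. of_bool (odd p) :: real) = of_int m"
proof (induction m rule: int_ge_induct)
  case base
  have "{0<..<2::int} = {1}" by auto
  then show ?case by simp
next
  case (step m)
  have *: "2 * (m + 1) = 2 * m + 1 + 1" by simp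
  have m: "2 * m + 1 > 0" "2 * m > 0" using step by auto
  show ?case
    unfolding * sum_step[OF m(1)] sum_step[OF m(2)] using step by (simp del: sum_of_bool_eq)
qed

text \<open>Only the parity of \<open>c\<close> matters: it is 1 for the weight of odd trace and 0
  for that of even trace. The value 1/2 at p = s is met only for even \<open>c\<close>, hence the
  two different corrections.\<close>

lemma count_half:
  assumes "k \<ge> 1" "s \<ge> 1"
  shows "2 * (\<Sum>p\<in>{0<..<k::int}. of_bool (even (p + s + c)) * half_step (p - s)) =
    (if s < k then of_int (k - s) - (if even c then of_bool (even (k + s))
        else of_bool (odd (k + s))) else 0)"
proof (cases "s \<le> k")
  case True
  then show ?thesis
  proof (induction k rule: int_ge_induct)
    case base
    have "(\<Sum>p\<in>{0<..<s::int}. of_bool (even (p + s + c)) * half_step (p - s)) = (\<Sum>p\<in>{0<..<s::int}. 0)"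
      by (rule sum.cong) (auto simp: half_step_def)
    then show ?case by simp
  next
    case (step k)
    then show ?case using assms
      by (cases "even c"; cases "even s"; cases "even k")
          (auto simp: sum_step half_step_def simp del: sum_of_bool_eq sum_of_bool_mult_eq)
  qed
next
  case False
  then have "(\<Sum>p\<in>{0<..<k::int}. of_bool (even (p + s + c)) * half_step (p - s)) = (\<Sum>p\<in>{0<..<k::int}. 0)"
    by (intro sum.cong) (auto simp: half_step_def)
  then show ?thesis using False by simp
qed

text \<open>The line q = 0 contributes min s k and the hyperplane q = s the positive part of k - s;
  together these are k. The other boundary terms vanish by parity or cancel in pairs.\<close>

lemma odd_elliptic_sum:
  assumes "odd n"
  shows "(\<Sum>(p, q, s, t)\<in>elliptic n. ell_weight p q s t * odd_eps p q s t) =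
    (\<Sum>(s, k)\<in>divisor_pairs n. of_int k)"
proof -
  interpret parity_weight odd_eps odd_delta by (rule odd_weight)
  have odd: "odd s" "odd k" "0 < s" "0 < k" if "(s, k) \<in> divisor_pairs n" for s k
    using that assms by (auto simp: divisor_pairs_def)
  have e0: "(\<Sum>(p, s, t)\<in>elliptic0 n. ell_weight p 0 s t * odd_eps p 0 s t) =
      (\<Sum>(s, t)\<in>divisor_pairs n. of_int (min s t))"
    unfolding sum_elliptic0
  proof (rule sum.cong[OF refl], clarify)
    fix s t assume st: "(s, t) \<in> divisor_pairs n"
    have "(\<Sum>p\<in>{0<..<2 * min s t}. ell_weight p 0 s t * odd_eps p 0 s t) =
        (\<Sum>p\<in>{0<..<2 * min s t}. of_bool (odd p))"
      using odd[OF st] by (intro sum.cong) (auto simp: ell_weight_def half_step_def odd_eps_def)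
    also have "\<dots> = of_int (min s t)"
      using odd[OF st] by (intro conjunct2[OF count_parity]) auto
    finally show "ell_weight 0 0 s t * odd_eps 0 0 s t +
        (\<Sum>p\<in>{0<..<2 * min s t}. ell_weight p 0 s t * odd_eps p 0 s t)
      + of_bool (s \<noteq> t) * (ell_weight (2 * min s t) 0 s t * odd_eps (2 * min s t) 0 s t) =
          of_int (min s t)"
      by (simp only:) (simp add: odd_eps_def)
  qed
  have e1: "(\<Sum>(a, b)\<in>divisor_pairs n. odd_eps b (- b) (a + b) b) = 0"
    by (rule sum.neutral) (auto simp: odd_eps_def)
  have e2: "edge_sum n = qsum n (\<lambda>p q s t. 0)"
    by (rule qsum_cong) (auto simp: odd_eps_def)
  have e3: "qsum n (\<lambda>p q s t. of_bool (q = s \<or> q = t) * odd_delta p q s t) = qsum n (\<lambda>p q s t. 0)"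
    by (rule qsum_cong) (auto simp: odd_delta_def)
  have e4: "qsum n (\<lambda>p q s t. of_bool (p = s) * odd_delta p q s t) =
      qsum n (\<lambda>p q s t. of_bool (q = s) * odd_eps p q s t)"
    unfolding qsum_edge1 qsum_edge2
    by (intro sum.cong refl, clarify, intro sum.cong refl)
      (drule odd, auto simp: odd_eps_def odd_delta_def dest: odd)
  have e5: "2 * qsum n (\<lambda>p q s t. (of_bool (q = s) * half_step (p - q)) * odd_eps p q s t) =
      (\<Sum>(s, k)\<in>divisor_pairs n. if s < k then of_int (k - s) else 0)"
    unfolding mult.assoc qsum_edge1 sum_distrib_left
  proof (rule sum.cong[OF refl], clarify)
    fix s k assume sk: "(s, k) \<in> divisor_pairs n"
    have "(\<Sum>p\<in>{0<..<k}. half_step (p - s) * odd_eps p s s (k - p)) =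
       (\<Sum>p\<in>{0<..<k}. of_bool (even (p + s + 1)) * half_step (p - s))"
      using odd[OF sk] by (intro sum.cong) (auto simp: odd_eps_def)
    then have "2 * (\<Sum>p\<in>{0<..<k}. half_step (p - s) * odd_eps p s s (k - p)) =
        (if s < k then of_int (k - s) else 0)"
      using count_half[of k s 1] odd[OF sk] by simp
    then show "2 * (\<Sum>p\<in>{0<..<k}. half_step (p - s) * odd_eps p s s (k - p)) =
        (if s < k then of_int (k - s) else 0)" .
  qed
  have "(\<Sum>(s, t)\<in>divisor_pairs n. of_int (min s t)) +
      (\<Sum>(s, k)\<in>divisor_pairs n. if s < k then of_int (k - s) else 0)
     = (\<Sum>(s, k)\<in>divisor_pairs n. real_of_int k)"
    unfolding sum.distrib[symmetric] by (rule sum.cong) auto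
  then show ?thesis
    unfolding elliptic_sum e0 e1 e2 e3 e4 e5 by (simp add: qsum_def)
qed

definition psign :: "int \<Rightarrow> int \<Rightarrow> real" where
  "psign y z = (if even y \<and> even z then - 1 else 1)"

lemma sum_symmetrize:
  assumes "\<And>a b. (a, b) \<in> divisor_pairs n \<Longrightarrow> F a b + F b a = G a b + (G b a :: real)"
  shows "(\<Sum>(a, b)\<in>divisor_pairs n. F a b) = (\<Sum>(a, b)\<in>divisor_pairs n. G a b)"
proof -
  have "(\<Sum>(a, b)\<in>divisor_pairs n. F a b + F b a) = (\<Sum>(a, b)\<in>divisor_pairs n. G a b + G b a)"
    by (rule sum.cong) (use assms in auto)
  then show ?thesis
    using divisor_pairs_swap[of F n] divisor_pairs_swap[of G n]
        by (simp add: case_prod_unfold sum.distrib)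
qed

text \<open>The boundary terms match the right-hand side only after adding the swapped divisor pair,
  hence \<open>sum_symmetrize\<close> in \<open>main\<close>. The defect 1/4 at s = k occurs when n
  is a square and is later balanced by the terms w^2 = n, where H(0) enters.\<close>

lemma even_elliptic_sum:
  "(\<Sum>(p, q, s, t)\<in>elliptic n. ell_weight p q s t * even_eps p q s t) =
    (\<Sum>(s, k)\<in>divisor_pairs n. psign s k * of_int k - of_bool (s = k) / 4)"
proof -
  interpret parity_weight even_eps even_delta by (rule even_weight)
  have pos: "0 < s" "0 < k" if "(s, k) \<in> divisor_pairs n" for s k
    using that by (auto simp: divisor_pairs_def)
  have e0: "(\<Sum>(p, s, t)\<in>elliptic0 n. ell_weight p 0 s t * even_eps p 0 s t) =
      (\<Sum>(s, t)\<in>divisor_pairs n. psign s t * (of_int (min s t) - 1 / 4 - of_bool (s = t) / 2))"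
    unfolding sum_elliptic0
  proof (rule sum.cong[OF refl], clarify)
    fix s t assume st: "(s, t) \<in> divisor_pairs n"
    have "(\<Sum>p\<in>{0<..<2 * min s t}. ell_weight p 0 s t * even_eps p 0 s t) =
        (\<Sum>p\<in>{0<..<2 * min s t}. psign s t * of_bool (even p))"
      using pos[OF st] by (intro sum.cong) (auto simp: ell_weight_def half_step_def even_eps_def psign_def)
    also have "\<dots> = psign s t * (of_int (min s t) - 1)"
      unfolding sum_distrib_left[symmetric]
      using pos[OF st] by (subst conjunct1[OF count_parity]) auto
    finally show "ell_weight 0 0 s t * even_eps 0 0 s t +
        (\<Sum>p\<in>{0<..<2 * min s t}. ell_weight p 0 s t * even_eps p 0 s t)
      + of_bool (s \<noteq> t) * (ell_weight (2 * min s t) 0 s t * even_eps (2 * min s t) 0 s t) =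
      psign s t * (of_int (min s t) - 1 / 4 - of_bool (s = t) / 2)"
      using pos[OF st] by (simp only:) (auto simp: even_eps_def ell_weight_def half_step_def psign_def min_def field_simps)
  qed
  have e1: "(\<Sum>(a, b)\<in>divisor_pairs n. even_eps b (- b) (a + b) b) = (\<Sum>(a, b)\<in>divisor_pairs n. psign a b)"
    by (rule sum.cong) (auto simp: even_eps_def psign_def)
  have e2: "edge_sum n = (\<Sum>(a, b)\<in>divisor_pairs n. of_bool (even a \<and> even b))"
    unfolding qsum_edge3
  proof (rule sum.cong[OF refl], clarify)
    fix a b assume ab: "(a, b) \<in> divisor_pairs n"
    let ?c = "if even (a + b) then if even a then - 1 else 1 else 0 :: real"
    have "(\<Sum>q\<in>{0<..<min a b}. even_eps (a + b - q) q (a - q) (b - q)) =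
        (\<Sum>q\<in>{0<..<min a b}. ?c * (if even q then 1 else - 1))"
      by (intro sum.cong) (auto simp: even_eps_def)
    also have "\<dots> = ?c * - of_bool (even (min a b))"
      unfolding sum_distrib_left[symmetric] using pos[OF ab] by (subst sum_alternating) auto
    also have "\<dots> = of_bool (even a \<and> even b)" by (auto simp: min_def)
    finally show "(\<Sum>q\<in>{0<..<min a b}. even_eps (a + b - q) q (a - q) (b - q)) =
      of_bool (even a \<and> even b)" .
  qed
  have e3: "qsum n (\<lambda>p q s t. of_bool (q = s \<or> q = t) * even_delta p q s t) =
     (\<Sum>(s, k)\<in>divisor_pairs n. 2 * of_bool (even s \<and> even k) + of_bool (s < k \<and> even (s + k)))"
  proof -
    have "qsum n (\<lambda>p q s t. of_bool (q = s \<or> q = t) * even_delta p q s t) =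
       qsum n (\<lambda>p q s t. of_bool (q = s) * even_delta p q s t + of_bool (q = t) * even_delta p q s t
         - of_bool (q = s) * (of_bool (q = t) * even_delta p q s t))"
      by (rule qsum_cong) auto
    also have "\<dots> = 2 * qsum n (\<lambda>p q s t. of_bool (q = s) * even_delta p q s t)
        - qsum n (\<lambda>p q s t. of_bool (q = s) * (of_bool (q = t) * even_delta p q s t))"
      using qsum_delta_swap_right[of n "\<lambda>p q s t. of_bool (q = s)"] by (simp add: qsum_diff qsum_add)
    also have "qsum n (\<lambda>p q s t. of_bool (q = s) * even_delta p q s t) =
        (\<Sum>(s, k)\<in>divisor_pairs n. of_bool (even s \<and> even k))"
      unfolding qsum_edge1
    proof (rule sum.cong[OF refl], clarify)
      fix s k assume sk: "(s, k) \<in> divisor_pairs n"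
      have "(\<Sum>p\<in>{0<..<k}. even_delta p s s (k - p)) =
          (\<Sum>p\<in>{0<..<k}. - of_bool (even (s + k)) * (if even p then 1 else - 1))"
        by (intro sum.cong) (auto simp: even_delta_def)
      also have "\<dots> = - of_bool (even (s + k)) * - of_bool (even k)"
        unfolding sum_distrib_left[symmetric] using pos[OF sk] by (subst sum_alternating) auto
      finally show "(\<Sum>p\<in>{0<..<k}. even_delta p s s (k - p)) = of_bool (even s \<and> even k)"
        by auto
    qed
    also have "qsum n (\<lambda>p q s t. of_bool (q = s) * (of_bool (q = t) * even_delta p q s t)) =
        (\<Sum>(s, k)\<in>divisor_pairs n. - of_bool (s < k \<and> even (s + k)))"
      unfolding qsum_edge1
    proof (rule sum.cong[OF refl], clarify)
      fix s k assume sk: "(s, k) \<in> divisor_pairs n"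
      have "(\<Sum>p\<in>{0<..<k}. of_bool (s = k - p) * even_delta p s s (k - p)) =
          (\<Sum>p\<in>{0<..<k}. if p = k - s then - of_bool (even (s + k)) else 0)"
        by (intro sum.cong) (auto simp: even_delta_def)
      also have "\<dots> = - of_bool (s < k \<and> even (s + k))"
        using pos[OF sk] by (subst sum.delta) auto
      finally show "(\<Sum>p\<in>{0<..<k}. of_bool (s = k - p) * even_delta p s s (k - p)) =
        - of_bool (s < k \<and> even (s + k))" .
    qed
    finally show ?thesis
      by (simp add: sum_distrib_left sum_negf case_prod_unfold sum.distrib)
  qed
  have e4: "qsum n (\<lambda>p q s t. of_bool (p = s) * even_delta p q s t) =
      qsum n (\<lambda>p q s t. of_bool (q = s) * even_eps p q s t)
      - (\<Sum>(s, k)\<in>divisor_pairs n. of_bool (odd s \<and> even k))"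
    unfolding qsum_edge1 qsum_edge2 sum_subtractf[symmetric]
  proof (rule sum.cong[OF refl], clarify)
    fix s k assume sk: "(s, k) \<in> divisor_pairs n"
    let ?c = "if even (s + k) then 0 else if odd s then 1 else - 1 :: real"
    have "(\<Sum>q\<in>{0<..<k}. even_delta s q s (k - q)) =
       (\<Sum>p\<in>{0<..<k}. even_eps p s s (k - p) + ?c * (if even p then 1 else - 1))"
      by (intro sum.cong) (auto simp: even_eps_def even_delta_def)
    also have "\<dots> = (\<Sum>p\<in>{0<..<k}. even_eps p s s (k - p)) + ?c * - of_bool (even k)"
      unfolding sum_distrib_left[symmetric] sum.distrib using pos[OF sk] by (subst sum_alternating) auto
    finally show "(\<Sum>q\<in>{0<..<k}. even_delta s q s (k - q)) =
       (\<Sum>p\<in>{0<..<k}. even_eps p s s (k - p)) - of_bool (odd s \<and> even k)"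
      by (auto split: if_splits)
  qed
  have e5: "2 * qsum n (\<lambda>p q s t. (of_bool (q = s) * half_step (p - q)) * even_eps p q s t) =
      (\<Sum>(s, k)\<in>divisor_pairs n. psign s k * (if s < k then of_int (k - s) - of_bool (even (s + k))
          else 0))"
    unfolding mult.assoc qsum_edge1 sum_distrib_left
  proof (rule sum.cong[OF refl], clarify)
    fix s k assume sk: "(s, k) \<in> divisor_pairs n"
    have "(\<Sum>p\<in>{0<..<k}. half_step (p - s) * even_eps p s s (k - p)) =
       (\<Sum>p\<in>{0<..<k}. psign s k * (of_bool (even (p + s + 0)) * half_step (p - s)))"
      by (intro sum.cong) (auto simp: even_eps_def psign_def)
    also have "\<dots> = psign s k * (\<Sum>p\<in>{0<..<k}. of_bool (even (p + s + 0)) * half_step (p - s))"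
      by (simp only: sum_distrib_left)
    finally show "2 * (\<Sum>p\<in>{0<..<k}. half_step (p - s) * even_eps p s s (k - p)) =
        psign s k * (if s < k then of_int (k - s) - of_bool (even (s + k)) else 0)"
      using count_half[of k s 0] pos[OF sk] by (simp add: add.commute)
  qed
  have main: "(\<Sum>(s, k)\<in>divisor_pairs n. psign s k * (of_int (min s k) - 1 / 4 - of_bool (s = k) / 2)
      + psign s k / 2 - 3 / 2 * of_bool (even s \<and> even k) - of_bool (odd s \<and> even k) / 2
      + (2 * of_bool (even s \<and> even k) + of_bool (s < k \<and> even (s + k))) / 2
      + psign s k * (if s < k then of_int (k - s) - of_bool (even (s + k)) else 0)) =
    (\<Sum>(s, k)\<in>divisor_pairs n. psign s k * of_int k - of_bool (s = k) / 4)"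
    by (rule sum_symmetrize) (auto simp: psign_def min_def)
  have gen: "(\<Sum>(s, k)\<in>divisor_pairs n. a s k + b s k / 2 - 3 / 2 * c s k - d s k / 2 + e s k / 2 +
      f s k) =
      (\<Sum>(s, k)\<in>divisor_pairs n. a s k) + (\<Sum>(s, k)\<in>divisor_pairs n. b s k) / 2
      - 3 / 2 * (\<Sum>(s, k)\<in>divisor_pairs n. c s k) - (\<Sum>(s, k)\<in>divisor_pairs n. d s k) / 2
      + (\<Sum>(s, k)\<in>divisor_pairs n. e s k) / 2 + (\<Sum>(s, k)\<in>divisor_pairs n. f s k)"
    for a b c d e f :: "int \<Rightarrow> int \<Rightarrow> real"
    by (simp add: case_prod_unfold sum.distrib sum_subtractf sum_divide_distrib sum_distrib_left)
  show ?thesis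
    unfolding elliptic_sum e0 e1 e2 e3 e4 e5 using main[unfolded gen] by argo
qed

section \<open>Four squares\<close>

definition windmill :: "int \<Rightarrow> (int \<times> int \<times> int) set" where
  "windmill n = {(x, y, z). 0 < y \<and> 0 < z \<and> x^2 + y * z = n}"

definition roots_upto :: "int \<Rightarrow> int set" where
  "roots_upto n = {x. x^2 \<le> n}"

lemma abs_le_square: "\<bar>x\<bar> \<le> (x::int)^2"
  using mult_mono[of 1 "\<bar>x\<bar>" "\<bar>x\<bar>" "\<bar>x\<bar>"] by (cases "x = 0") (auto simp: power2_eq_square)

lemma finite_roots_upto: "finite (roots_upto n)"
proof (rule finite_subset)
  show "roots_upto n \<subseteq> {- n..n}"
  proof
    fix x assume "x \<in> roots_upto n"
    then have "\<bar>x\<bar> \<le> n" using abs_le_square[of x] by (simp add: roots_upto_def)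
    then show "x \<in> {- n..n}" by auto
  qed
qed simp

lemma sum_windmill:
  fixes F :: "int \<Rightarrow> int \<Rightarrow> int \<Rightarrow> real"
  shows "(\<Sum>(x, y, z)\<in>windmill n. F x y z) = (\<Sum>x\<in>roots_upto n. \<Sum>(y, z)\<in>divisor_pairs (n - x^2). F x y z)"
proof -
  have "(\<Sum>x\<in>roots_upto n. \<Sum>(y, z)\<in>divisor_pairs (n - x^2). F x y z) =
     (\<Sum>(x, y, z)\<in>(SIGMA x:roots_upto n. divisor_pairs (n - x^2)). F x y z)"
    by (subst sum.Sigma) (auto simp: finite_roots_upto finite_divisor_pairs case_prod_unfold)
  also have "(SIGMA x:roots_upto n. divisor_pairs (n - x^2)) = windmill n"
    using mult_pos_pos by (fastforce simp: roots_upto_def divisor_pairs_def windmill_def intro: less_imp_le)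
  finally show ?thesis by simp
qed

lemma finite_windmill: "finite (windmill n)"
proof (rule finite_subset)
  show "windmill n \<subseteq> (SIGMA x:roots_upto n. divisor_pairs (n - x^2))"
    by (auto simp: roots_upto_def divisor_pairs_def windmill_def)
qed (simp add: finite_roots_upto finite_divisor_pairs)

text \<open>\<open>r\<close> is kept apart from \<open>m\<close> so that induction on
  \<open>m\<close> is possible; only r = m is used, where the value is m^2.\<close>

lemma alternating_cubic:
  fixes r :: int
  assumes "m \<ge> 1"
  shows "(\<Sum>y\<in>{0<..<2 * m}. (if even y then - 1 else 1) * (real_of_int ((2 * r - y)^2 * y))) =
    4 * r^2 * m - 4 * r * m * (2 * m - 1) + m^2 * (4 * m - 3)"
  using assms
proof (induction m rule: int_ge_induct)
  case base
  have "{0<..<2::int} = {1}" by auto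
  then show ?case by (simp add: power2_eq_square algebra_simps)
next
  case (step m)
  have *: "2 * (m + 1) = 2 * m + 1 + 1" by simp
  have m: "2 * m + 1 > 0" "2 * m > 0" using step by auto
  show ?case
    unfolding * sum_step[OF m(1)] sum_step[OF m(2)] step.IH
    by (simp add: power2_eq_square algebra_simps)
qed

text \<open>On z = y + 2 * x one has n = (x + y)^2, so this wall is empty unless n is a square, and
  otherwise it is parametrized by y alone.\<close>

lemma windmill_diagonal:
  assumes "n \<ge> 1"
  shows "(\<Sum>(x, y, z)\<in>windmill n. of_bool (z = y + 2 * x) * (psign y z * of_int (z^2 * y))) =
     (if \<exists>r. n = r^2 then of_int n else 0)"
proof (cases "\<exists>r. n = r^2")
  case True
  then obtain r where "n = r^2" by blast
  then have r: "n = \<bar>r\<bar>^2" by simp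
  define s where "s = \<bar>r\<bar>"
  have "r \<noteq> 0" using r assms by auto
  then have s: "n = s^2" "s \<ge> 1" using r unfolding s_def by auto
  have "(\<Sum>(x, y, z)\<in>windmill n. of_bool (z = y + 2 * x) * (psign y z * of_int (z^2 * y))) =
     (\<Sum>(x, y, z)\<in>{(x, y, z) \<in> windmill n. z = y + 2 * x}. psign y z * of_int (z^2 * y))"
    by (rule sum.mono_neutral_cong_right) (auto simp: finite_windmill)
  also have "\<dots> = (\<Sum>y\<in>{0<..<2 * s}. (if even y then - 1 else 1) * (real_of_int ((2 * s - y)^2 * y)))"
  proof (rule sum.reindex_bij_witness[where i = "\<lambda>y. (s - y, y, 2 * s - y)" and j = "\<lambda>(x, y, z). y"])
    fix t assume t: "t \<in> {(x, y, z) \<in> windmill n. z = y + 2 * x}"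
    obtain x y z where [simp]: "t = (x, y, z)" by (cases t)
    have "(x + y)^2 = s^2" "x + y > 0" "0 < y" "0 < z" "z = y + 2 * x"
      using t s by (auto simp: windmill_def power2_eq_square algebra_simps)
    then have "x + y = s" using s by (auto simp: power2_eq_iff)
    then show "(case t of (x, y, z) \<Rightarrow> y) \<in> {0<..<2 * s}"
      "(s - (case t of (x, y, z) \<Rightarrow> y), (case t of (x, y, z) \<Rightarrow> y), 2 * s - (case t of (x, y, z) \<Rightarrow> y)) = t"
      "(if even (case t of (x, y, z) \<Rightarrow> y) then - 1 else 1) *
         real_of_int ((2 * s - (case t of (x, y, z) \<Rightarrow> y))\<^sup>2 * (case t of (x, y, z) \<Rightarrow> y)) =
        (case t of (x, y, z) \<Rightarrow> psign y z * real_of_int (z\<^sup>2 * y))"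
      using \<open>z = y + 2 * x\<close> \<open>0 < y\<close> \<open>0 < z\<close> by (auto simp: psign_def)
  qed (auto simp: windmill_def s power2_eq_square algebra_simps)
  also have "\<dots> = of_int n"
    using s by (subst alternating_cubic) (simp_all add: power2_eq_square algebra_simps)
  finally show ?thesis using True by simp
next
  case False
  have "z \<noteq> y + 2 * x" if "(x, y, z) \<in> windmill n" for x y z
  proof
    assume "z = y + 2 * x"
    then have "n = (x + y)^2" using that by (auto simp: windmill_def power2_eq_square algebra_simps)
    with False show False by blast
  qed
  then have "(\<Sum>(x, y, z)\<in>windmill n. of_bool (z = y + 2 * x) * (psign y z * of_int (z^2 * y))) = 0"
    by (intro sum.neutral) auto
  then show ?thesis using False by simp
qed

lemma windmill_restrict:
  "(\<Sum>(x, y, z)\<in>windmill n. of_bool (P x y z) * F x y z) =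
    (\<Sum>(x, y, z)\<in>{(x, y, z) \<in> windmill n. P x y z}. (F x y z :: real))"
  by (rule sum.mono_neutral_cong_right) (auto simp: finite_windmill)

lemma windmill_neg: "(\<Sum>(x, y, z)\<in>windmill n. F (- x) y z) = (\<Sum>(x, y, z)\<in>windmill n. F x y z)"
  by (rule sum.reindex_bij_witness[where i = "\<lambda>(x, y, z). (- x, y, z)" and j = "\<lambda>(x, y, z). (- x, y, z)"])
    (auto simp: windmill_def)

lemma windmill_swap: "(\<Sum>(x, y, z)\<in>windmill n. F x z y) = (\<Sum>(x, y, z)\<in>windmill n. F x y z)"
  by (rule sum.reindex_bij_witness[where i = "\<lambda>(x, y, z). (x, z, y)" and j = "\<lambda>(x, y, z). (x, z, y)"])
    (auto simp: windmill_def algebra_simps)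

lemma psign_commute: "psign y z = psign z y"
  by (auto simp: psign_def)

lemma windmill_identity:
  assumes "n \<ge> 1"
  shows "(\<Sum>(x, y, z)\<in>windmill n. psign y z * of_int ((y + z) * (y * z - 4 * x^2))) =
    (if \<exists>r. n = r^2 then 2 * of_int n else 0)"
proof -
  \<comment> \<open>\<open>H\<close> changes sign when the substitution is followed by swapping \<open>y\<close> and \<open>z\<close>, and its average over
    the signs of \<open>x\<close> and the order of \<open>y, z\<close> is \<open>-1/2\<close> times the wanted cubic.\<close>
  define H where "H = (\<lambda>x y z :: int. y^2 * (z - 2 * x - y) + (z - 2 * x - y)^2 * z - z^2 * y)"
  let ?S = "\<lambda>F. \<Sum>(x, y, z)\<in>windmill n. F x y z :: real"
  define G where "G = (\<lambda>x y z. psign y z * of_int (H x y z))"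
  have "?S (\<lambda>x y z. of_bool (z < y + 2 * x) * G x y z) =
      ?S (\<lambda>x y z. of_bool (2 * x + z < y) * G (x + z) (y - 2 * x - z) z)"
    unfolding windmill_restrict
    by (rule sum.reindex_bij_witness[where i = "\<lambda>(x, y, z). (x + z, y - 2 * x - z, z)"
        and j = "\<lambda>(x, y, z). (x - z, y + 2 * x - z, z)"])
      (auto simp: windmill_def power2_eq_square algebra_simps)
  moreover have "G (x + z) (y - 2 * x - z) z = - G x z y" for x y z
    by (auto simp: G_def H_def psign_def power2_eq_square algebra_simps)
  moreover have "?S (\<lambda>x y z. of_bool (y + 2 * x < z) * G x y z) =
      ?S (\<lambda>x y z. of_bool (2 * x + z < y) * G x z y)"
    by (subst windmill_swap[symmetric]) (simp add: algebra_simps)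
  \<comment> \<open>On the wall fixed by the substitution the factor z - 2 * x - y is 0, so only the
    term - z^2 * y of \<open>H\<close> survives.\<close>
  moreover have "?S (\<lambda>x y z. of_bool (z = y + 2 * x) * G x y z) = - (if \<exists>r. n = r^2 then of_int n else 0)"
    unfolding windmill_diagonal[OF assms, symmetric] sum_negf[symmetric]
    by (rule sum.cong) (auto simp: G_def H_def power2_eq_square)
  moreover have "?S G = ?S (\<lambda>x y z. of_bool (z < y + 2 * x) * G x y z + of_bool (y + 2 * x < z) *
      G x y z +
      of_bool (z = y + 2 * x) * G x y z)"
    by (rule sum.cong) auto
  ultimately have 1: "?S G = - (if \<exists>r. n = r^2 then of_int n else 0)"
    by (simp add: case_prod_unfold sum.distrib sum_negf)
  have "4 * ?S G = ?S G + ?S (\<lambda>x y z. G (- x) y z) + ?S (\<lambda>x y z. G x z y) + ?S (\<lambda>x y z. G (- x) z y)"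
    using windmill_neg[of G n] windmill_swap[of G n] windmill_swap[of "\<lambda>x y z. G (- x) y z" n] by simp
  also have "\<dots> = ?S (\<lambda>x y z. G x y z + G (- x) y z + G x z y + G (- x) z y)"
    by (simp add: case_prod_unfold sum.distrib)
  also have "\<dots> = ?S (\<lambda>x y z. - 2 * (psign y z * of_int ((y + z) * (y * z - 4 * x^2))))"
    by (intro sum.cong refl) (auto simp: G_def H_def psign_def power2_eq_square algebra_simps)
  also have "\<dots> = - 2 * ?S (\<lambda>x y z. psign y z * of_int ((y + z) * (y * z - 4 * x^2)))"
    by (simp only: sum_distrib_left case_prod_unfold)
  finally have "?S (\<lambda>x y z. psign y z * of_int ((y + z) * (y * z - 4 * x^2))) =
      2 * (if \<exists>r. n = r^2 then of_int n else 0)"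
    unfolding 1 by argo
  then show ?thesis by (simp only: if_distrib[of "(*) 2"] mult_zero_right)
qed

text \<open>For n \<ge> 1 this is Jacobi's sum of the divisors not divisible by 4: for n = 2^a * u
  with u odd and a \<ge> 1, the signed powers 1 - 2 - ... - 2^(a-1) + 2^a add up to 3. The signed
  form is symmetric in the two factors.\<close>

definition div_sum :: "int \<Rightarrow> real" where
  "div_sum n = (\<Sum>(y, z)\<in>divisor_pairs n. psign y z * of_int y)"

definition jacobi_sum :: "int \<Rightarrow> real" where
  "jacobi_sum n = (if n = 0 then 1 else 8 * div_sum n)"

lemma sum_roots_upto_eq:
  assumes "n \<ge> 1"
  shows "(\<Sum>x\<in>roots_upto n. of_bool (x^2 = n) * c) = (if \<exists>r. n = r^2 then 2 * c else (0::real))"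
proof (cases "\<exists>r. n = r^2")
  case True
  then obtain r where r: "n = r^2" by blast
  then have r0: "r \<noteq> - r" using assms by auto
  have "(\<Sum>x\<in>roots_upto n. of_bool (x^2 = n) * c) = (\<Sum>x\<in>{r, - r}. c)"
    using finite_roots_upto[of n]
    by (intro sum.mono_neutral_cong_right) (auto simp: roots_upto_def r power2_eq_iff)
  then show ?thesis using True r0 by simp
next
  case False
  then show ?thesis by (auto intro!: sum.neutral)
qed

text \<open>The value 1 at 0 gives -4n for each of the two roots of x^2 = n if n is a square. The
  windmill identity, halved by the symmetry of y and z and multiplied by 8, gives the opposite
  8n.\<close>

lemma jacobi_sum_recursion:
  assumes "n \<ge> 1"
  shows "(\<Sum>x\<in>roots_upto n. of_int (n - 5 * x^2) * jacobi_sum (n - x^2)) = 0"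
proof -
  have d0: "div_sum 0 = 0"
    by (auto simp: div_sum_def divisor_pairs_def intro!: sum.neutral)
  have "(\<Sum>x\<in>roots_upto n. of_int (n - 5 * x^2) * jacobi_sum (n - x^2)) =
     (\<Sum>x\<in>roots_upto n. of_bool (x^2 = n) * (- 4 * of_int n) + 8 *
         (of_int (n - 5 * x^2) * div_sum (n - x^2)))"
    by (rule sum.cong) (auto simp: jacobi_sum_def d0)
  also have "\<dots> = (\<Sum>x\<in>roots_upto n. of_bool (x^2 = n) * (- 4 * of_int n)) +
      8 * (\<Sum>x\<in>roots_upto n. of_int (n - 5 * x^2) * div_sum (n - x^2))"
    by (simp only: sum.distrib sum_distrib_left)
  also have "(\<Sum>x\<in>roots_upto n. of_int (n - 5 * x^2) * div_sum (n - x^2)) =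
      (\<Sum>(x, y, z)\<in>windmill n. psign y z * of_int (y * (y * z - 4 * x^2)))"
    unfolding sum_windmill div_sum_def sum_distrib_left
    by (intro sum.cong refl) (auto simp: divisor_pairs_def algebra_simps)
  also have "\<dots> = (\<Sum>(x, y, z)\<in>windmill n. psign y z * of_int ((y + z) * (y * z - 4 * x^2))) / 2"
  proof -
    have "(\<Sum>(x, y, z)\<in>windmill n. psign y z * of_int ((y + z) * (y * z - 4 * x^2))) =
       (\<Sum>(x, y, z)\<in>windmill n. psign y z * of_int (y * (y * z - 4 * x^2)) +
         psign z y * of_int (z * (z * y - 4 * x^2)))"
      by (intro sum.cong refl) (auto simp: algebra_simps psign_commute)
    then show ?thesis
      using windmill_swap[of "\<lambda>x y z. psign y z * of_int (y * (y * z - 4 * x^2))" n]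
      by (simp add: case_prod_unfold sum.distrib)
  qed
  finally show ?thesis
    unfolding windmill_identity[OF assms] sum_roots_upto_eq[OF assms] by simp
qed

section \<open>Jacobi's four-square theorem\<close>

definition squares3 :: "int \<Rightarrow> (int \<times> int \<times> int) set" where
  "squares3 n = {(a, b, c). a^2 + b^2 + c^2 = n}"
definition squares4 :: "int \<Rightarrow> (int \<times> int \<times> int \<times> int) set" where
  "squares4 n = {(a, b, c, d). a^2 + b^2 + c^2 + d^2 = n}"

lemma finite_squares3: "finite (squares3 n)"
proof (rule finite_subset)
  show "squares3 n \<subseteq> roots_upto n \<times> roots_upto n \<times> roots_upto n"
    by (auto simp: squares3_def roots_upto_def)
qed (simp add: finite_roots_upto)

lemma squares4_Sigma: "squares4 n = (SIGMA x:roots_upto n. squares3 (n - x^2))"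
  by (auto simp: squares4_def squares3_def roots_upto_def)

lemma finite_squares4: "finite (squares4 n)"
  by (simp add: squares4_Sigma finite_roots_upto finite_squares3)

lemma card_squares4: "card (squares4 n) = (\<Sum>x\<in>roots_upto n. card (squares3 (n - x^2)))"
  by (simp add: squares4_Sigma finite_roots_upto finite_squares3)

text \<open>On x^2 + a^2 + b^2 + c^2 + d^2 = n the factor n - 5x^2 is the sum of the four
  differences a^2 - x^2, ..., d^2 - x^2, and exchanging x with the other variable shows that each
  sums to 0.\<close>

lemma card_squares4_recursion:
  "(\<Sum>x\<in>roots_upto n. of_int (n - 5 * x^2) * real (card (squares4 (n - x^2)))) = 0"
proof -
  let ?T = "{(x, a, b, c, d). x^2 + a^2 + b^2 + c^2 + d^2 = n}"
  have T: "(SIGMA x:roots_upto n. squares4 (n - x^2)) = ?T"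
    by (auto simp: squares4_def roots_upto_def)
  let ?S = "\<lambda>F. \<Sum>(x, a, b, c, d)\<in>?T. F x a b c d :: real"
  have "(\<Sum>x\<in>roots_upto n. of_int (n - 5 * x^2) * real (card (squares4 (n - x^2)))) =
      ?S (\<lambda>x a b c d. of_int (n - 5 * x^2))"
    unfolding T[symmetric]
    by (subst sum.Sigma[symmetric]) (auto simp: finite_roots_upto finite_squares4 mult.commute)
  also have "\<dots> = ?S (\<lambda>x a b c d. of_int (a^2) - of_int (x^2) + (of_int (b^2) - of_int (x^2)) +
      (of_int (c^2) - of_int (x^2)) + (of_int (d^2) - of_int (x^2)))"
    by (rule sum.cong) auto
  also have "\<dots> = (?S (\<lambda>x a b c d. of_int (a^2)) - ?S (\<lambda>x a b c d. of_int (x^2))) +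
     (?S (\<lambda>x a b c d. of_int (b^2)) - ?S (\<lambda>x a b c d. of_int (x^2))) +
     (?S (\<lambda>x a b c d. of_int (c^2)) - ?S (\<lambda>x a b c d. of_int (x^2))) +
     (?S (\<lambda>x a b c d. of_int (d^2)) - ?S (\<lambda>x a b c d. of_int (x^2)))"
    by (simp only: case_prod_unfold sum.distrib sum_subtractf)
  also have "?S (\<lambda>x a b c d. of_int (a^2)) = ?S (\<lambda>x a b c d. of_int (x^2))"
    by (rule sum.reindex_bij_witness[where i = "\<lambda>(x, a, b, c, d). (a, x, b, c, d)"
          and j = "\<lambda>(x, a, b, c, d). (a, x, b, c, d)"]) auto
  also have "?S (\<lambda>x a b c d. of_int (b^2)) = ?S (\<lambda>x a b c d. of_int (x^2))"
    by (rule sum.reindex_bij_witness[where i = "\<lambda>(x, a, b, c, d). (b, a, x, c, d)"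
          and j = "\<lambda>(x, a, b, c, d). (b, a, x, c, d)"]) auto
  also have "?S (\<lambda>x a b c d. of_int (c^2)) = ?S (\<lambda>x a b c d. of_int (x^2))"
    by (rule sum.reindex_bij_witness[where i = "\<lambda>(x, a, b, c, d). (c, a, b, x, d)"
          and j = "\<lambda>(x, a, b, c, d). (c, a, b, x, d)"]) auto
  also have "?S (\<lambda>x a b c d. of_int (d^2)) = ?S (\<lambda>x a b c d. of_int (x^2))"
    by (rule sum.reindex_bij_witness[where i = "\<lambda>(x, a, b, c, d). (d, a, b, c, x)"
          and j = "\<lambda>(x, a, b, c, d). (d, a, b, c, x)"]) auto
  finally show ?thesis by argo
qed

lemma roots_upto_zero: "n \<ge> 0 \<Longrightarrow> 0 \<in> roots_upto n"
  by (simp add: roots_upto_def)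

theorem jacobi_four_squares:
  assumes "n \<ge> 0"
  shows "real (card (squares4 n)) = jacobi_sum n"
  using assms
proof (induction "nat n" arbitrary: n rule: less_induct)
  case less
  show ?case
  proof (cases "n = 0")
    case True
    have "squares4 0 = {(0, 0, 0, 0)}"
      by (auto simp: squares4_def) (smt (verit) zero_le_power2 power2_eq_iff zero_eq_power2)+
    then show ?thesis using True by (simp add: jacobi_sum_def)
  next
    case False
    then have n: "n \<ge> 1" using less.prems by simp
    have "(\<Sum>x\<in>roots_upto n - {0}. of_int (n - 5 * x^2) * real (card (squares4 (n - x^2)))) =
       (\<Sum>x\<in>roots_upto n - {0}. of_int (n - 5 * x^2) * jacobi_sum (n - x^2))"
    proof (rule sum.cong[OF refl])
      fix x assume x: "x \<in> roots_upto n - {0}"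
      then have "nat (n - x^2) < nat n" "n - x^2 \<ge> 0" using n by (auto simp: roots_upto_def)
      from less.hyps[OF this]
      show "of_int (n - 5 * x^2) * real (card (squares4 (n - x^2))) = of_int (n - 5 * x^2) *
          jacobi_sum (n - x^2)"
        by simp
    qed
    moreover have "(\<Sum>x\<in>roots_upto n. of_int (n - 5 * x^2) * real (card (squares4 (n - x^2)))) =
       (\<Sum>x\<in>roots_upto n. of_int (n - 5 * x^2) * jacobi_sum (n - x^2))"
      unfolding card_squares4_recursion jacobi_sum_recursion[OF n] ..
    \<comment> \<open>The term x = 0 has the coefficient n, which is nonzero and can be
      cancelled.\<close>
    ultimately show ?thesis
      using n by (simp add: sum.remove[OF finite_roots_upto roots_upto_zero])
  qed
qed

section \<open>Reduced forms and Selling parameters\<close>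

lemma SL2Z_equiv_iff:
  "((a, b, c), (a', b', c')) \<in> SL2Z_equiv \<longleftrightarrow> (\<exists>p q r s. p * s - q * r = 1 \<and>
    a' = a * p^2 + b * p * r + c * r^2 \<and> b' = 2 * a * p * q + b * (p * s + q * r) + 2 * c * r * s \<and>
    c' = a * q^2 + b * q * s + c * s^2)"
proof
  assume "((a, b, c), (a', b', c')) \<in> SL2Z_equiv"
  then obtain p q r s :: int where 1: "p * s - q * r = 1" and
    ev: "\<And>x y :: int. bqf_eval (a', b', c') x y = bqf_eval (a, b, c) (p * x + q * y) (r * x + s * y)"
    unfolding SL2Z_equiv_def by auto
  have "a' = a * p^2 + b * p * r + c * r^2" using ev[of 1 0] by simp
  moreover have "c' = a * q^2 + b * q * s + c * s^2" using ev[of 0 1] by simp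
  moreover have "b' = 2 * a * p * q + b * (p * s + q * r) + 2 * c * r * s"
    using ev[of 1 1] calculation by (simp add: power2_eq_square algebra_simps)
  ultimately show "\<exists>p q r s. p * s - q * r = 1 \<and>
    a' = a * p^2 + b * p * r + c * r^2 \<and> b' = 2 * a * p * q + b * (p * s + q * r) + 2 * c * r * s \<and>
    c' = a * q^2 + b * q * s + c * s^2" using 1 by blast
next
  assume "\<exists>p q r s. p * s - q * r = 1 \<and>
    a' = a * p^2 + b * p * r + c * r^2 \<and> b' = 2 * a * p * q + b * (p * s + q * r) + 2 * c * r * s \<and>
    c' = a * q^2 + b * q * s + c * s^2"
  then obtain p q r s where 1: "p * s - q * r = 1" and
    *: "a' = a * p^2 + b * p * r + c * r^2" "b' = 2 * a * p * q + b * (p * s + q * r) + 2 * c * r * s"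
    "c' = a * q^2 + b * q * s + c * s^2" by blast
  have "\<forall>x y :: int. bqf_eval (a', b', c') x y = bqf_eval (a, b, c) (p * x + q * y) (r * x + s * y)"
    by (simp add: * power2_eq_square algebra_simps)
  with 1 show "((a, b, c), (a', b', c')) \<in> SL2Z_equiv"
    unfolding SL2Z_equiv_def by blast
qed

lemma SL2Z_equiv_refl: "(f, f) \<in> SL2Z_equiv"
  unfolding SL2Z_equiv_def
  by clarify (rule exI[of _ 1], rule exI[of _ 0], rule exI[of _ 0], rule exI[of _ 1], simp)

lemma SL2Z_equiv_sym:
  assumes "(f, g) \<in> SL2Z_equiv"
  shows "(g, f) \<in> SL2Z_equiv"
proof -
  obtain p q r s :: int where 1: "p * s - q * r = 1" and
    ev: "\<And>x y :: int. bqf_eval g x y = bqf_eval f (p * x + q * y) (r * x + s * y)"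
    using assms unfolding SL2Z_equiv_def by auto
  have "bqf_eval f x y = bqf_eval g (s * x + (- q) * y) ((- r) * x + p * y)" for x y :: int
  proof -
    have "p * (s * x + (- q) * y) + q * ((- r) * x + p * y) = (p * s - q * r) * x"
      "r * (s * x + (- q) * y) + s * ((- r) * x + p * y) = (p * s - q * r) * y"
      by (simp_all add: algebra_simps)
    then show ?thesis using 1 by (simp only: ev) simp
  qed
  moreover have "s * p - (- q) * (- r) = 1" using 1 by (simp add: algebra_simps)
  ultimately show ?thesis unfolding SL2Z_equiv_def by blast
qed

lemma SL2Z_equiv_trans:
  assumes "(f, g) \<in> SL2Z_equiv" "(g, h) \<in> SL2Z_equiv"
  shows "(f, h) \<in> SL2Z_equiv"
proof -
  obtain p q r s :: int where 1: "p * s - q * r = 1" and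
    ev: "\<And>x y :: int. bqf_eval g x y = bqf_eval f (p * x + q * y) (r * x + s * y)"
    using assms(1) unfolding SL2Z_equiv_def by auto
  obtain p' q' r' s' :: int where 2: "p' * s' - q' * r' = 1" and
    ev': "\<And>x y :: int. bqf_eval h x y = bqf_eval g (p' * x + q' * y) (r' * x + s' * y)"
    using assms(2) unfolding SL2Z_equiv_def by auto
  have "bqf_eval h x y = bqf_eval f ((p * p' + q * r') * x + (p * q' + q * s') * y)
      ((r * p' + s * r') * x + (r * q' + s * s') * y)" for x y :: int
    by (simp only: ev ev') (simp add: algebra_simps)
  moreover have "(p * p' + q * r') * (r * q' + s * s') - (p * q' + q * s') * (r * p' + s * r') =
      (p * s - q * r) * (p' * s' - q' * r')"
    by (simp add: algebra_simps)
  ultimately show ?thesis unfolding SL2Z_equiv_def using 1 2 by auto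
qed

lemma equiv_SL2Z: "equiv UNIV SL2Z_equiv"
  by (rule equivI)
    (auto simp: refl_on_def sym_def trans_def SL2Z_equiv_refl intro: SL2Z_equiv_sym SL2Z_equiv_trans)

lemma bqf_pos_def_iff:
  assumes "b^2 - 4 * a * c < 0"
  shows "bqf_pos_def (a, b, c) \<longleftrightarrow> a > 0"
proof
  assume pos: "bqf_pos_def (a, b, c)"
  show "a > 0" using pos[unfolded bqf_pos_def_def, rule_format, of 1 0] by simp
next
  assume a: "a > 0"
  have D: "real_of_int b^2 - 4 * a * c < 0" using assms by (metis of_int_less_0_iff of_int_diff of_int_mult of_int_numeral of_int_power)
  show "bqf_pos_def (a, b, c)"
    unfolding bqf_pos_def_def
  proof (intro allI impI)
    fix x y :: real assume xy: "(x, y) \<noteq> (0, 0)"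
    have *: "4 * a * bqf_eval (a, b, c) x y = (2 * a * x + b * y)^2 + (4 * a * c - b^2) * y^2"
      by (simp add: power2_eq_square algebra_simps)
    have "0 < (2 * a * x + b * y)^2 + (4 * real_of_int a * c - b^2) * y^2"
    proof (cases "y = 0")
      case True
      then show ?thesis using xy a by simp
    next
      case False
      then have "0 < (4 * real_of_int a * c - b^2) * y^2" using D by simp
      then show ?thesis by (simp add: add_nonneg_pos)
    qed
    then have "0 < 4 * a * bqf_eval (a, b, c) x y" unfolding * by simp
    then show "0 < bqf_eval (a, b, c) x y" using a by (simp add: zero_less_mult_iff)
  qed
qed

definition pos_forms :: "int \<Rightarrow> bqf set" where
  "pos_forms D = {(a, b, c). a > 0 \<and> 4 * a * c = b^2 + D}"

lemma pos_forms_iff: "D > 0 \<Longrightarrow> {f. bqf_pos_def f \<and> bqf_disc f = - D} = pos_forms D"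
  by (auto simp: pos_forms_def bqf_pos_def_iff)

definition reduced_forms :: "int \<Rightarrow> bqf set" where
  "reduced_forms D = {(a, b, c). (a, b, c) \<in> pos_forms D \<and>
      (- a < b \<and> b \<le> a \<and> a < c \<or> 0 \<le> b \<and> b \<le> a \<and> a = c)}"

lemma pos_forms_equiv:
  assumes "D > 0" "f \<in> pos_forms D" "(f, g) \<in> SL2Z_equiv"
  shows "g \<in> pos_forms D"
proof -
  obtain a b c where f: "f = (a, b, c)" by (cases f)
  obtain a' b' c' where g: "g = (a', b', c')" by (cases g)
  obtain p q r s where 1: "p * s - q * r = 1" and
    *: "a' = a * p^2 + b * p * r + c * r^2" "b' = 2 * a * p * q + b * (p * s + q * r) + 2 * c * r * s"
    "c' = a * q^2 + b * q * s + c * s^2" using assms(3) unfolding f g SL2Z_equiv_iff by blast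
  have ac: "a > 0" "4 * a * c = b^2 + D" using assms(2) by (auto simp: f pos_forms_def)
  have "4 * a' * c' - b'^2 = (4 * a * c - b^2) * (p * s - q * r)^2"
    unfolding * by (simp add: power2_eq_square algebra_simps)
  then have "4 * a' * c' = b'^2 + D" using ac 1 by simp
  moreover have "4 * a * a' = (2 * a * p + b * r)^2 + (4 * a * c - b^2) * r^2"
    unfolding * by (simp add: power2_eq_square algebra_simps)
  then have "4 * a * a' = (2 * a * p + b * r)^2 + D * r^2" using ac by simp
  moreover have "(2 * a * p + b * r)^2 + D * r^2 > 0"
  proof (cases "r = 0")
    case True
    then have "p \<noteq> 0" using 1 by auto
    then show ?thesis using True ac by simp
  next
    case False
    then show ?thesis using assms(1) by (simp add: add_nonneg_pos)
  qed
  ultimately have "4 * a' * c' = b'^2 + D" "0 < (4 * a) * a'" by simp_all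
  then show ?thesis using ac by (simp add: g pos_forms_def zero_less_mult_iff)
qed

text \<open>A form with the least leading coefficient in its class is translated to bring b into
  (-a, a]. Minimality against the form with a and c exchanged yields a \<le> c.\<close>

lemma reduced_exists:
  assumes "D > 0" "f \<in> pos_forms D"
  shows "\<exists>g\<in>reduced_forms D. (f, g) \<in> SL2Z_equiv"
proof -
  define P where "P = (\<lambda>n. \<exists>b c. (f, (int n, b, c)) \<in> SL2Z_equiv)"
  obtain a0 b0 c0 where f: "f = (a0, b0, c0)" by (cases f)
  have "a0 > 0" using assms f by (auto simp: pos_forms_def)
  then have "P (nat a0)" unfolding P_def using SL2Z_equiv_refl[of f] f by auto
  then obtain n where n: "P n" "\<And>m. P m \<Longrightarrow> n \<le> m" by (metis LeastI Least_le)
  then obtain b1 c1 where g1: "(f, (int n, b1, c1)) \<in> SL2Z_equiv" unfolding P_def by blast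
  define a where "a = int n"
  have min: "a \<le> a'" if "(f, (a', b', c')) \<in> SL2Z_equiv" for a' b' c'
  proof -
    have "a' > 0" using pos_forms_equiv[OF assms that] by (simp add: pos_forms_def)
    moreover from this have "P (nat a')"
      unfolding P_def using that by (intro exI[of _ b'] exI[of _ c']) simp
    ultimately show ?thesis using n(2)[of "nat a'"] by (simp add: a_def)
  qed
  have a: "a > 0" using pos_forms_equiv[OF assms g1] by (simp add: pos_forms_def a_def)
  \<comment> \<open>The offset a - 1 sends the remainders 0, ..., 2a - 1 to -a + 1, ..., a, so that
    b = a is allowed and b = -a is not.\<close>
  define k where "k = - ((b1 + a - 1) div (2 * a))"
  define b where "b = b1 + 2 * a * k"
  define c where "c = a * k^2 + b1 * k + c1"
  have "b = (b1 + a - 1) mod (2 * a) - a + 1"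
    unfolding b_def k_def minus_mult_div_eq_mod[symmetric] by simp
  then have b: "- a < b" "b \<le> a"
    using a pos_mod_sign[of "2 * a" "b1 + a - 1"] pos_mod_bound[of "2 * a" "b1 + a - 1"] by linarith+
  have "((a, b1, c1), (a, b, c)) \<in> SL2Z_equiv"
    unfolding SL2Z_equiv_iff b_def c_def
    by (rule exI[of _ 1], rule exI[of _ k], rule exI[of _ 0], rule exI[of _ 1]) simp
  then have g: "(f, (a, b, c)) \<in> SL2Z_equiv"
    using g1 SL2Z_equiv_trans a_def by blast
  have "((a, b, c), (c, - b, a)) \<in> SL2Z_equiv"
    unfolding SL2Z_equiv_iff
    by (rule exI[of _ 0], rule exI[of _ "- 1"], rule exI[of _ 1], rule exI[of _ 0]) simp
  then have g': "(f, (c, - b, a)) \<in> SL2Z_equiv" using g SL2Z_equiv_trans by blast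
  have "a \<le> c" using min[OF g'] .
  show ?thesis
  proof (cases "a = c \<and> b < 0")
    case True
    then have "(c, - b, a) \<in> reduced_forms D"
      using pos_forms_equiv[OF assms g'] b by (auto simp: reduced_forms_def)
    then show ?thesis using g' by blast
  next
    case False
    then have "(a, b, c) \<in> reduced_forms D"
      using pos_forms_equiv[OF assms g] b \<open>a \<le> c\<close> by (auto simp: reduced_forms_def)
    then show ?thesis using g by blast
  qed
qed

text \<open>Values off the x-axis are at least c. So a is the minimum of the form, and it can be
  attained off the axis only if c = a.\<close>

lemma reduced_ge:
  fixes a b c x y :: int
  assumes "0 < a" "\<bar>b\<bar> \<le> a" "a \<le> c" "y \<noteq> 0"
  shows "c \<le> a * x^2 + b * x * y + c * y^2"
proof -
  have "\<bar>b * x * y\<bar> \<le> a * (\<bar>x\<bar> * \<bar>y\<bar>)"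
    using mult_right_mono[OF assms(2), of "\<bar>x\<bar> * \<bar>y\<bar>"] by (simp add: abs_mult mult.assoc)
  then have 1: "a * x^2 - a * (\<bar>x\<bar> * \<bar>y\<bar>) + c * y^2 \<le> a * x^2 + b * x * y + c * y^2" by linarith
  have y1: "1 \<le> y^2" using assms(4) abs_le_square[of y] by linarith
  show ?thesis
  proof (cases "\<bar>y\<bar> \<le> \<bar>x\<bar>")
    case True
    have "a * (\<bar>x\<bar> * \<bar>y\<bar>) \<le> a * (\<bar>x\<bar> * \<bar>x\<bar>)"
      using True assms(1) by (intro mult_left_mono) auto
    moreover have "c * 1 \<le> c * y^2" using y1 assms by (intro mult_left_mono) auto
    ultimately show ?thesis using 1 by (simp add: power2_eq_square)
  next
    case False
    have "a * (\<bar>x\<bar> * (\<bar>y\<bar> - \<bar>x\<bar>)) \<le> c * (\<bar>x\<bar> * (\<bar>y\<bar> - \<bar>x\<bar>))"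
      using False assms by (intro mult_right_mono) auto
    then have "c * (\<bar>x\<bar> * \<bar>x\<bar> + \<bar>y\<bar> * (\<bar>y\<bar> - \<bar>x\<bar>)) \<le> a * x^2 - a * (\<bar>x\<bar> * \<bar>y\<bar>) + c * y^2"
      by (simp add: power2_eq_square algebra_simps)
    moreover have "1 * 1 \<le> \<bar>y\<bar> * (\<bar>y\<bar> - \<bar>x\<bar>)" using False by (intro mult_mono) auto
    then have "c * 1 \<le> c * (\<bar>x\<bar> * \<bar>x\<bar> + \<bar>y\<bar> * (\<bar>y\<bar> - \<bar>x\<bar>))"
      using assms by (intro mult_left_mono) (auto simp: add_increasing)
    ultimately show ?thesis using 1 by linarith
  qed
qed

lemma reduced_min:
  fixes a b c x y :: int
  assumes "0 < a" "\<bar>b\<bar> \<le> a" "a \<le> c" "(x, y) \<noteq> (0, 0)"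
  shows "a \<le> a * x^2 + b * x * y + c * y^2"
proof (cases "y = 0")
  case True
  then have "x \<noteq> 0" using assms(4) by simp
  then have "1 \<le> x^2" using abs_le_square[of x] by linarith
  then have "a * 1 \<le> a * x^2" using assms by (intro mult_left_mono) auto
  then show ?thesis using True by simp
next
  case False
  then show ?thesis using reduced_ge[OF assms(1-3) False, of x] assms(3) by linarith
qed

text \<open>Both leading coefficients are the minimum of the class. If r = 0, the substitution is up
  to sign a translation and the range of b rules out a proper one; if r is nonzero, the minimum is
  attained off the axis, so both forms have a = c, and the discriminant with b \<ge> 0 determines
  b.\<close>

lemma reduced_unique:
  assumes "D > 0" "f \<in> reduced_forms D" "g \<in> reduced_forms D" "(f, g) \<in> SL2Z_equiv"
  shows "f = g"
proof -
  obtain a b c where f: "f = (a, b, c)" by (cases f)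
  obtain a' b' c' where g: "g = (a', b', c')" by (cases g)
  obtain p q r s where 1: "p * s - q * r = 1" and
    *: "a' = a * p^2 + b * p * r + c * r^2" "b' = 2 * a * p * q + b * (p * s + q * r) + 2 * c * r * s"
    "c' = a * q^2 + b * q * s + c * s^2" using assms(4) unfolding f g SL2Z_equiv_iff by blast
  have ra: "0 < a" "\<bar>b\<bar> \<le> a" "a \<le> c" "- a < b" "4 * a * c = b^2 + D" "a = c \<Longrightarrow> 0 \<le> b"
    using assms(2) by (auto simp: f reduced_forms_def pos_forms_def)
  have ra': "0 < a'" "\<bar>b'\<bar> \<le> a'" "a' \<le> c'" "- a' < b'" "4 * a' * c' = b'^2 + D" "a' = c' \<Longrightarrow> 0 \<le> b'"
    using assms(3) by (auto simp: g reduced_forms_def pos_forms_def)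
  have inv: "a = a' * s^2 + b' * s * (- r) + c' * (- r)^2"
  proof -
    have "a' * s^2 + b' * s * (- r) + c' * (- r)^2 = a * (p * s - q * r)^2"
      unfolding * by (simp add: power2_eq_square algebra_simps)
    then show ?thesis using 1 by simp
  qed
  have pr: "(p, r) \<noteq> (0, 0)" "(s, - r) \<noteq> (0, 0)" using 1 by auto
  have "a \<le> a'" using reduced_min[OF ra(1-3) pr(1)] *(1) by simp
  moreover have "a' \<le> a" using reduced_min[OF ra'(1-3) pr(2)] inv by simp
  ultimately have aa: "a' = a" by simp
  have "b = b'"
  proof (cases "r = 0")
    case True
    then have "p * s = 1" using 1 by simp
    then have "b' = b + 2 * a * (p * q)" using * True by (simp add: algebra_simps)
    then have "a * (p * q) < a * 1" "a * (- 1) < a * (p * q)"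
      using ra(2,4) ra'(2,4) aa by auto
    then have "p * q = 0" using ra(1) by (simp only: mult_less_cancel_left_pos)
    then show ?thesis using \<open>b' = b + 2 * a * (p * q)\<close> by simp
  next
    case False
    have "c = a" using reduced_ge[OF ra(1-3) False, of p] *(1) aa ra(3) by simp
    moreover have "c' \<le> a"
      using reduced_ge[OF ra'(1-3), of "- r" s] False unfolding inv[symmetric] by simp
    then have "c' = a" using ra'(3) aa by simp
    ultimately have "b^2 = b'^2" "0 \<le> b" "0 \<le> b'" using ra ra' aa by auto
    then show ?thesis by simp
  qed
  moreover have "(4 * a) * c = (4 * a) * c'" using ra(5) ra'(5) aa \<open>b = b'\<close> by simp
  then have "c = c'" using ra(1) by simp
  ultimately show ?thesis by (simp add: f g aa)
qed

definition form_weight :: "bqf \<Rightarrow> real" where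
  "form_weight f = (case f of (a, b, c) \<Rightarrow> if b = 0 \<and> a = c then 1/2 else if a = b \<and> b =
      c then 1/3 else 1)"

lemma hurwitz_H_reduced:
  assumes "D > 0"
  shows "hurwitz_H D = (\<Sum>f\<in>reduced_forms D. form_weight f)"
proof -
  have sub: "reduced_forms D \<subseteq> pos_forms D" by (auto simp: reduced_forms_def)
  have bij: "bij_betw (\<lambda>f. SL2Z_equiv `` {f}) (reduced_forms D) (bqf_classes D)"
    unfolding bij_betw_def
  proof (intro conjI inj_onI equalityI subsetI)
    fix f g assume fg: "f \<in> reduced_forms D" "g \<in> reduced_forms D" "SL2Z_equiv `` {f} = SL2Z_equiv `` {g}"
    then have "(f, g) \<in> SL2Z_equiv" using eq_equiv_class[OF _ equiv_SL2Z] by auto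
    then show "f = g" using reduced_unique[OF assms] fg by blast
  next
    fix C assume "C \<in> (\<lambda>f. SL2Z_equiv `` {f}) ` reduced_forms D"
    then show "C \<in> bqf_classes D"
      unfolding bqf_classes_def pos_forms_iff[OF assms] using sub by (auto intro: quotientI)
  next
    fix C assume "C \<in> bqf_classes D"
    then obtain f where f: "f \<in> pos_forms D" "C = SL2Z_equiv `` {f}"
      unfolding bqf_classes_def pos_forms_iff[OF assms] by (auto elim: quotientE)
    obtain g where g: "g \<in> reduced_forms D" "(f, g) \<in> SL2Z_equiv"
        using reduced_exists[OF assms f(1)] by blast
    then show "C \<in> (\<lambda>f. SL2Z_equiv `` {f}) ` reduced_forms D"
      using f equiv_class_eq[OF equiv_SL2Z] by blast
  qed
  have weight: "class_weight (SL2Z_equiv `` {f}) = form_weight f" if f: "f \<in> reduced_forms D" for f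
  proof -
    \<comment> \<open>The two kinds of forms with extra automorphisms are themselves reduced, so a
      class contains one only if it is the reduced representative.\<close>
    have eq: "(a, b, c) = f" if "(a, b, c) \<in> SL2Z_equiv `` {f}" "b = 0 \<or> b = a" "a = c" for a b c
    proof -
      have 1: "(f, (a, b, c)) \<in> SL2Z_equiv" using that by simp
      then have "(a, b, c) \<in> pos_forms D" using pos_forms_equiv[OF assms] f sub by blast
      then have "(a, b, c) \<in> reduced_forms D" using that by (auto simp: reduced_forms_def pos_forms_def)
      then show ?thesis using reduced_unique[OF assms f _ 1] by simp
    qed
    have self: "f \<in> SL2Z_equiv `` {f}" using SL2Z_equiv_refl by simp
    obtain a b c where fabc [simp]: "f = (a, b, c)" by (cases f)
    have "(\<exists>a. (a, 0, a) \<in> SL2Z_equiv `` {f}) \<longleftrightarrow> b = 0 \<and> a = c"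
      using eq self by fastforce
    moreover have "(\<exists>a. (a, a, a) \<in> SL2Z_equiv `` {f}) \<longleftrightarrow> a = b \<and> b = c"
      using eq self by fastforce
    ultimately show ?thesis unfolding class_weight_def form_weight_def by (simp only: prod.case fabc)
  qed
  have "hurwitz_H D = (\<Sum>C\<in>bqf_classes D. class_weight C)" using assms by (simp add: hurwitz_H_def)
  also have "\<dots> = (\<Sum>f\<in>reduced_forms D. class_weight (SL2Z_equiv `` {f}))"
    by (rule sum.reindex_bij_betw[OF bij, symmetric])
  also have "\<dots> = (\<Sum>f\<in>reduced_forms D. form_weight f)" by (simp add: weight)
  finally show ?thesis .
qed

section \<open>Class numbers in Selling parameters\<close>

definition selling :: "int \<Rightarrow> (int \<times> int \<times> int) set" where
  "selling D = {(x, y, z). 0 \<le> x \<and> 0 \<le> y \<and> 0 \<le> z \<and> x * y + y * z + z * x = D}"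

definition selling_weight :: "int \<Rightarrow> int \<Rightarrow> int \<Rightarrow> real" where
  "selling_weight x y z = half_step x * half_step y * half_step z"

lemma finite_selling:
  assumes "D > 0"
  shows "finite (selling D)"
proof (rule finite_subset)
  have "x \<le> D" if "(x, y, z) \<in> selling D" for x y z
  proof -
    have p: "0 \<le> x" "0 \<le> y" "0 \<le> z" "x * y + y * z + z * x = D" using that by (auto simp: selling_def)
    show ?thesis
    proof (cases "y + z = 0")
      case True
      then have "y = 0" "z = 0" using p by auto
      then show ?thesis using p assms by simp
    next
      case False
      then have "x * 1 \<le> x * (y + z)" using p by (intro mult_left_mono) auto
      then have "x \<le> x * y + z * x" by (simp add: algebra_simps)
      moreover have "0 \<le> y * z" using p by simp
      ultimately show ?thesis using p(4) by linarith
    qed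
  qed
  note * = this
  show "selling D \<subseteq> {0..D} \<times> {0..D} \<times> {0..D}"
  proof
    fix t assume "t \<in> selling D"
    moreover obtain x y z where t: "t = (x, y, z)" by (cases t)
    ultimately have xyz: "(x, y, z) \<in> selling D" by simp
    then have "(y, z, x) \<in> selling D" "(z, x, y) \<in> selling D" by (auto simp: selling_def algebra_simps)
    then show "t \<in> {0..D} \<times> {0..D} \<times> {0..D}"
      using t *[OF xyz] *[of y z x] *[of z x y] xyz by (auto simp: selling_def)
  qed
qed simp

lemma sum_selling_perm:
  "(\<Sum>(x, y, z)\<in>selling D. F y x z) = (\<Sum>(x, y, z)\<in>selling D. F x y z)"
  "(\<Sum>(x, y, z)\<in>selling D. F x z y) = (\<Sum>(x, y, z)\<in>selling D. F x y z)"
  "(\<Sum>(x, y, z)\<in>selling D. F y z x) = (\<Sum>(x, y, z)\<in>selling D. F x y z)"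
  "(\<Sum>(x, y, z)\<in>selling D. F z x y) = (\<Sum>(x, y, z)\<in>selling D. F x y z)"
  "(\<Sum>(x, y, z)\<in>selling D. F z y x) = (\<Sum>(x, y, z)\<in>selling D. F x y z)"
proof -
  show "(\<Sum>(x, y, z)\<in>selling D. F y x z) = (\<Sum>(x, y, z)\<in>selling D. F x y z)"
    by (rule sum.reindex_bij_witness[where i = "\<lambda>(x, y, z). (y, x, z)" and j = "\<lambda>(x, y, z). (y, x, z)"])
      (auto simp: selling_def algebra_simps)
  show "(\<Sum>(x, y, z)\<in>selling D. F x z y) = (\<Sum>(x, y, z)\<in>selling D. F x y z)"
    by (rule sum.reindex_bij_witness[where i = "\<lambda>(x, y, z). (x, z, y)" and j = "\<lambda>(x, y, z). (x, z, y)"])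
      (auto simp: selling_def algebra_simps)
  show "(\<Sum>(x, y, z)\<in>selling D. F y z x) = (\<Sum>(x, y, z)\<in>selling D. F x y z)"
    by (rule sum.reindex_bij_witness[where i = "\<lambda>(x, y, z). (z, x, y)" and j = "\<lambda>(x, y, z). (y, z, x)"])
      (auto simp: selling_def algebra_simps)
  show "(\<Sum>(x, y, z)\<in>selling D. F z x y) = (\<Sum>(x, y, z)\<in>selling D. F x y z)"
    by (rule sum.reindex_bij_witness[where i = "\<lambda>(x, y, z). (y, z, x)" and j = "\<lambda>(x, y, z). (z, x, y)"])
      (auto simp: selling_def algebra_simps)
  show "(\<Sum>(x, y, z)\<in>selling D. F z y x) = (\<Sum>(x, y, z)\<in>selling D. F x y z)"
    by (rule sum.reindex_bij_witness[where i = "\<lambda>(x, y, z). (z, y, x)" and j = "\<lambda>(x, y, z). (z, y, x)"])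
      (auto simp: selling_def algebra_simps)
qed

text \<open>On sorted triples this is the reciprocal of the order of the stabilizer under
  permutations, so the values over the six permutations of any triple add up to 1.\<close>

definition ord_weight :: "int \<Rightarrow> int \<Rightarrow> int \<Rightarrow> real" where
  "ord_weight x y z = (if x \<le> y \<and> y \<le> z then (if x < y \<and>
      y < z then 1 else if x < y \<or> y < z then 1/2 else 1/6) else 0)"

lemma sum_selling_sorted:
  assumes "\<And>x y z. F y x z = F x y z" "\<And>x y z. F x z y = (F x y z :: real)"
  shows "(\<Sum>(x, y, z)\<in>selling D. F x y z) = 6 * (\<Sum>(x, y, z)\<in>selling D. ord_weight x y z * F x y z)"
proof -
  let ?S = "\<lambda>G. \<Sum>(x, y, z)\<in>selling D. (G x y z :: real)"
  let ?G = "\<lambda>x y z. ord_weight x y z * F x y z"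
  have F: "F x z y = F x y z" "F y x z = F x y z" "F y z x = F x y z" "F z x y = F x y z" "F z y x =
      F x y z" for x y z
    using assms by metis+
  have "?S F = ?S (\<lambda>x y z. ?G x y z + ?G y x z + ?G x z y + ?G y z x + ?G z x y + ?G z y x)"
    by (rule sum.cong[OF refl]) (auto simp: F distrib_right[symmetric] ord_weight_def)
  also have "\<dots> = 6 * ?S ?G"
    using sum_selling_perm(1)[of ?G D] sum_selling_perm(2)[of ?G D] sum_selling_perm(3)[of ?G D]
      sum_selling_perm(4)[of ?G D] sum_selling_perm(5)[of ?G D]
    by (simp add: case_prod_unfold sum.distrib)
  finally show ?thesis .
qed

text \<open>
  A reduced form \<open>(a, b, c)\<close> has the sorted parameters \<open>|b|, 2a - |b|, 2c - |b|\<close>.  Three distinct positive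
  parameters come from two reduced forms, which differ in the sign of \<open>b\<close>.
\<close>

theorem hurwitz_H_selling:
  assumes "D > 0"
  shows "3 * hurwitz_H D = (\<Sum>(x, y, z)\<in>selling D. of_bool (even (x + y) \<and> even (y + z)) *
      selling_weight x y z)"
proof -
  let ?S = "{(x, y, z) \<in> selling D. even (x + y) \<and> even (y + z) \<and> x \<le> y \<and> y \<le> z}"
  have red: "reduced_forms D = {(a, b, c) \<in> reduced_forms D. 0 \<le> b} \<union>
      {(a, b, c) \<in> reduced_forms D. b < 0}"
    by auto
  have finS: "finite {(x, y, z) \<in> selling D. P x y z}" for P
    by (rule finite_subset[OF _ finite_selling[OF assms]]) auto
  let ?T = "{(x, y, z) \<in> selling D. even (x + y) \<and> even (y + z) \<and> 0 < x \<and> x < y \<and> y < z}"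
  let ?g = "\<lambda>(a, b, c). (b, 2 * a - b, 2 * c - b) :: int \<times> int \<times> int"
  let ?g' = "\<lambda>(a, b, c). (- b, 2 * a + b, 2 * c + b) :: int \<times> int \<times> int"
  have nz: "0 < y" if "(x, y, z) \<in> selling D" "x \<le> y" for x y z
    using that assms by (cases "y = 0") (auto simp: selling_def)
  have half: "\<exists>a c. x + y = 2 * a \<and> x + z = 2 * c" if "even (x + y)" "even (y + z)" for x y z :: int
  proof -
    have "even (x + z)" using that by auto
    then show ?thesis using that(1) by (meson evenE)
  qed
  have g: "?g ` {(a, b, c) \<in> reduced_forms D. 0 \<le> b} = ?S"
  proof (intro equalityI subsetI)
    fix t assume t: "t \<in> ?S"
    obtain x y z where [simp]: "t = (x, y, z)" by (cases t)
    obtain a c where ac: "x + y = 2 * a" "x + z = 2 * c" using t half[of x y z] by auto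
    have 1: "x \<le> a" "a \<le> c" "0 \<le> x" "0 < a" using t nz[of x y z] ac by (auto simp: selling_def)
    have y: "y = 2 * a - x" "z = 2 * c - x" using ac by auto
    have "4 * a * c = x^2 + D" using t unfolding y \<open>t = (x, y, z)\<close>
      by (auto simp: selling_def power2_eq_square algebra_simps)
    then have "(a, x, c) \<in> {(a, b, c) \<in> reduced_forms D. 0 \<le> b}"
      using 1 by (auto simp: reduced_forms_def pos_forms_def)
    moreover have "t = ?g (a, x, c)" using y by simp
    ultimately show "t \<in> ?g ` {(a, b, c) \<in> reduced_forms D. 0 \<le> b}" by blast
  qed (auto simp: reduced_forms_def pos_forms_def selling_def power2_eq_square algebra_simps)
  have g': "?g' ` {(a, b, c) \<in> reduced_forms D. b < 0} = ?T"
  proof (intro equalityI subsetI)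
    fix t assume t: "t \<in> ?T"
    obtain x y z where [simp]: "t = (x, y, z)" by (cases t)
    obtain a c where ac: "x + y = 2 * a" "x + z = 2 * c" using t half[of x y z] by auto
    have 1: "x < a" "a < c" "0 < x" using t ac by auto
    have y: "y = 2 * a - x" "z = 2 * c - x" using ac by auto
    have "4 * a * c = (- x)^2 + D" using t unfolding y \<open>t = (x, y, z)\<close>
      by (auto simp: selling_def power2_eq_square algebra_simps)
    then have "(a, - x, c) \<in> {(a, b, c) \<in> reduced_forms D. b < 0}"
      using 1 by (auto simp: reduced_forms_def pos_forms_def)
    moreover have "t = ?g' (a, - x, c)" using y by simp
    ultimately show "t \<in> ?g' ` {(a, b, c) \<in> reduced_forms D. b < 0}" by blast
  qed (auto simp: reduced_forms_def pos_forms_def selling_def power2_eq_square algebra_simps)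
  have inj: "inj_on ?g A" "inj_on ?g' A" for A by (auto simp: inj_on_def)
  have fin: "finite {(a, b, c) \<in> reduced_forms D. 0 \<le> b}" "finite {(a, b, c) \<in> reduced_forms D. b < 0}"
    by (rule finite_imageD[OF _ inj(1)], unfold g, rule finS)
      (rule finite_imageD[OF _ inj(2)], unfold g', rule finS)
  let ?w = "\<lambda>x y z. if x = 0 \<and> y = z then 1 / 2 else if x = y \<and> y = z then 1 / 3 else 1 :: real"
  have "hurwitz_H D = (\<Sum>f\<in>{(a, b, c) \<in> reduced_forms D. 0 \<le> b}. form_weight f)
      + (\<Sum>f\<in>{(a, b, c) \<in> reduced_forms D. b < 0}. form_weight f)"
    unfolding hurwitz_H_reduced[OF assms]
    by (subst (1) red, rule sum.union_disjoint[OF fin]) auto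
  also have "(\<Sum>f\<in>{(a, b, c) \<in> reduced_forms D. 0 \<le> b}. form_weight f) = (\<Sum>(x, y, z)\<in>?S. ?w x y z)"
    unfolding g[symmetric] sum.reindex[OF inj(1)]
    by (rule sum.cong) (auto simp: form_weight_def)
  also have "(\<Sum>f\<in>{(a, b, c) \<in> reduced_forms D. b < 0}. form_weight f) = (\<Sum>(x, y, z)\<in>?T. 1)"
    unfolding g'[symmetric] sum.reindex[OF inj(2)]
    by (rule sum.cong) (auto simp: form_weight_def reduced_forms_def)
  also have "(\<Sum>(x, y, z)\<in>?S. ?w x y z) = (\<Sum>(x, y, z)\<in>selling D. of_bool (even (x + y) \<and>
      even (y + z) \<and> x \<le> y \<and> y \<le> z) * ?w x y z)"
    by (rule sum.mono_neutral_cong_left[OF finite_selling[OF assms]]) auto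
  also have "(\<Sum>(x, y, z)\<in>?T. 1) = (\<Sum>(x, y, z)\<in>selling D. of_bool (even (x + y) \<and> even (y + z) \<and>
      0 < x \<and> x < y \<and> y < z))"
    by (rule sum.mono_neutral_cong_left[OF finite_selling[OF assms]]) auto
  finally have "3 * hurwitz_H D = (\<Sum>(x, y, z)\<in>selling D.
      3 * (of_bool (even (x + y) \<and> even (y + z) \<and> x \<le> y \<and> y \<le> z) * ?w x y z
        + of_bool (even (x + y) \<and> even (y + z) \<and> 0 < x \<and> x < y \<and> y < z)))"
    by (simp only: sum_distrib_left[symmetric] sum.distrib[symmetric] case_prod_unfold)
  \<comment> \<open>Six orderings match three times two forms if 0 < x < y < z. The weight 1/2 for x
    = 0 and the stabilizers for equal parameters match the single form with b = 0, b = a or a = c,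
    and the class weights 1/2 and 1/3.\<close>
  also have "\<dots> = (\<Sum>(x, y, z)\<in>selling D. 6 * (ord_weight x y z *
      (of_bool (even (x + y) \<and> even (y + z)) * selling_weight x y z)))"
  proof (rule sum.cong[OF refl], clarify)
    fix x y z assume "(x, y, z) \<in> selling D"
    then have "0 \<le> x" "x \<le> y \<Longrightarrow> 0 < y" using nz by (auto simp: selling_def)
    then show "3 * (of_bool (even (x + y) \<and> even (y + z) \<and> x \<le> y \<and> y \<le> z) * ?w x y z
        + of_bool (even (x + y) \<and> even (y + z) \<and> 0 < x \<and> x < y \<and> y < z)) =
      6 * (ord_weight x y z * (of_bool (even (x + y) \<and> even (y + z)) * selling_weight x y z))"
      by (cases "x \<le> y \<and> y \<le> z") (auto simp: ord_weight_def selling_weight_def half_step_def)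
  qed
  also have "\<dots> = 6 * (\<Sum>(x, y, z)\<in>selling D. ord_weight x y z *
      (of_bool (even (x + y) \<and> even (y + z)) * selling_weight x y z))"
    by (simp only: sum_distrib_left case_prod_unfold)
  also have "\<dots> = (\<Sum>(x, y, z)\<in>selling D. of_bool (even (x + y) \<and> even (y + z)) * selling_weight x y z)"
    by (rule sum_selling_sorted[symmetric]) (auto simp: selling_weight_def)
  finally show ?thesis .
qed

section \<open>Three squares\<close>

definition psign3 :: "int \<Rightarrow> int \<Rightarrow> int \<Rightarrow> real" where
  "psign3 x y z = (if even (x + y) \<and> even (y + z) then - 1 else 1)"

lemma selling_restrict:
  assumes "D > 0"
  shows "(\<Sum>(x, y, z)\<in>selling D. of_bool (P x y z) * F x y z) =
    (\<Sum>(x, y, z)\<in>{(x, y, z) \<in> selling D. P x y z}. (F x y z :: real))"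
  by (rule sum.mono_neutral_cong_right) (auto simp: finite_selling[OF assms])

lemma half_step_scale: "0 < c \<Longrightarrow> half_step (c * x) = half_step x"
  by (auto simp: half_step_def zero_less_mult_iff)

text \<open>Three odd parameters would give an odd value of xy + yz + zx, so equal parity means that
  all are even, and halving them divides the value by 4.\<close>

lemma selling_even:
  assumes "d > 0"
  shows "(\<Sum>(x, y, z)\<in>selling (4 * d). of_bool (even (x + y) \<and> even (y + z)) * selling_weight x y z) =
    (\<Sum>(x, y, z)\<in>selling d. selling_weight x y z)"
proof -
  have ev: "even x \<and> even y \<and> even z" if "(x, y, z) \<in> selling (4 * d)" "even (x + y)" "even (y + z)"
      for x y z
  proof (rule ccontr)
    assume "\<not> (even x \<and> even y \<and> even z)"
    then have "odd x" "odd y" "odd z" using that by auto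
    then have "odd (x * y + y * z + z * x)" by simp
    moreover have "x * y + y * z + z * x = 4 * d" using that(1) by (simp add: selling_def)
    ultimately show False by (metis dvd_mult2 even_numeral)
  qed
  have pos: "4 * d > 0" using assms by simp
  have set: "{(x, y, z) \<in> selling (4 * d). even (x + y) \<and> even (y + z)} =
      {(x, y, z) \<in> selling (4 * d). even x \<and> even y \<and> even z}"
    using ev by auto
  have "half_step (2 * x) = half_step x" "half_step (x * 2) = half_step x" for x
    using half_step_scale[of 2 x] by (simp_all add: mult.commute)
  then have "(\<Sum>(x, y, z)\<in>selling d. selling_weight x y z) =
      (\<Sum>(x, y, z)\<in>{(x, y, z) \<in> selling (4 * d). even (x + y) \<and> even (y + z)}. selling_weight x y z)"
    unfolding set
    by (intro sum.reindex_bij_witness[where i = "\<lambda>(x, y, z). (x div 2, y div 2, z div 2)"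
          and j = "\<lambda>(x, y, z). (2 * x, 2 * y, 2 * z)"])
      (auto simp: selling_weight_def selling_def algebra_simps elim!: evenE)
  then show ?thesis by (simp add: selling_restrict[OF pos])
qed

lemma hurwitz_H_4:
  assumes "d > 0"
  shows "3 * hurwitz_H (4 * d) = (\<Sum>(x, y, z)\<in>selling d. selling_weight x y z)"
  using hurwitz_H_selling[of "4 * d"] assms unfolding selling_even[OF assms] by simp

text \<open>For odd x the equation forces y and z to agree modulo 4, which makes (y - z)/4 an
  integer. \<open>half_step (y - z)\<close> breaks the symmetry of y and z first, and the symmetry
  of the new x and y restores the other half.\<close>

lemma selling_one_odd:
  assumes "d > 0"
  shows "(\<Sum>(x, y, z)\<in>selling (4 * d). of_bool (odd x \<and> even y \<and> even z) * selling_weight x y z) =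
    (\<Sum>(x, y, z)\<in>selling d. of_bool (odd (x + y)) * selling_weight x y z)"
proof -
  have pos: "4 * d > 0" using assms by simp
  let ?G = "\<lambda>x y z. of_bool (odd x \<and> even y \<and> even z \<and> z \<le> y) *
      (half_step (y - z) * selling_weight x y z)"
  have "(\<Sum>(x, y, z)\<in>selling (4 * d). of_bool (odd x \<and> even y \<and> even z) * selling_weight x y z) =
     (\<Sum>(x, y, z)\<in>selling (4 * d). ?G x y z + ?G x z y)"
    by (rule sum.cong) (auto simp: half_step_def selling_weight_def)
  also have "\<dots> = 2 * (\<Sum>(x, y, z)\<in>selling (4 * d). ?G x y z)"
    using sum_selling_perm(2)[of ?G "4 * d"] by (simp add: case_prod_unfold sum.distrib)
  also have "(\<Sum>(x, y, z)\<in>selling (4 * d). ?G x y z) =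
     (\<Sum>(x, y, z)\<in>selling d. of_bool (odd (x + y) \<and> y < x) * selling_weight x y z)"
    unfolding selling_restrict[OF pos] selling_restrict[OF assms]
  proof (rule sum.reindex_bij_witness[where j = "\<lambda>(x, y, z). (x + z div 2, z div 2, (y - z) div 4)"
        and i = "\<lambda>(x, y, z). (x - y, 2 * y + 4 * z, 2 * y)"])
    fix t assume t: "t \<in> {(x, y, z) \<in> selling (4 * d). odd x \<and> even y \<and> even z \<and> z \<le> y}"
    obtain x y z where xyz: "t = (x, y, z)" by (cases t)
    obtain z1 where z: "z = 2 * z1" using t xyz by (auto elim!: evenE)
    obtain y1 where y: "y = 2 * y1" using t xyz by (auto elim!: evenE)
    have eq: "x * (y1 + z1) + 2 * (y1 * z1) = 2 * d" and "odd x" "z1 \<le> y1" "0 \<le> z1" "0 \<le> x"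
      using t by (auto simp: xyz y z selling_def algebra_simps)
    then have "even (x * (y1 + z1))" by (metis dvd_add_left_iff dvd_triv_left)
    then have "even (y1 - z1)" using \<open>odd x\<close> by simp
    then obtain k where k: "y1 = z1 + 2 * k" by (metis evenE add.commute diff_eq_eq)
    have k0: "0 \<le> k" "0 < x" using \<open>z1 \<le> y1\<close> \<open>odd x\<close> \<open>0 \<le> x\<close> k by (auto intro: le_neq_trans)
    have d: "x * (z1 + k) + (z1 + 2 * k) * z1 = d" using eq k by (simp add: algebra_simps)
    have y0: "0 < z1 + 2 * k"
      using d assms k0 \<open>0 \<le> z1\<close> by (cases "z1 = 0 \<and> k = 0") auto
    show "(case (case t of (x, y, z) \<Rightarrow> (x + z div 2, z div 2, (y - z) div 4)) of
        (x, y, z) \<Rightarrow> (x - y, 2 * y + 4 * z, 2 * y)) = t"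
      by (simp add: xyz z y k)
    show "(case t of (x, y, z) \<Rightarrow> (x + z div 2, z div 2, (y - z) div 4)) \<in>
        {(x, y, z) \<in> selling d. odd (x + y) \<and> y < x}"
      using k0 \<open>odd x\<close> \<open>0 \<le> z1\<close> d by (auto simp: xyz z y k selling_def algebra_simps)
    have "half_step (4 * k) = half_step k" "half_step (2 * z1) = half_step z1"
        by (simp_all add: half_step_scale)
    then show "(case (case t of (x, y, z) \<Rightarrow> (x + z div 2, z div 2, (y - z) div 4)) of (x, y, z)
        \<Rightarrow> selling_weight x y z) =
       (case t of (x, y, z) \<Rightarrow> half_step (y - z) * selling_weight x y z)"
      using k0 \<open>0 \<le> z1\<close> y0 by (simp add: xyz z y k selling_weight_def half_step_simps)
  next
    fix t assume t: "t \<in> {(x, y, z) \<in> selling d. odd (x + y) \<and> y < x}"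
    obtain x y z where xyz: "t = (x, y, z)" by (cases t)
    show "(case t of (x, y, z) \<Rightarrow> (x - y, 2 * y + 4 * z, 2 * y)) \<in>
       {(x, y, z) \<in> selling (4 * d). odd x \<and> even y \<and> even z \<and> z \<le> y}"
      using t by (auto simp: xyz selling_def algebra_simps)
    show "(case (case t of (x, y, z) \<Rightarrow> (x - y, 2 * y + 4 * z, 2 * y)) of
        (x, y, z) \<Rightarrow> (x + z div 2, z div 2, (y - z) div 4)) = t"
      by (simp add: xyz)
  qed
  also have "2 * (\<Sum>(x, y, z)\<in>selling d. of_bool (odd (x + y) \<and> y < x) * selling_weight x y z) =
     (\<Sum>(x, y, z)\<in>selling d. of_bool (odd (x + y) \<and> y < x) * selling_weight x y z +
         of_bool (odd (y + x) \<and> x < y) * selling_weight y x z)"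
    using sum_selling_perm(1)[of "\<lambda>x y z. of_bool (odd (x + y) \<and> y < x) * selling_weight x y z" d]
    by (simp add: case_prod_unfold sum.distrib)
  also have "\<dots> = (\<Sum>(x, y, z)\<in>selling d. of_bool (odd (x + y)) * selling_weight x y z)"
    by (rule sum.cong) (auto simp: selling_weight_def)
  finally show ?thesis .
qed

text \<open>An even value of xy + yz + zx leaves only triples that are all even or have exactly one
  odd entry. Of x + y, y + z, z + x either none or two are odd, so the multiplicity 1 + 0 or 1 + 2
  is 2 + \<open>psign3\<close>.\<close>

lemma selling_4:
  assumes "d > 0"
  shows "(\<Sum>(x, y, z)\<in>selling (4 * d). selling_weight x y z) =
      (\<Sum>(x, y, z)\<in>selling d. (2 + psign3 x y z) * selling_weight x y z)"
proof -
  let ?o = "\<lambda>x y z. of_bool (odd x \<and> even y \<and> even z) * selling_weight x y z"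
  let ?e = "\<lambda>x y z. of_bool (odd (x + y)) * selling_weight x y z"
  have "(\<Sum>(x, y, z)\<in>selling (4 * d). selling_weight x y z) = (\<Sum>(x, y, z)\<in>selling (4 * d).
      of_bool (even (x + y) \<and> even (y + z)) * selling_weight x y z + ?o x y z + ?o y x z + ?o z y x)"
  proof (rule sum.cong[OF refl], clarify)
    fix x y z assume "(x, y, z) \<in> selling (4 * d)"
    then have "x * y + y * z + z * x = 4 * d" by (simp add: selling_def)
    then have *: "even (x * y + y * z + z * x)" by (metis dvd_mult2 even_numeral)
    have "selling_weight y x z = selling_weight x y z" "selling_weight z y x = selling_weight x y z"
        by (auto simp: selling_weight_def)
    then show "selling_weight x y z = of_bool (even (x + y) \<and> even (y + z)) * selling_weight x y z +
        ?o x y z + ?o y x z + ?o z y x"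
      using * by auto
  qed
  also have "\<dots> = (\<Sum>(x, y, z)\<in>selling (4 * d). of_bool (even (x + y) \<and> even (y + z)) *
      selling_weight x y z)
      + 3 * (\<Sum>(x, y, z)\<in>selling (4 * d). ?o x y z)"
    using sum_selling_perm(1)[of ?o "4 * d"] sum_selling_perm(5)[of ?o "4 * d"]
    by (simp add: case_prod_unfold sum.distrib)
  also have "\<dots> = (\<Sum>(x, y, z)\<in>selling d. selling_weight x y z) + 3 * (\<Sum>(x, y, z)\<in>selling d. ?e x y z)"
    unfolding selling_even[OF assms] selling_one_odd[OF assms] ..
  also have "\<dots> = (\<Sum>(x, y, z)\<in>selling d. selling_weight x y z + ?e x y z + ?e y z x + ?e z x y)"
    using sum_selling_perm(3)[of ?e d] sum_selling_perm(4)[of ?e d]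
        by (simp add: case_prod_unfold sum.distrib)
  also have "\<dots> = (\<Sum>(x, y, z)\<in>selling d. (2 + psign3 x y z) * selling_weight x y z)"
    by (rule sum.cong) (auto simp: selling_weight_def psign3_def)
  finally show ?thesis .
qed

definition selling_sum :: "int \<Rightarrow> real" where
  "selling_sum d = (if d = 0 then 1 else 4 * (\<Sum>(x, y, z)\<in>selling d. psign3 x y z * selling_weight x y z))"

text \<open>Subtracting 2 H(4d) removes precisely the constant 2 in \<open>selling_4\<close>. At d =
  0 the value is 12(-1/12 + 2/12) = 1, in accordance with the single representation of 0.\<close>

lemma hurwitz_H_selling_sum:
  assumes "d \<ge> 0"
  shows "12 * (hurwitz_H (16 * d) - 2 * hurwitz_H (4 * d)) = selling_sum d"
proof (cases "d = 0")
  case True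
  then show ?thesis by (simp add: hurwitz_H_def selling_sum_def)
next
  case False
  then have d: "d > 0" using assms by simp
  have "3 * hurwitz_H (16 * d) = (\<Sum>(x, y, z)\<in>selling (4 * d). selling_weight x y z)"
    using hurwitz_H_4[of "4 * d"] d by simp
  also have "\<dots> = 2 * (\<Sum>(x, y, z)\<in>selling d. selling_weight x y z) +
      (\<Sum>(x, y, z)\<in>selling d. psign3 x y z * selling_weight x y z)"
    unfolding selling_4[OF d] by (simp add: distrib_right case_prod_unfold sum.distrib sum_distrib_left)
  finally show ?thesis using hurwitz_H_4[OF d] False by (simp add: selling_sum_def)
qed

section \<open>Gauss's three-square count by deconvolution\<close>

lemma divisor_pairs_diag: "(\<Sum>(s, k)\<in>divisor_pairs n. of_bool (s = k) :: real) = of_bool (\<exists>r>0. n = r^2)"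
proof (cases "\<exists>r>0. n = r^2")
  case True
  then obtain r where r: "r > 0" "n = r^2" by blast
  have root: "s = r" if "(s, s) \<in> divisor_pairs n" for s
  proof -
    have "s^2 = r^2" "0 \<le> s" "0 \<le> r" using that r by (auto simp: divisor_pairs_def power2_eq_square)
    then show ?thesis by (simp only: power2_eq_iff_nonneg)
  qed
  have "(r, r) \<in> divisor_pairs n" using r by (simp add: divisor_pairs_def power2_eq_square)
  then have "(\<Sum>(s, k)\<in>divisor_pairs n. of_bool (s = k) :: real) = (\<Sum>x\<in>{(r, r)}. 1)"
    by (intro sum.mono_neutral_cong_right[OF finite_divisor_pairs]) (auto dest: root)
  then show ?thesis using True by simp
next
  case False
  then have "(\<Sum>(s, k)\<in>divisor_pairs n. of_bool (s = k) :: real) = 0"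
    by (intro sum.neutral) (auto simp: divisor_pairs_def power2_eq_square)
  then show ?thesis using False by simp
qed

lemma square_pos_root: "n \<ge> 1 \<Longrightarrow> (\<exists>r>0. n = (r::int)^2) \<longleftrightarrow> (\<exists>r. n = r^2)"
proof
  assume n: "n \<ge> 1" and "\<exists>r. n = r^2"
  then obtain r where "n = r^2" by blast
  then have "n = \<bar>r\<bar>^2" "\<bar>r\<bar> > 0" using n by auto
  then show "\<exists>r>0. n = r^2" by blast
qed blast

lemma sum_roots_upto_fold:
  assumes "\<And>w. F (- w) = F w"
  shows "(\<Sum>w\<in>roots_upto n. F w) = 2 * (\<Sum>w\<in>{w \<in> roots_upto n. 0 \<le> w}. half_step w * (F w :: real))"
proof -
  have "(\<Sum>w\<in>roots_upto n. half_step (- w) * F w) = (\<Sum>w\<in>roots_upto n. half_step w * F w)"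
    by (rule sum.reindex_bij_witness[where i = uminus and j = uminus]) (auto simp: roots_upto_def assms)
  moreover have "(\<Sum>w\<in>roots_upto n. F w) = (\<Sum>w\<in>roots_upto n. half_step w * F w + half_step (- w) * F w)"
    by (rule sum.cong) (auto simp: half_step_def)
  moreover have "(\<Sum>w\<in>roots_upto n. half_step w * F w) = (\<Sum>w\<in>{w \<in> roots_upto n. 0 \<le> w}. half_step w * F w)"
    by (rule sum.mono_neutral_right[OF finite_roots_upto]) (auto simp: half_step_def)
  ultimately show ?thesis by (simp add: sum.distrib)
qed

lemma selling_pos:
  assumes "(x, y, z) \<in> selling D" "D > 0"
  shows "0 \<le> x" "0 \<le> y" "0 \<le> z" "0 < x + y" "0 < x + z" "0 < y + z"
proof -
  show *: "0 \<le> x" "0 \<le> y" "0 \<le> z" using assms by (auto simp: selling_def)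
  have "\<not> (x = 0 \<and> y = 0)" "\<not> (x = 0 \<and> z = 0)" "\<not> (y = 0 \<and> z = 0)"
    using assms by (auto simp: selling_def)
  then show "0 < x + y" "0 < x + z" "0 < y + z" using * by linarith+
qed

text \<open>Matrices of odd trace have weight 0, so half the trace is an integer w. Both
  off-diagonal entries are sums of two parameters, which identifies the scalar case modulo 2 with
  the sign in \<open>psign3\<close>.\<close>

lemma even_elliptic_selling:
  "(\<Sum>(p, q, s, t)\<in>elliptic n. ell_weight p q s t * even_eps p q s t) =
   (\<Sum>w\<in>{w. w^2 < n \<and> 0 \<le> w}. half_step w * (\<Sum>(x, y, z)\<in>selling (n - w^2). psign3 x y z *
       selling_weight x y z))"
proof -
  have fin: "finite {w. w^2 < n \<and> 0 \<le> w}"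
    by (rule finite_subset[OF _ finite_roots_upto[of n]]) (auto simp: roots_upto_def)
  have "(\<Sum>w\<in>{w. w^2 < n \<and> 0 \<le> w}. half_step w *
      (\<Sum>(x, y, z)\<in>selling (n - w^2). psign3 x y z * selling_weight x y z)) =
      (\<Sum>(w, x, y, z)\<in>(SIGMA w:{w. w^2 < n \<and> 0 \<le> w}. selling (n - w^2)). half_step w *
          (psign3 x y z * selling_weight x y z))"
    unfolding sum_distrib_left by (subst sum.Sigma) (auto simp: fin finite_selling case_prod_unfold)
  also have "\<dots> = (\<Sum>(p, q, s, t)\<in>{(p, q, s, t) \<in> elliptic n. even (p + q)}. ell_weight p q s t *
      even_eps p q s t)"
  proof (rule sum.reindex_bij_witness[where j = "\<lambda>(w, x, y, z). (w + x, w - x, x + z, x + y)"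
        and i = "\<lambda>(p, q, s, t). ((p + q) div 2, (p - q) div 2, t - (p - q) div 2, s - (p - q) div 2)"])
    fix u assume u: "u \<in> (SIGMA w:{w. w^2 < n \<and> 0 \<le> w}. selling (n - w^2))"
    obtain w x y z where [simp]: "u = (w, x, y, z)" by (cases u)
    have w: "w^2 < n" "0 \<le> w" and xyz: "(x, y, z) \<in> selling (n - w^2)" using u by auto
    note p = selling_pos[OF xyz]
    show "(case (case u of (w, x, y, z) \<Rightarrow> (w + x, w - x, x + z, x + y)) of
        (p, q, s, t) \<Rightarrow> ((p + q) div 2, (p - q) div 2, t - (p - q) div 2, s - (p - q) div 2)) = u"
      by simp
    show "(case u of (w, x, y, z) \<Rightarrow> (w + x, w - x, x + z, x + y)) \<in>
        {(p, q, s, t) \<in> elliptic n. even (p + q)}"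
      using w p xyz by (auto simp: elliptic_def selling_def power2_eq_square algebra_simps)
    have "half_step (2 * v) = half_step v" for v by (simp add: half_step_scale)
    moreover have "w + x + (w - x) = 2 * w" "w + x - (w - x) = 2 * x"
      "2 * (x + y) - (w + x) + (w - x) = 2 * y" "2 * (x + z) - (w + x) + (w - x) = 2 * z" by auto
    ultimately have "ell_weight (w + x) (w - x) (x + z) (x + y) = half_step w * selling_weight x y z"
      by (simp only: ell_weight_def selling_weight_def mult.assoc)
    moreover have "even_eps (w + x) (w - x) (x + z) (x + y) = psign3 x y z"
      by (auto simp: even_eps_def psign3_def)
    ultimately show "(case (case u of (w, x, y, z) \<Rightarrow> (w + x, w - x, x + z, x + y)) of
        (p, q, s, t) \<Rightarrow> ell_weight p q s t * even_eps p q s t) =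
        (case u of (w, x, y, z) \<Rightarrow> half_step w * (psign3 x y z * selling_weight x y z))"
      by simp
  next
    fix u assume u: "u \<in> {(p, q, s, t) \<in> elliptic n. even (p + q)}"
    obtain p q s t where [simp]: "u = (p, q, s, t)" by (cases u)
    have "even (p + q)" using u by simp
    then obtain w where w: "p + q = 2 * w" by (rule evenE)
    define x where "x = p - w"
    have pq: "p = w + x" "q = w - x" using w by (auto simp: x_def)
    have e: "(p, q, s, t) \<in> elliptic n" using u by simp
    define y where "y = t - x"
    define z where "z = s - x"
    have st: "t = x + y" "s = x + z" by (auto simp: y_def z_def)
    have nn: "0 \<le> w" "0 \<le> x" "0 \<le> y" "0 \<le> z" "0 < x + y" "0 < x + z" "\<not> (y = 0 \<and> z = 0)"
      using e by (auto simp: elliptic_def pq st)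
    then have "0 < x * y + y * z + z * x"
      by (smt (verit) mult_nonneg_nonneg mult_pos_pos)
    moreover have "x * y + y * z + z * x = n - w^2"
      using e by (auto simp: elliptic_def pq st power2_eq_square algebra_simps)
    ultimately show "(case u of (p, q, s, t) \<Rightarrow>
        ((p + q) div 2, (p - q) div 2, t - (p - q) div 2, s - (p - q) div 2)) \<in>
        (SIGMA w:{w. w^2 < n \<and> 0 \<le> w}. selling (n - w^2))"
      using nn by (auto simp: pq st selling_def)
    show "(case (case u of (p, q, s, t) \<Rightarrow>
        ((p + q) div 2, (p - q) div 2, t - (p - q) div 2, s - (p - q) div 2)) of
        (w, x, y, z) \<Rightarrow> (w + x, w - x, x + z, x + y)) = u"
      by (simp add: pq st)
  qed
  also have "\<dots> = (\<Sum>(p, q, s, t)\<in>elliptic n. ell_weight p q s t * even_eps p q s t)"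
    by (rule sum.mono_neutral_left[OF finite_elliptic]) (auto simp: even_eps_def)
  finally show ?thesis by simp
qed

text \<open>If n is a square, the two roots of w^2 = n contribute 2. The diagonal defect 1/4 of
  \<open>even_elliptic_sum\<close>, multiplied by 8 for the normalization and the two signs of w,
  takes this away.\<close>

lemma sum_selling_sum:
  assumes "n \<ge> 1"
  shows "(\<Sum>w\<in>roots_upto n. selling_sum (n - w^2)) = jacobi_sum n"
proof -
  let ?F = "\<lambda>w. of_bool (w^2 < n) * (\<Sum>(x, y, z)\<in>selling (n - w^2). psign3 x y z * selling_weight x y z)"
  have "(\<Sum>w\<in>roots_upto n. selling_sum (n - w^2)) = (\<Sum>w\<in>roots_upto n. of_bool (w^2 = n) * 1 + 4 * ?F w)"
    by (rule sum.cong) (auto simp: selling_sum_def roots_upto_def)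
  also have "\<dots> = (\<Sum>w\<in>roots_upto n. of_bool (w^2 = n) * 1) + 4 * (\<Sum>w\<in>roots_upto n. ?F w)"
    by (simp only: sum.distrib sum_distrib_left)
  also have "(\<Sum>w\<in>roots_upto n. ?F w) = 2 * (\<Sum>w\<in>{w \<in> roots_upto n. 0 \<le> w}. half_step w * ?F w)"
    by (rule sum_roots_upto_fold) simp
  also have "(\<Sum>w\<in>{w \<in> roots_upto n. 0 \<le> w}. half_step w * ?F w) =
      (\<Sum>w\<in>{w. w^2 < n \<and> 0 \<le> w}. half_step w *
          (\<Sum>(x, y, z)\<in>selling (n - w^2). psign3 x y z * selling_weight x y z))"
    using finite_roots_upto[of n] by (intro sum.mono_neutral_cong_right) (auto simp: roots_upto_def)
  also have "\<dots> = (\<Sum>(s, k)\<in>divisor_pairs n. psign s k * of_int k)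
      - (\<Sum>(s, k)\<in>divisor_pairs n. of_bool (s = k)) / 4"
    unfolding even_elliptic_selling[symmetric] even_elliptic_sum
    by (simp add: case_prod_unfold sum_subtractf sum_divide_distrib)
  also have "(\<Sum>(s, k)\<in>divisor_pairs n. psign s k * of_int k) = div_sum n"
    unfolding div_sum_def using divisor_pairs_swap[of "\<lambda>y z. psign y z * of_int y" n]
        by (simp add: psign_commute)
  finally show ?thesis
    using assms unfolding divisor_pairs_diag square_pos_root[OF assms] sum_roots_upto_eq[OF assms]
    by (simp add: jacobi_sum_def)
qed

theorem three_squares:
  assumes "n \<ge> 0"
  shows "real (card (squares3 n)) = selling_sum n"
  using assms
proof (induction "nat n" arbitrary: n rule: less_induct)
  case less
  show ?case
  proof (cases "n = 0")
    case True
    have "squares3 0 = {(0, 0, 0)}"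
      by (auto simp: squares3_def) (smt (verit) zero_le_power2 power2_eq_iff zero_eq_power2)+
    then show ?thesis using True by (simp add: selling_sum_def)
  next
    case False
    then have n: "n \<ge> 1" using less.prems by simp
    have "(\<Sum>x\<in>roots_upto n - {0}. real (card (squares3 (n - x^2)))) =
        (\<Sum>x\<in>roots_upto n - {0}. selling_sum (n - x^2))"
    proof (rule sum.cong[OF refl])
      fix x assume x: "x \<in> roots_upto n - {0}"
      then have "nat (n - x^2) < nat n" "n - x^2 \<ge> 0" using n by (auto simp: roots_upto_def)
      from less.hyps[OF this] show "real (card (squares3 (n - x^2))) = selling_sum (n - x^2)" .
    qed
    moreover have "(\<Sum>x\<in>roots_upto n. real (card (squares3 (n - x^2)))) =
        (\<Sum>x\<in>roots_upto n. selling_sum (n - x^2))"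
      unfolding sum_selling_sum[OF n] using jacobi_four_squares[of n] n by (simp add: card_squares4)
    ultimately show ?thesis
      using n by (simp add: sum.remove[OF finite_roots_upto roots_upto_zero])
  qed
qed

section \<open>Odd trace and discriminants 3 modulo 8\<close>

lemma odd_elliptic_selling:
  assumes "odd n"
  shows "(\<Sum>(p, q, s, t)\<in>elliptic n. ell_weight p q s t * odd_eps p q s t) =
   (\<Sum>w\<in>{w. w^2 < 4 * n \<and> 0 \<le> w \<and> odd w}. 3 * hurwitz_H (4 * n - w^2))"
proof -
  let ?W = "{w. w^2 < 4 * n \<and> 0 \<le> w \<and> odd w}"
  let ?O = "\<lambda>D. {(x, y, z) \<in> selling D. odd x \<and> odd y \<and> odd z}"
  have fin: "finite ?W"
    by (rule finite_subset[OF _ finite_roots_upto[of "4 * n"]]) (auto simp: roots_upto_def)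
  have finO: "finite (?O D)" if "D > 0" for D
    by (rule finite_subset[OF _ finite_selling[OF that]]) auto
  have finO': "\<forall>w\<in>?W. finite (?O (4 * n - w^2))" by (intro ballI finO) simp
  have "(\<Sum>w\<in>?W. 3 * hurwitz_H (4 * n - w^2)) = (\<Sum>w\<in>?W. \<Sum>(x, y, z)\<in>?O (4 * n - w^2). 1)"
  proof (rule sum.cong[OF refl])
    fix w assume "w \<in> ?W"
    then have w: "4 * n - w^2 > 0" "odd w" by auto
    have "(\<Sum>(x, y, z)\<in>selling (4 * n - w^2). of_bool (even (x + y) \<and> even (y + z)) *
        selling_weight x y z) =
       (\<Sum>(x, y, z)\<in>?O (4 * n - w^2). 1)"
    proof (rule sum.mono_neutral_cong_right[OF finite_selling[OF w(1)]])
      show "\<forall>i\<in>selling (4 * n - w^2) - ?O (4 * n - w^2).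
          (case i of (x, y, z) \<Rightarrow> of_bool (even (x + y) \<and> even (y + z)) * selling_weight x y z) = 0"
      proof
        fix u assume u: "u \<in> selling (4 * n - w^2) - ?O (4 * n - w^2)"
        obtain x y z where [simp]: "u = (x, y, z)" by (cases u)
        have "x * y + y * z + z * x = 4 * n - w^2" "\<not> (odd x \<and> odd y \<and> odd z)"
          using u by (auto simp: selling_def)
        moreover have "odd (4 * n - w^2)" using w by simp
        ultimately have "\<not> (even (x + y) \<and> even (y + z))"
          by (metis even_add even_mult_iff)
        then show "(case u of (x, y, z) \<Rightarrow> of_bool (even (x + y) \<and> even (y + z)) *
            selling_weight x y z) = 0"
          by simp
      qed
    qed (auto simp: selling_def selling_weight_def half_step_def)
    then show "3 * hurwitz_H (4 * n - w^2) = (\<Sum>(x, y, z)\<in>?O (4 * n - w^2). 1)"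
      using hurwitz_H_selling[OF w(1)] by simp
  qed
  also have "\<dots> = (\<Sum>(w, x, y, z)\<in>(SIGMA w:?W. ?O (4 * n - w^2)). 1)"
    by (subst sum.Sigma[OF fin finO']) simp
  \<comment> \<open>For odd trace the coordinates w, x, y, z are doubled. All of them are odd, hence
    nonzero, so no boundary case occurs and every \<open>half_step\<close> is 1.\<close>
  also have "\<dots> = (\<Sum>(p, q, s, t)\<in>{(p, q, s, t) \<in> elliptic n. odd (p + q) \<and> odd s \<and> odd t}.
      ell_weight p q s t * odd_eps p q s t)"
  proof (rule sum.reindex_bij_witness[where i =
      "\<lambda>(p, q, s, t). (p + q, p - q, 2 * t - p + q, 2 * s - p + q)"
        and j = "\<lambda>(w, x, y, z). ((w + x) div 2, (w - x) div 2, (x + z) div 2, (x + y) div 2)"])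
    fix u assume u: "u \<in> (SIGMA w:?W. ?O (4 * n - w^2))"
    obtain w x y z where [simp]: "u = (w, x, y, z)" by (cases u)
    have w: "0 \<le> w" "odd w" "odd x" "odd y" "odd z" and xyz: "(x, y, z) \<in> selling (4 * n - w^2)"
      using u by auto
    have pos: "0 \<le> x" "0 \<le> y" "0 \<le> z" "w^2 + (x * y + y * z + z * x) = 4 * n"
        using xyz by (auto simp: selling_def)
    have pos: "0 < w" "0 < x" "0 < y" "0 < z" "w^2 + (x * y + y * z + z * x) = 4 * n"
      using pos w by (auto intro: le_neq_trans)
    obtain p where p: "w + x = 2 * p" using w by (metis odd_even_add evenE)
    obtain s where s: "x + z = 2 * s" using w by (metis odd_even_add evenE)
    obtain t where t: "x + y = 2 * t" using w by (metis odd_even_add evenE)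
    define q where "q = w - p"
    have eq: "w = p + q" "x = p - q" "y = 2 * t - p + q" "z = 2 * s - p + q"
      using p s t by (auto simp: q_def)
    have n: "p * q + s * t = n" using pos(5) unfolding eq by (simp add: power2_eq_square algebra_simps)
    have "even (p * q)" using w(2) unfolding eq by auto
    then have st: "odd s" "odd t" using n assms by (metis even_add even_mult_iff)+
    have j: "(case u of (w, x, y, z) \<Rightarrow> ((w + x) div 2, (w - x) div 2, (x + z) div 2, (x + y) div 2))
        = (p, q, s, t)"
      by (simp add: eq)
    show "(case (case u of (w, x, y, z) \<Rightarrow> ((w + x) div 2, (w - x) div 2, (x + z) div 2, (x + y) div 2)) of
        (p, q, s, t) \<Rightarrow> (p + q, p - q, 2 * t - p + q, 2 * s - p + q)) = u"
      unfolding j by (simp add: eq)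
    show "(case u of (w, x, y, z) \<Rightarrow> ((w + x) div 2, (w - x) div 2, (x + z) div 2, (x + y) div 2)) \<in>
       {(p, q, s, t) \<in> elliptic n. odd (p + q) \<and> odd s \<and> odd t}"
      unfolding j using n st w(2) pos by (auto simp: elliptic_def eq)
    show "(case (case u of (w, x, y, z) \<Rightarrow> ((w + x) div 2, (w - x) div 2, (x + z) div 2, (x + y) div 2)) of
        (p, q, s, t) \<Rightarrow> ell_weight p q s t * odd_eps p q s t) = (case u of (w, x, y, z) \<Rightarrow> 1)"
      unfolding j using st w(2) pos by (simp add: eq ell_weight_def odd_eps_def half_step_simps)
  next
    fix u assume u: "u \<in> {(p, q, s, t) \<in> elliptic n. odd (p + q) \<and> odd s \<and> odd t}"
    obtain p q s t where [simp]: "u = (p, q, s, t)" by (cases u)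
    have e: "0 < s" "0 < t" "p * q + s * t = n" "0 \<le> p + q" "q \<le> p" "p - q \<le> 2 * s" "p - q \<le> 2 * t"
        "odd (p + q)"
      using u by (auto simp: elliptic_def)
    have D: "4 * n - (p + q)^2 = (p - q) * (2 * t - p + q) + (2 * t - p + q) * (2 * s - p + q) +
        (2 * s - p + q) * (p - q)"
      unfolding e(3)[symmetric] by (simp add: power2_eq_square algebra_simps)
    have od: "odd (p - q)" "odd (2 * t - p + q)" "odd (2 * s - p + q)" using e(8) by auto
    then have "p - q \<noteq> 0" "2 * t - p + q \<noteq> 0" "2 * s - p + q \<noteq> 0" by (metis even_zero)+
    then have "0 < p - q" "0 < 2 * t - p + q" "0 < 2 * s - p + q" using e by linarith+
    moreover have "0 < a * b + b * c + c * a" if "0 < a" "0 < b" "0 < c" for a b c :: int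
      using that by (simp add: add_pos_pos)
    ultimately have "0 < 4 * n - (p + q)^2" unfolding D by blast
    then show "(case u of (p, q, s, t) \<Rightarrow> (p + q, p - q, 2 * t - p + q, 2 * s - p + q)) \<in>
        (SIGMA w:?W. ?O (4 * n - w^2))"
      using e od D by (auto simp: selling_def)
    show "(case (case u of (p, q, s, t) \<Rightarrow> (p + q, p - q, 2 * t - p + q, 2 * s - p + q)) of
        (w, x, y, z) \<Rightarrow> ((w + x) div 2, (w - x) div 2, (x + z) div 2, (x + y) div 2)) = u"
      by simp
  qed
  also have "\<dots> = (\<Sum>(p, q, s, t)\<in>elliptic n. ell_weight p q s t * odd_eps p q s t)"
    by (rule sum.mono_neutral_left[OF finite_elliptic]) (auto simp: odd_eps_def)
  finally show ?thesis by simp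
qed

text \<open>The factor 4 goes to the first divisor, to the second, or as 2 to each, with a minus
  sign: 4 + 1 - 2 = 3.\<close>

lemma div_sum_times_4:
  assumes "odd n"
  shows "div_sum (4 * n) = 3 * div_sum n"
proof -
  let ?f = "\<lambda>(y, z). psign y z * real_of_int y"
  have odd: "odd a" "odd b" "0 < a" "0 < b" "a * b = n" if "(a, b) \<in> divisor_pairs n" for a b
    using that assms by (auto simp: divisor_pairs_def)
  have "divisor_pairs (4 * n) = (\<lambda>(a, b). (4 * a, b)) ` divisor_pairs n \<union>
      ((\<lambda>(a, b). (a, 4 * b)) ` divisor_pairs n \<union> (\<lambda>(a, b). (2 * a, 2 * b)) ` divisor_pairs n)"
          (is "_ = ?A \<union> (?B \<union> ?C)")
  proof (intro equalityI subsetI)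
    fix u assume u: "u \<in> divisor_pairs (4 * n)"
    obtain y z where [simp]: "u = (y, z)" by (cases u)
    have yz: "0 < y" "0 < z" "y * z = 4 * n" using u by (auto simp: divisor_pairs_def)
    consider "even y" "even z" | "odd y" | "odd z" by blast
    then show "u \<in> ?A \<union> (?B \<union> ?C)"
    proof cases
      case 1
      then obtain a b where "y = 2 * a" "z = 2 * b" by (meson evenE)
      then have "u \<in> ?C" using yz by (auto simp: divisor_pairs_def image_iff)
      then show ?thesis by blast
    next
      case 2
      then have "coprime (2^2) y" unfolding coprime_power_left_iff by simp
      then have "4 dvd z" using yz(3)
        by (metis coprime_dvd_mult_right_iff dvd_triv_left power2_eq_square
            numeral_Bit0 mult_2 four_x_squared one_power2 mult.right_neutral)
      then obtain b where "z = 4 * b" by (rule dvdE)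
      then have "u \<in> ?B" using yz by (auto simp: divisor_pairs_def image_iff)
      then show ?thesis by blast
    next
      case 3
      then have "coprime (2^2) z" unfolding coprime_power_left_iff by simp
      then have "4 dvd y" using yz(3)
        by (metis coprime_dvd_mult_left_iff dvd_triv_left power2_eq_square
            numeral_Bit0 mult_2 four_x_squared one_power2 mult.right_neutral)
      then obtain a where "y = 4 * a" by (rule dvdE)
      then have "u \<in> ?A" using yz by (auto simp: divisor_pairs_def image_iff)
      then show ?thesis by blast
    qed
  qed (auto simp: divisor_pairs_def)
  then have "div_sum (4 * n) = sum ?f (?A \<union> (?B \<union> ?C))" by (simp only: div_sum_def)
  also have "\<dots> = sum ?f ?A + sum ?f (?B \<union> ?C)"
    by (rule sum.union_disjoint) (auto simp: finite_divisor_pairs dest: odd)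
  also have "sum ?f (?B \<union> ?C) = sum ?f ?B + sum ?f ?C"
    by (rule sum.union_disjoint) (auto simp: finite_divisor_pairs dest: odd)
  also have "sum ?f ?A = (\<Sum>(a, b)\<in>divisor_pairs n. 4 * of_int a)"
    by (subst sum.reindex) (auto simp: inj_on_def psign_def odd intro!: sum.cong)
  also have "sum ?f ?B = (\<Sum>(a, b)\<in>divisor_pairs n. of_int a)"
    by (subst sum.reindex) (auto simp: inj_on_def psign_def odd intro!: sum.cong)
  also have "sum ?f ?C = (\<Sum>(a, b)\<in>divisor_pairs n. - 2 * of_int a)"
    by (subst sum.reindex) (auto simp: inj_on_def psign_def intro!: sum.cong)
  also have "(\<Sum>(a, b)\<in>divisor_pairs n. 4 * of_int a) + ((\<Sum>(a, b)\<in>divisor_pairs n. of_int a) +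
      (\<Sum>(a, b)\<in>divisor_pairs n. - 2 * of_int a)) = (\<Sum>(a, b)\<in>divisor_pairs n. 3 * real_of_int a)"
    unfolding sum.distrib[symmetric] by (rule sum.cong) auto
  also have "\<dots> = 3 * div_sum n"
    unfolding div_sum_def sum_distrib_left by (rule sum.cong) (auto simp: psign_def dest: odd)
  finally show ?thesis .
qed

lemma square_mod_4: "(x::int)^2 mod 4 = (if even x then 0 else 1)"
proof -
  have "x mod 4 \<in> {0, 1, 2, 3}" using pos_mod_sign[of 4 x] pos_mod_bound[of 4 x] by auto
  moreover have "x^2 mod 4 = (x mod 4)^2 mod 4" by (simp add: power_mod)
  moreover have "even x \<longleftrightarrow> even (x mod 4)" by presburger
  ultimately show ?thesis by auto
qed

lemma mod_4_sum: "(i mod 4 + j mod 4 + k mod 4 + l mod 4) mod 4 = (i + j + k + l) mod (4::int)"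
  by (intro mod_add_cong) simp_all

text \<open>Four squares with sum divisible by 4 have roots of equal parity. The even ones are the
  representations of n, and Jacobi's formula for 4n and n leaves 24 - 8 = 16.\<close>

lemma four_odd_squares:
  assumes "odd n" "n \<ge> 0"
  shows "(\<Sum>w\<in>{w \<in> roots_upto (4 * n). odd w}. real (card (squares3 (4 * n - w^2)))) = 16 * div_sum n"
proof -
  have "card {w \<in> squares4 (4 * n). even (fst w)} = card (squares4 n)"
  proof (rule bij_betw_same_card[symmetric], rule bij_betw_imageI)
    show "inj_on (\<lambda>(a, b, c, d). (2 * a, 2 * b, 2 * c, 2 * d)) (squares4 n)" by (auto simp: inj_on_def)
    show "(\<lambda>(a, b, c, d). (2 * a, 2 * b, 2 * c, 2 * d)) ` squares4 n =
        {w \<in> squares4 (4 * n). even (fst w)}"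
    proof (intro equalityI subsetI)
      fix u assume u: "u \<in> {w \<in> squares4 (4 * n). even (fst w)}"
      obtain a b c d where [simp]: "u = (a, b, c, d)" by (cases u)
      have e: "a^2 + b^2 + c^2 + d^2 = 4 * n" "even a" using u by (auto simp: squares4_def)
      have "(a^2 mod 4 + b^2 mod 4 + c^2 mod 4 + d^2 mod 4) mod 4 = 0"
        unfolding mod_4_sum e(1) by simp
      then have "even b" "even c" "even d"
        unfolding square_mod_4 using e(2) by (auto split: if_splits)
      with e obtain a' b' c' d' where "a = 2 * a'" "b = 2 * b'" "c = 2 * c'" "d = 2 * d'" by (meson evenE)
      then show "u \<in> (\<lambda>(a, b, c, d). (2 * a, 2 * b, 2 * c, 2 * d)) ` squares4 n"
        using e by (auto simp: squares4_def image_iff power2_eq_square)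
    qed (auto simp: squares4_def power2_eq_square)
  qed
  moreover have "card {w \<in> squares4 (4 * n). odd (fst w)} =
      (\<Sum>w\<in>{w \<in> roots_upto (4 * n). odd w}. card (squares3 (4 * n - w^2)))"
  proof -
    have "{w \<in> squares4 (4 * n). odd (fst w)} =
        (SIGMA w:{w \<in> roots_upto (4 * n). odd w}. squares3 (4 * n - w^2))"
      by (auto simp: squares4_Sigma)
    then show ?thesis using finite_roots_upto[of "4 * n"] by (simp add: finite_squares3)
  qed
  moreover have "card (squares4 (4 * n)) = card {w \<in> squares4 (4 * n). even (fst w)} +
      card {w \<in> squares4 (4 * n). odd (fst w)}"
    using finite_squares4[of "4 * n"] by (subst card_Un_disjoint[symmetric])
        (auto intro!: arg_cong[of _ _ card])
  ultimately have "real (\<Sum>w\<in>{w \<in> roots_upto (4 * n). odd w}. card (squares3 (4 * n - w^2))) =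
      real (card (squares4 (4 * n))) - real (card (squares4 n))"
    by simp
  also have "\<dots> = 16 * div_sum n"
    using assms jacobi_four_squares[of n] jacobi_four_squares[of "4 * n"]
    by (auto simp: jacobi_sum_def div_sum_times_4[OF assms(1)])
  finally show ?thesis by simp
qed

text \<open>Both signs of w double the sum from \<open>odd_elliptic_sum\<close>, and 24 = 8 * 3. An
  odd square is never 4n, so the bounds w^2 \<le> 4n and w^2 < 4n agree here.\<close>

lemma hurwitz_odd_sum:
  assumes "odd n" "n \<ge> 0"
  shows "(\<Sum>w\<in>{w \<in> roots_upto (4 * n). odd w}. 24 * hurwitz_H (4 * n - w^2)) = 16 * div_sum n"
proof -
  let ?F = "\<lambda>w. of_bool (odd w) * (3 * hurwitz_H (4 * n - w^2))"
  have sq: "w^2 < 4 * n" if "odd w" "w^2 \<le> 4 * n" for w :: int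
  proof -
    have "odd (w^2)" using that by simp
    then have "w^2 \<noteq> 4 * n" by (metis dvd_mult2 even_numeral)
    then show ?thesis using that by simp
  qed
  have "(\<Sum>w\<in>{w \<in> roots_upto (4 * n). odd w}. 3 * hurwitz_H (4 * n - w^2)) = (\<Sum>w\<in>roots_upto (4 * n). ?F w)"
    by (rule sum.mono_neutral_cong_left[OF finite_roots_upto]) auto
  also have "\<dots> = 2 * (\<Sum>w\<in>{w \<in> roots_upto (4 * n). 0 \<le> w}. half_step w * ?F w)"
    by (rule sum_roots_upto_fold) simp
  also have "(\<Sum>w\<in>{w \<in> roots_upto (4 * n). 0 \<le> w}. half_step w * ?F w) =
      (\<Sum>w\<in>{w. w^2 < 4 * n \<and> 0 \<le> w \<and> odd w}. 3 * hurwitz_H (4 * n - w^2))"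
  proof (rule sum.mono_neutral_cong_right)
    show "finite {w \<in> roots_upto (4 * n). 0 \<le> w}" using finite_roots_upto by simp
  qed (auto simp: roots_upto_def half_step_def dest: sq intro: le_neq_trans)
  also have "\<dots> = (\<Sum>(s, k)\<in>divisor_pairs n. of_int k)"
    unfolding odd_elliptic_selling[OF assms(1), symmetric] odd_elliptic_sum[OF assms(1)] ..
  also have "\<dots> = div_sum n"
    unfolding div_sum_def divisor_pairs_swap[of "\<lambda>y z. of_int y" n]
    by (rule sum.cong) (use assms in \<open>auto simp: psign_def divisor_pairs_def\<close>)
  finally show ?thesis by (simp add: sum_distrib_left[symmetric])
qed

text \<open>Put D = 4n - 1, so that n is odd. Odd squares are 1 modulo 8, hence all terms except w =
  1 and w = -1 have smaller arguments that are again 3 modulo 8, and those two both have the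
  argument D.\<close>

theorem three_squares_3_mod_8:
  assumes "D \<ge> 0" "D mod 8 = 3"
  shows "real (card (squares3 D)) = 24 * hurwitz_H D"
  using assms
proof (induction "nat D" arbitrary: D rule: less_induct)
  case less
  define n where "n = (D + 1) div 4"
  have "odd n" "D = 4 * n - 1" "n \<ge> 1" using less.prems unfolding n_def by presburger+
  note n = this
  let ?W = "{w \<in> roots_upto (4 * n). odd w}"
  have fin: "finite ?W" using finite_roots_upto by simp
  have W: "1 \<in> ?W" "- 1 \<in> ?W - {1}" using n by (auto simp: roots_upto_def)
  have "(\<Sum>w\<in>?W - {1} - {- 1}. real (card (squares3 (4 * n - w^2)))) =
      (\<Sum>w\<in>?W - {1} - {- 1}. 24 * hurwitz_H (4 * n - w^2))"
  proof (rule sum.cong[OF refl])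
    fix w assume w: "w \<in> ?W - {1} - {- 1}"
    then have "w \<noteq> 1" "w \<noteq> - 1" "odd w" "w^2 \<le> 4 * n" by (auto simp: roots_upto_def)
    then have "\<bar>w\<bar> > 1" by (cases "w = 0") auto
    then have "w^2 > 1" using abs_le_square[of w] by linarith
    obtain k where k: "w = 2 * k + 1" using \<open>odd w\<close> by (rule oddE)
    have "even (k * (k + 1))" by simp
    then obtain j where j: "k * (k + 1) = 2 * j" by (rule evenE)
    have w2: "w^2 = 8 * j + 1" using j unfolding k by (simp add: power2_eq_square algebra_simps)
    have "4 * n - w^2 = D - 8 * j" using n w2 by simp
    moreover have "(D - 8 * j) mod 8 = 3" using less.prems(2) by presburger
    moreover have "0 \<le> D - 8 * j" using w2 n(2) \<open>w^2 \<le> 4 * n\<close> \<open>odd n\<close> calculation(2) by presburger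
    moreover have "nat (D - 8 * j) < nat D"
      using w2 \<open>w^2 > 1\<close> less.prems by (cases "D = 0") auto
    ultimately show "real (card (squares3 (4 * n - w^2))) = 24 * hurwitz_H (4 * n - w^2)"
      using less.hyps[of "D - 8 * j"] by simp
  qed
  moreover have "(\<Sum>w\<in>?W. real (card (squares3 (4 * n - w^2)))) = (\<Sum>w\<in>?W. 24 * hurwitz_H (4 * n - w^2))"
    using four_odd_squares[OF n(1)] hurwitz_odd_sum[OF n(1)] n(3) by simp
  ultimately show ?case
    using fin W n(2) by (simp add: sum.remove[OF fin W(1)] sum.remove[OF _ W(2)])
qed

section \<open>Sums of four polygonal numbers\<close>

definition sq_sum_reps :: "int \<Rightarrow> int \<Rightarrow> (int \<times> int \<times> int \<times> int) set" where
  "sq_sum_reps Q s = {(a, b, c, d). a^2 + b^2 + c^2 + d^2 = Q \<and> a + b + c + d = s}"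

text \<open>Here a + b - s is (a + b - c - d)/2, and likewise for the others: three rows of an
  orthogonal matrix with entries 1/2 and -1/2 whose remaining row gives s. Even \<open>Q\<close>
  makes x + y + z + s even, so the inverse is integral.\<close>

lemma sq_sum_reps_even:
  assumes "even Q"
  shows "card (sq_sum_reps Q (2 * s)) = card (squares3 (Q - s^2))"
proof (rule bij_betw_same_card, rule bij_betw_imageI)
  let ?f = "\<lambda>(a, b, c, d). (a + b - s, a + c - s, a + d - s)"
  show "inj_on ?f (sq_sum_reps Q (2 * s))" by (auto simp: inj_on_def sq_sum_reps_def)
  show "?f ` sq_sum_reps Q (2 * s) = squares3 (Q - s^2)"
  proof (intro equalityI subsetI)
    fix u assume "u \<in> ?f ` sq_sum_reps Q (2 * s)"
    then obtain a b c d where u: "u = (a + b - s, a + c - s, a + d - s)"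
      and 1: "a^2 + b^2 + c^2 + d^2 = Q" "a + b + c + d = 2 * s" by (auto simp: sq_sum_reps_def)
    have d: "d = 2 * s - a - b - c" using 1(2) by simp
    show "u \<in> squares3 (Q - s^2)"
      unfolding u squares3_def 1(1)[symmetric] d by (simp add: power2_eq_square algebra_simps)
  next
    fix u assume u: "u \<in> squares3 (Q - s^2)"
    obtain x y z where [simp]: "u = (x, y, z)" by (cases u)
    have Q: "x^2 + y^2 + z^2 + s^2 = Q" using u by (auto simp: squares3_def)
    then have "even (x^2 + y^2 + z^2 + s^2)" using assms by simp
    then have "even (x + y + z + s)" by simp
    then obtain a where a: "x + y + z + s = 2 * a" by (rule evenE)
    have s: "s = 2 * a - x - y - z" using a by simp
    have "(a, a - y - z, a - x - z, a - x - y) \<in> sq_sum_reps Q (2 * s)"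
      unfolding sq_sum_reps_def Q[symmetric] s by (simp add: power2_eq_square algebra_simps)
    moreover have "u = ?f (a, a - y - z, a - x - z, a - x - y)" using s by simp
    ultimately show "u \<in> ?f ` sq_sum_reps Q (2 * s)" by blast
  qed
qed

text \<open>The map is doubled to be integral, and its image consists of the triples with 4 dividing
  x + y + z + s. All coordinates are odd, and this sum and the one for the negated triple are even
  numbers adding up to 2s, which is 2 modulo 4. So exactly one of each triple and its negative is in
  the image.\<close>

lemma sq_sum_reps_odd:
  assumes "odd s"
  shows "2 * card (sq_sum_reps Q s) = card (squares3 (4 * Q - s^2))"
proof -
  let ?f = "\<lambda>(a, b, c, d). (2 * (a + b) - s, 2 * (a + c) - s, 2 * (a + d) - s)"
  let ?P = "{(x, y, z) \<in> squares3 (4 * Q - s^2). 4 dvd x + y + z + s}"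
  let ?N = "{(x, y, z) \<in> squares3 (4 * Q - s^2). \<not> 4 dvd x + y + z + s}"
  have od: "odd x \<and> odd y \<and> odd z" if "(x, y, z) \<in> squares3 (4 * Q - s^2)" for x y z
  proof -
    have "x^2 + y^2 + z^2 + s^2 = 4 * Q" using that by (auto simp: squares3_def)
    then have "(x^2 mod 4 + y^2 mod 4 + z^2 mod 4 + s^2 mod 4) mod 4 = 0"
      by (simp only: mod_4_sum) simp
    then show ?thesis unfolding square_mod_4 using assms by (auto split: if_splits)
  qed
  have "card (sq_sum_reps Q s) = card ?P"
  proof (rule bij_betw_same_card, rule bij_betw_imageI)
    show "inj_on ?f (sq_sum_reps Q s)" by (auto simp: inj_on_def sq_sum_reps_def)
    show "?f ` sq_sum_reps Q s = ?P"
    proof (intro equalityI subsetI)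
      fix u assume "u \<in> ?f ` sq_sum_reps Q s"
      then obtain a b c d where u: "u = (2 * (a + b) - s, 2 * (a + c) - s, 2 * (a + d) - s)"
        and 1: "a^2 + b^2 + c^2 + d^2 = Q" "a + b + c + d = s" by (auto simp: sq_sum_reps_def)
      have d: "d = s - a - b - c" using 1(2) by simp
      have "2 * (a + b) - s + (2 * (a + c) - s) + (2 * (a + d) - s) + s = 4 * a" unfolding d by simp
      then show "u \<in> ?P"
        unfolding u squares3_def 1(1)[symmetric] d by (simp add: power2_eq_square algebra_simps)
    next
      fix u assume u: "u \<in> ?P"
      obtain x y z where [simp]: "u = (x, y, z)" by (cases u)
      have Q: "x^2 + y^2 + z^2 + s^2 = 4 * Q" using u by (auto simp: squares3_def)
      have "4 dvd x + y + z + s" using u by simp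
      then obtain a where a: "x + y + z + s = 4 * a" by (rule dvdE)
      have "odd x" "odd y" using od[of x y z] u by auto
      then have "even (x + y)" "even (x + s)" "even (y + s)" using assms by auto
      then obtain h k l where "x + s = 2 * h" "y + s = 2 * k" "x + y = 2 * l" by (meson evenE)
      then have h: "x = 2 * h - s" "y = 2 * k - s" "z = 4 * a + s - 2 * h - 2 * k" using a by auto
      have "(a, h - a, k - a, a + s - h - k) \<in> sq_sum_reps Q s"
        using Q unfolding sq_sum_reps_def h by (simp add: power2_eq_square algebra_simps)
      moreover have "u = ?f (a, h - a, k - a, a + s - h - k)" by (simp add: h)
      ultimately show "u \<in> ?f ` sq_sum_reps Q s" by blast
    qed
  qed
  moreover have "card ?N = card ?P"
  proof (rule bij_betw_same_card, rule bij_betw_byWitness)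
    have *: "4 dvd - x + - y + - z + s \<longleftrightarrow> \<not> 4 dvd x + y + z + s" if "(x, y, z) \<in>
        squares3 (4 * Q - s^2)" for x y z
      using od[OF that] assms by presburger
    show "(\<lambda>(x, y, z). (- x, - y, - z)) ` ?N \<subseteq> ?P" "(\<lambda>(x, y, z). (- x, - y, - z)) ` ?P \<subseteq> ?N"
      using * by (auto simp: squares3_def)
  qed auto
  moreover have "card (squares3 (4 * Q - s^2)) = card (?P \<union> ?N)" by (rule arg_cong[of _ _ card]) auto
  moreover have "card (?P \<union> ?N) = card ?P + card ?N"
    by (rule card_Un_disjoint; (rule finite_subset[OF _ finite_squares3[of "4 * Q - s^2"]])?) auto
  ultimately show ?thesis by simp
qed

lemma finite_sq_sum_reps: "finite (sq_sum_reps Q s)"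
  by (rule finite_subset[OF _ finite_squares4[of Q]]) (auto simp: sq_sum_reps_def squares4_def)

text \<open>With Q = n + 1 - r and s = 2 - r one has 4Q - s^2 = 4n - r^2. For odd n, even r makes Q
  even, and odd r makes 4n - r^2 congruent to 3 modulo 8, as the two counts require.\<close>

lemma card_sq_sum_reps:
  fixes n :: nat and r :: int
  assumes "odd n" "4 * int n - r^2 \<ge> 0"
  shows "real (card (sq_sum_reps (int n + 1 - r) (2 - r))) =
    (if even r then 12 * hurwitz_H2 (4 * int n - r^2) else 12 * hurwitz_H (4 * int n - r^2))"
proof (cases "even r")
  case True
  then obtain k where k: "r = 2 * k" by (rule evenE)
  have r2: "2 - r = 2 * (1 - k)" by (simp add: k)
  have d: "int n + 1 - r - (1 - k)^2 = int n - k^2" by (simp add: k power2_eq_square algebra_simps)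
  have D: "4 * int n - r^2 = 4 * (int n - k^2)" by (simp add: k power2_eq_square)
  then have "int n - k^2 \<ge> 0" using assms(2) by simp
  have "even (int n + 1 - r)" using assms(1) True by simp
  then have "real (card (sq_sum_reps (int n + 1 - r) (2 - r))) = real (card (squares3 (int n - k^2)))"
    unfolding r2 d[symmetric] by (simp only: sq_sum_reps_even)
  also have "\<dots> = selling_sum (int n - k^2)"
    using \<open>int n - k^2 \<ge> 0\<close> by (rule three_squares)
  also have "\<dots> = 12 * (hurwitz_H (16 * (int n - k^2)) - 2 * hurwitz_H (4 * (int n - k^2)))"
    using \<open>int n - k^2 \<ge> 0\<close> by (simp only: hurwitz_H_selling_sum)
  also have "\<dots> = 12 * hurwitz_H2 (4 * int n - r^2)"
    unfolding D hurwitz_H2_def by simp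
  finally show ?thesis using True by simp
next
  case False
  have D: "4 * (int n + 1 - r) - (2 - r)^2 = 4 * int n - r^2"
      by (simp add: power2_eq_square algebra_simps)
  obtain k where k: "r = 2 * k + 1" using False by (rule oddE)
  obtain j where j: "int n = 2 * j + 1" using assms(1) by (metis even_of_nat oddE)
  have "even (k * (k + 1))" by simp
  then obtain i where "k * (k + 1) = 2 * i" by (rule evenE)
  then have "4 * int n - r^2 = 8 * (j - i) + 3" by (simp add: j k power2_eq_square algebra_simps)
  then have "(4 * int n - r^2) mod 8 = 3" by presburger
  with assms(2) have "real (card (squares3 (4 * int n - r^2))) = 24 * hurwitz_H (4 * int n - r^2)"
    by (rule three_squares_3_mod_8)
  moreover have "2 * card (sq_sum_reps (int n + 1 - r) (2 - r)) = card (squares3 (4 * int n - r^2))"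
    using sq_sum_reps_odd[of "2 - r" "int n + 1 - r"] False unfolding D by simp
  ultimately show ?thesis using False by simp
qed

section \<open>Summation over n and r\<close>

lemma card_polygonal_reps:
  "polygonal_reps (m + 2) 4 N =
    card {(a, b, c, d). m * (a^2 + b^2 + c^2 + d^2) - (m - 2) * (a + b + c + d) = 2 * int N}"
proof -
  have pol: "polygonal (m + 2) a + (polygonal (m + 2) b +
      (polygonal (m + 2) c + polygonal (m + 2) d)) = int N \<longleftrightarrow>
     m * (a^2 + b^2 + c^2 + d^2) - (m - 2) * (a + b + c + d) = 2 * int N" for a b c d
    using two_times_polygonal[of "m + 2" a] two_times_polygonal[of "m + 2" b]
      two_times_polygonal[of "m + 2" c] two_times_polygonal[of "m + 2" d]
    by (simp add: algebra_simps) linarith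
  have "{ls :: int list. length ls = 4 \<and> (\<Sum>l\<leftarrow>ls. polygonal (m + 2) l) = int N} =
     (\<lambda>(a, b, c, d). [a, b, c, d]) `
     {(a, b, c, d). m * (a^2 + b^2 + c^2 + d^2) - (m - 2) * (a + b + c + d) = 2 * int N}"
         (is "?L = ?f ` ?R")
  proof (intro equalityI subsetI)
    fix ls assume ls: "ls \<in> ?L"
    then obtain a b c d where "ls = [a, b, c, d]" by (auto simp: numeral_eq_Suc length_Suc_conv)
    then show "ls \<in> ?f ` ?R" using ls by (auto simp: pol image_iff)
  qed (auto simp: pol)
  moreover have "inj_on ?f ?R" by (auto simp: inj_on_def)
  ultimately show ?thesis unfolding polygonal_reps_def by (simp add: card_image)
qed

lemma self_le_square: "(a::int) \<le> a^2"
  using abs_le_square[of a] by linarith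

theorem theorem1p1:
  fixes m :: int and N :: nat
  assumes "m \<ge> 1"
  shows "real (polygonal_reps (m + 2) 4 N) =
    (\<Sum>(n, r) \<in> {(n :: nat, r :: int).
        real_of_int m * real n / 2 - real_of_int r + 2 - real_of_int m / 2 = real N \<and>
        odd n \<and> even r \<and> 4 * int n - r^2 \<ge> 0}. 12 * hurwitz_H2 (4 * int n - r^2)) +
    (\<Sum>(n, r) \<in> {(n :: nat, r :: int).
        real_of_int m * real n / 2 - real_of_int r + 2 - real_of_int m / 2 = real N \<and>
        odd n \<and> odd r \<and> 4 * int n - r^2 \<ge> 0}. 12 * hurwitz_H (4 * int n - r^2))"
    (is "_ = sum _ ?E + sum _ ?O")
proof -
  let ?U = "{(a, b, c, d). m * (a^2 + b^2 + c^2 + d^2) - (m - 2) * (a + b + c + d) = 2 * int N}"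
  let ?P = "{(n :: nat, r :: int). m * int n - 2 * r + 4 - m = 2 * int N \<and> odd n \<and> 4 * int n - r^2 \<ge> 0}"
  let ?g = "\<lambda>(a, b, c, d). (nat (a^2 + b^2 + c^2 + d^2 - (a + b + c + d) + 1), 2 - (a + b + c + d))"
  have cond: "real_of_int m * real n / 2 - real_of_int r + 2 - real_of_int m / 2 = real N \<longleftrightarrow>
     m * int n - 2 * r + 4 - m = 2 * int N" for n r
  proof -
    have "real_of_int m * real n / 2 - real_of_int r + 2 - real_of_int m / 2 = real N \<longleftrightarrow>
       real_of_int m * real n - 2 * real_of_int r + 4 - real_of_int m = 2 * real N"
      by (rule iffI; linarith)
    also have "\<dots> \<longleftrightarrow> real_of_int (m * int n - 2 * r + 4 - m) = real_of_int (2 * int N)"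
      by simp
    finally show ?thesis by (simp only: of_int_eq_iff)
  qed
  \<comment> \<open>Finiteness matters because \<open>sum\<close> over an infinite set is 0 by
    default. Since m \<ge> 1, the linear equation bounds n by a linear function of r, while 4n \<ge>
    r^2; completing the square at r = 4 bounds r.\<close>
  have finP: "finite ?P"
  proof (rule finite_subset)
    show "?P \<subseteq> {0..nat (2 * (8 * int N + 8) + 2 * int N)} \<times> {- (8 * int N + 8)..8 * int N + 8}"
    proof clarify
      fix n r assume nr: "m * int n - 2 * r + 4 - m = 2 * int N" "odd n" "4 * int n - r^2 \<ge> 0"
      have "n \<ge> 1" using nr(2) by (cases n) auto
      then have "1 * (int n - 1) \<le> m * (int n - 1)" using assms by (intro mult_right_mono) auto
      then have n: "int n - 1 \<le> 2 * r - 4 + 2 * int N" using nr(1) by (simp add: algebra_simps)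
      then have "(r - 4)^2 \<le> 8 * int N + 4" using nr(3) by (simp add: power2_eq_square algebra_simps)
      then have "\<bar>r - 4\<bar> \<le> 8 * int N + 4" using abs_le_square[of "r - 4"] by linarith
      then have "- (8 * int N + 8) \<le> r \<and> r \<le> 8 * int N + 8" by linarith
      then show "n \<in> {0..nat (2 * (8 * int N + 8) + 2 * int N)} \<and> r \<in> {- (8 * int N + 8)..8 * int N + 8}"
        using n by auto
    qed
  qed simp
  have gU: "?g u \<in> ?P" "u \<in> sq_sum_reps (int (fst (?g u)) + 1 - snd (?g u)) (2 - snd (?g u))"
      if u: "u \<in> ?U" for u
  proof -
    obtain a b c d where [simp]: "u = (a, b, c, d)" by (cases u)
    define Q s where "Q = a^2 + b^2 + c^2 + d^2" and "s = a + b + c + d"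
    have "m * Q - (m - 2) * s = 2 * int N" using u by (simp add: Q_def s_def)
    then have 1: "m * (Q - s + 1) - 2 * (2 - s) + 4 - m = 2 * int N" by (simp add: algebra_simps)
    have "0 \<le> Q - s" unfolding Q_def s_def
      using self_le_square[of a] self_le_square[of b] self_le_square[of c] self_le_square[of d]
          by linarith
    then have n: "int (nat (Q - s + 1)) = Q - s + 1" by simp
    \<comment> \<open>Each l^2 - l is even; this is the origin of the restriction to odd n.\<close>
    have "even (Q - s)" unfolding Q_def s_def by simp
    then have "odd (nat (Q - s + 1))" by (metis n even_add even_of_nat odd_one)
    \<comment> \<open>The left side is 4Q - s^2, and the squares are the doubled remaining
      coordinates of Cauchy's change of variables.\<close>
    moreover have "4 * (Q - s + 1) - (2 - s)^2 = (a + b - c - d)^2 + (a - b + c - d)^2 +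
        (a - b - c + d)^2"
      unfolding Q_def s_def by (simp add: power2_eq_square algebra_simps)
    then have "4 * (Q - s + 1) - (2 - s)^2 \<ge> 0" by simp
    ultimately show "?g u \<in> ?P"
      using 1 n by (simp add: Q_def[symmetric] s_def[symmetric] del: int_nat_eq)
    show "u \<in> sq_sum_reps (int (fst (?g u)) + 1 - snd (?g u)) (2 - snd (?g u))"
      using n by (simp add: sq_sum_reps_def Q_def[symmetric] s_def[symmetric] del: int_nat_eq)
  qed
  have fib: "{u \<in> ?U. ?g u = p} = sq_sum_reps (int (fst p) + 1 - snd p) (2 - snd p)" if p: "p \<in> ?P" for p
  proof (intro equalityI subsetI)
    fix u assume "u \<in> {u \<in> ?U. ?g u = p}"
    then show "u \<in> sq_sum_reps (int (fst p) + 1 - snd p) (2 - snd p)" using gU(2) by blast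
  next
    fix u assume u: "u \<in> sq_sum_reps (int (fst p) + 1 - snd p) (2 - snd p)"
    obtain n r where [simp]: "p = (n, r)" by (cases p)
    obtain a b c d where [simp]: "u = (a, b, c, d)" by (cases u)
    have 1: "a^2 + b^2 + c^2 + d^2 = int n + 1 - r" "a + b + c + d = 2 - r"
      using u by (auto simp: sq_sum_reps_def)
    have "m * (int n + 1 - r) - (m - 2) * (2 - r) = 2 * int N" using p by (simp add: algebra_simps)
    then show "u \<in> {u \<in> ?U. ?g u = p}" by (simp add: 1)
  qed
  have "?U \<subseteq> (\<Union>p\<in>?P. sq_sum_reps (int (fst p) + 1 - snd p) (2 - snd p))"
    by (rule subsetI, rule UN_I[OF gU(1)], assumption, rule gU(2))
  then have finU: "finite ?U"
    by (rule finite_subset) (intro finite_UN_I finP finite_sq_sum_reps)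
  have "real (polygonal_reps (m + 2) 4 N) = (\<Sum>u\<in>?U. 1)"
    unfolding card_polygonal_reps by simp
  \<comment> \<open>The solutions are counted fibre by fibre over (n, r), which fixes both the sum
    and the sum of squares of the tuple.\<close>
  also have "\<dots> = (\<Sum>p\<in>?P. \<Sum>u\<in>{u \<in> ?U. ?g u = p}. 1)"
    by (rule sum.group[symmetric, OF finU finP]) (rule image_subsetI, erule gU(1))
  also have "\<dots> = (\<Sum>(n, r)\<in>?P. if even r then 12 * hurwitz_H2 (4 * int n - r^2) else 12 *
      hurwitz_H (4 * int n - r^2))"
    by (rule sum.cong[OF refl]) (simp only: fib, auto simp: card_sq_sum_reps)
  also have "?P = ?E \<union> ?O" unfolding cond by auto
  also have "(\<Sum>(n, r)\<in>?E \<union> ?O. if even r then 12 * hurwitz_H2 (4 * int n - r^2) else 12 *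
      hurwitz_H (4 * int n - r^2)) =
     (\<Sum>(n, r)\<in>?E. if even r then 12 * hurwitz_H2 (4 * int n - r^2) else 12 *
         hurwitz_H (4 * int n - r^2)) +
     (\<Sum>(n, r)\<in>?O. if even r then 12 * hurwitz_H2 (4 * int n - r^2) else 12 * hurwitz_H (4 * int n - r^2))"
    unfolding cond by (rule sum.union_disjoint; (rule finite_subset[OF _ finP])?) auto
  also have "(\<Sum>(n, r)\<in>?E. if even r then 12 * hurwitz_H2 (4 * int n - r^2) else 12 *
      hurwitz_H (4 * int n - r^2)) =
     (\<Sum>(n, r)\<in>?E. 12 * hurwitz_H2 (4 * int n - r^2))"
    by (rule sum.cong) auto
  also have "(\<Sum>(n, r)\<in>?O. if even r then 12 * hurwitz_H2 (4 * int n - r^2) else 12 *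
      hurwitz_H (4 * int n - r^2)) =
     (\<Sum>(n, r)\<in>?O. 12 * hurwitz_H (4 * int n - r^2))"
    by (rule sum.cong) auto
  finally show ?thesis .
qed

end
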